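(* Let $d\ge 2$ and let $K\subset\mathbb{R}^d$ be a convex body with $o\in\operatorname{int}K$ in which a ball (of some positive radius) rolls freely. Let $\varrho$ be a probability density function on $K$ (with respect to Lebesgue measure) and let $q:\mathbb{R}\times S^{d-1}\to[0,\infty)$ be a locally integrable function. Assume that $\varrho$ is positive and continuous at each boundary point of $K$ and that $q$ is continuous at each point of $D_K=\{(t,u)\in[0,\infty)\times S^{d-1}: t=h_K(u)\}$. Let $K_{(n)}$ be the convex hull of $n$ independent random points in $K$, each with density $\varrho$. Then $$\operatorname{Var}_\varrho\bigl(W_q(K_{(n)})\bigr)\ll n^{-\frac{d+3}{d+1}},$$ where the implied constant depends only on $K$, $q$ and $\varrho$; that is, there is a constant $c>0$ depending only on $K$, $q$ and $\varrho$ such that $\operatorname{Var}_\varrho(W_q(K_{(n)}))\le c\,n^{-\frac{d+3}{d+1}}$ for all $n\in\mathbb{N}$.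
   Context: A convex body is a compact convex set with nonempty interior in $\mathbb{R}^d$; $o$ is the origin. $\mathcal{H}^{d-1}$ is $(d-1)$-dimensional Hausdorff measure, $\kappa_d$ is the volume of the $d$-dimensional unit ball. $h_M(u)=\max_{x\in M}\langle u,x\rangle$ is the support function of a nonempty compact convex set $M$. A ball $B$ rolls freely inside $K$ if for each boundary point $p$ of $K$ there is a translate $B+v$ with $p\in B+v$ and $B+v\subset K$. A nonnegative measurable function $q$ on $\mathbb{R}\times S^{d-1}$ is called locally integrable if $\int_{S^{d-1}}\int_C q(s,u)\,\mathrm{d}s\,\mathcal{H}^{d-1}(\mathrm{d}u)<\infty$ for all compact $C\subset\mathbb{R}$. The weighted mean width of a nonempty compact convex set $M$ is $$W_q(M)=\frac{2}{d\kappa_d}\int_{S^{d-1}}\int_0^{h_M(u)}q(s,u)\,\mathrm{d}s\,\mathcal{H}^{d-1}(\mathrm{d}u),$$ with the usual orientation convention $\int_0^{h}=-\int_h^0$ if $h<0$. $\operatorname{Var}_\varrho$ denotes variance when the points are i.i.d. with density $\varrho$. *)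

theory Defs
  imports "HOL-Probability.Probability"
begin

text \<open>
  The \<open>s\<close>-dimensional Hausdorff measure is normalised so that it agrees with Lebesgue measure
  when \<open>s\<close> is the dimension of the space. The empty set has weight 0 also for \<open>s = 0\<close>; covering
  sets are required to be bounded because \<^const>\<open>diameter\<close> is unspecified on unbounded sets.
\<close>

definition hausdorff_weight :: "nat \<Rightarrow> 'a::metric_space set \<Rightarrow> ennreal" where
  "hausdorff_weight s U =
     (if U = {} then 0 else ennreal (unit_ball_vol (real s) * (diameter U / 2) ^ s))"

definition hausdorff_pre :: "nat \<Rightarrow> real \<Rightarrow> 'a::metric_space set \<Rightarrow> ennreal" where
  "hausdorff_pre s \<delta> A =
     (INF U \<in> {U :: nat \<Rightarrow> 'a set. A \<subseteq> (\<Union>i. U i) \<and> (\<forall>i. bounded (U i) \<and> diameter (U i) \<le> \<delta>)}.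
        \<Sum>i. hausdorff_weight s (U i))"

definition hausdorff_outer :: "nat \<Rightarrow> 'a::metric_space set \<Rightarrow> ennreal" where
  "hausdorff_outer s A = (SUP \<delta> \<in> {0<..}. hausdorff_pre s \<delta> A)"

definition hausdorff_measure :: "nat \<Rightarrow> 'a::metric_space measure" where
  "hausdorff_measure s = measure_of UNIV (sets borel) (hausdorff_outer s)"

text \<open>
  As \<^const>\<open>measure_of\<close> yields the zero measure when its argument is not countably additive, we
  verify that the Hausdorff outer measure is countably additive on the Borel sets.
\<close>

lemma hausdorff_pre_mono: "A \<subseteq> B \<Longrightarrow> hausdorff_pre s \<delta> A \<le> hausdorff_pre s \<delta> B"
  unfolding hausdorff_pre_def by (rule INF_superset_mono) auto

lemma hausdorff_pre_antimono: "\<delta> \<le> \<epsilon> \<Longrightarrow> hausdorff_pre s \<epsilon> A \<le> hausdorff_pre s \<delta> A"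
  unfolding hausdorff_pre_def by (rule INF_superset_mono) (auto intro: order_trans)

lemma hausdorff_outer_mono: "A \<subseteq> B \<Longrightarrow> hausdorff_outer s A \<le> hausdorff_outer s B"
  unfolding hausdorff_outer_def by (intro SUP_mono) (auto intro: hausdorff_pre_mono)

lemma hausdorff_pre_le_outer: "0 < \<delta> \<Longrightarrow> hausdorff_pre s \<delta> A \<le> hausdorff_outer s A"
  unfolding hausdorff_outer_def by (intro SUP_upper) auto

lemma hausdorff_outer_empty [simp]: "hausdorff_outer s {} = 0"
proof -
  have "hausdorff_pre s \<delta> ({} :: 'a set) = 0" if "0 < \<delta>" for \<delta>
  proof -
    have "hausdorff_pre s \<delta> ({} :: 'a set) \<le> (\<Sum>i::nat. hausdorff_weight s ({} :: 'a set))"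
      unfolding hausdorff_pre_def using that by (intro INF_lower2[of "\<lambda>_. {}"]) auto
    then show ?thesis by (simp add: hausdorff_weight_def)
  qed
  then show ?thesis
    unfolding hausdorff_outer_def by (auto intro!: antisym SUP_least)
qed

lemma hausdorff_pre_UN: "hausdorff_pre s \<delta> (\<Union>i. A i) \<le> (\<Sum>i. hausdorff_pre s \<delta> (A i))"
proof (rule ennreal_le_epsilon)
  fix e :: real assume e: "0 < e" and fin: "(\<Sum>i. hausdorff_pre s \<delta> (A i)) < top"
  have *: "hausdorff_pre s \<delta> (A n) < hausdorff_pre s \<delta> (A n) + e * (1/2)^Suc n" for n
    using e fin by (auto simp add: less_top dest!: ennreal_suminf_lessD)
  have "\<exists>U. A n \<subseteq> (\<Union>i. U i) \<and> (\<forall>i::nat. bounded (U i) \<and> diameter (U i) \<le> \<delta>) \<and>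
       (\<Sum>i. hausdorff_weight s (U i)) < hausdorff_pre s \<delta> (A n) + e * (1/2)^Suc n" for n
    using *[of n] unfolding hausdorff_pre_def[of s \<delta> "A n"] INF_less_iff by auto
  then obtain B where B: "\<And>n. A n \<subseteq> (\<Union>i::nat. B n i)"
    "\<And>n i. bounded (B n i) \<and> diameter (B n i) \<le> \<delta>"
    and Ble: "\<And>n. (\<Sum>i. hausdorff_weight s (B n i)) < hausdorff_pre s \<delta> (A n) + e * (1/2)^Suc n"
    by metis
  define C where "C = case_prod B o prod_decode"
  have sub: "(\<Union>i. A i) \<subseteq> (\<Union>i. C i)"
    using B(1) by (auto simp add: C_def subset_eq) (metis prod.case prod_encode_inverse)
  have "hausdorff_pre s \<delta> (\<Union>i. A i) \<le> (\<Sum>i. hausdorff_weight s (C i))"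
    unfolding hausdorff_pre_def using sub B(2)
    by (intro INF_lower) (auto simp: C_def split: prod.splits)
  also have "\<dots> = (\<Sum>n. \<Sum>i. hausdorff_weight s (B n i))"
    unfolding C_def comp_def
    using suminf_ennreal_2dimen[of "\<lambda>n. \<Sum>i. hausdorff_weight s (B n i)"
        "\<lambda>(n, i). hausdorff_weight s (B n i)"]
    by (simp add: case_prod_unfold)
  also have "\<dots> \<le> (\<Sum>n. hausdorff_pre s \<delta> (A n) + e * (1/2) ^ Suc n)"
    using Ble by (intro suminf_le) (auto intro: less_imp_le)
  also have "\<dots> = (\<Sum>n. hausdorff_pre s \<delta> (A n)) + (\<Sum>n. ennreal e * ennreal ((1/2) ^ Suc n))"
    using \<open>0 < e\<close> by (subst suminf_add[symmetric])
      (auto simp del: ennreal_suminf_cmult simp add: ennreal_mult[symmetric])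
  also have "\<dots> = (\<Sum>n. hausdorff_pre s \<delta> (A n)) + e"
    unfolding ennreal_suminf_cmult
    by (subst suminf_ennreal_eq[OF zero_le_power power_half_series]) auto
  finally show "hausdorff_pre s \<delta> (\<Union>i. A i) \<le> (\<Sum>n. hausdorff_pre s \<delta> (A n)) + e" .
qed

lemma hausdorff_outer_UN: "hausdorff_outer s (\<Union>i. A i) \<le> (\<Sum>i. hausdorff_outer s (A i))"
  unfolding hausdorff_outer_def[of s "\<Union>i. A i"]
proof (rule SUP_least)
  fix \<delta> :: real assume "\<delta> \<in> {0<..}"
  then have "(\<Sum>i. hausdorff_pre s \<delta> (A i)) \<le> (\<Sum>i. hausdorff_outer s (A i))"
    by (intro suminf_le) (auto intro: hausdorff_pre_le_outer)
  then show "hausdorff_pre s \<delta> (\<Union>i. A i) \<le> (\<Sum>i. hausdorff_outer s (A i))"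
    using hausdorff_pre_UN order_trans by blast
qed

lemma outer_measure_space_hausdorff: "outer_measure_space UNIV (hausdorff_outer s)"
  by (simp add: outer_measure_space_def positive_def increasing_def countably_subadditive_def
      hausdorff_outer_mono hausdorff_outer_UN)

lemma hausdorff_outer_Un: "hausdorff_outer s (A \<union> B) \<le> hausdorff_outer s A + hausdorff_outer s B"
proof -
  interpret sigma_algebra UNIV UNIV using sigma_algebra_Pow[of UNIV] by simp
  have "subadditive UNIV (hausdorff_outer s)"
    using outer_measure_space_hausdorff[of s]
    by (auto simp: outer_measure_space_def intro: countably_subadditive_subadditive)
  then have "hausdorff_outer s (A \<union> (B - A)) \<le> hausdorff_outer s A + hausdorff_outer s (B - A)"
    by (rule subadditiveD) auto
  also have "\<dots> \<le> hausdorff_outer s A + hausdorff_outer s B"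
    by (intro add_left_mono hausdorff_outer_mono) auto
  finally show ?thesis by simp
qed

lemma hausdorff_pre_separated:
  assumes e: "\<delta> < e" and sep: "\<And>x y. x \<in> A \<Longrightarrow> y \<in> B \<Longrightarrow> e \<le> dist x y"
  shows "hausdorff_pre s \<delta> A + hausdorff_pre s \<delta> B \<le> hausdorff_pre s \<delta> (A \<union> B)"
  unfolding hausdorff_pre_def[of s \<delta> "A \<union> B"]
proof (rule INF_greatest)
  fix U :: "nat \<Rightarrow> 'a set"
  assume "U \<in> {U. A \<union> B \<subseteq> (\<Union>i. U i) \<and> (\<forall>i. bounded (U i) \<and> diameter (U i) \<le> \<delta>)}"
  then have U: "A \<union> B \<subseteq> (\<Union>i. U i)" "\<And>i. bounded (U i)" "\<And>i. diameter (U i) \<le> \<delta>"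
    by auto
  define V where "V C i = (if U i \<inter> C = {} then {} else U i)" for C i
  have V: "hausdorff_pre s \<delta> C \<le> (\<Sum>i. hausdorff_weight s (V C i))" if C: "C \<subseteq> A \<union> B" for C
  proof -
    have "C \<subseteq> (\<Union>i. V C i)"
    proof
      fix x assume x: "x \<in> C"
      then obtain i where "x \<in> U i" using U(1) C by blast
      then have "x \<in> V C i" using x by (auto simp: V_def)
      then show "x \<in> (\<Union>i. V C i)" by blast
    qed
    moreover have "0 \<le> \<delta>" using U(3) diameter_ge_0[OF U(2)] order_trans by blast
    ultimately show ?thesis
      unfolding hausdorff_pre_def using U(2,3) by (intro INF_lower) (auto simp: V_def)
  qed
  have "U i \<inter> A = {} \<or> U i \<inter> B = {}" for i
  proof (rule ccontr)
    assume "\<not> ?thesis"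
    then obtain x y where "x \<in> U i" "x \<in> A" "y \<in> U i" "y \<in> B" by auto
    then show False
      using diameter_bounded_bound[OF U(2)[of i], of x y] U(3)[of i] sep[of x y] e by auto
  qed
  then have "hausdorff_weight s (V A i) + hausdorff_weight s (V B i) \<le> hausdorff_weight s (U i)" for i
    by (cases "U i \<inter> A = {}"; cases "U i \<inter> B = {}") (auto simp: V_def hausdorff_weight_def)
  then have "(\<Sum>i. hausdorff_weight s (V A i)) + (\<Sum>i. hausdorff_weight s (V B i))
      \<le> (\<Sum>i. hausdorff_weight s (U i))"
    by (subst suminf_add) (auto intro!: suminf_le)
  then show "hausdorff_pre s \<delta> A + hausdorff_pre s \<delta> B \<le> (\<Sum>i. hausdorff_weight s (U i))"
    using add_mono[OF V[of A] V[of B]] order_trans by blast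
qed

lemma hausdorff_outer_separated:
  assumes e: "0 < e" and sep: "\<And>x y. x \<in> A \<Longrightarrow> y \<in> B \<Longrightarrow> e \<le> dist x y"
  shows "hausdorff_outer s A + hausdorff_outer s B \<le> hausdorff_outer s (A \<union> B)"
proof -
  have "hausdorff_outer s A + hausdorff_outer s B
      = (SUP \<delta> \<in> {0<..}. hausdorff_pre s \<delta> A + hausdorff_pre s \<delta> B)"
    unfolding hausdorff_outer_def
  proof (rule SUP_add_directed_ennreal[symmetric])
    fix i j :: real assume "i \<in> {0<..}" "j \<in> {0<..}"
    then show "\<exists>k\<in>{0<..}. hausdorff_pre s i A + hausdorff_pre s j B
        \<le> hausdorff_pre s k A + hausdorff_pre s k B"
      by (intro bexI[of _ "min i j"] add_mono hausdorff_pre_antimono) auto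
  qed
  also have "\<dots> \<le> hausdorff_outer s (A \<union> B)"
  proof (rule SUP_least)
    fix \<delta> :: real assume "\<delta> \<in> {0<..}"
    define m where "m = min \<delta> (e/2)"
    have m: "0 < m" "m < e" "m \<le> \<delta>" using e \<open>\<delta> \<in> _\<close> by (auto simp: m_def)
    have "hausdorff_pre s \<delta> A + hausdorff_pre s \<delta> B \<le> hausdorff_pre s m A + hausdorff_pre s m B"
      using m by (intro add_mono hausdorff_pre_antimono)
    also have "\<dots> \<le> hausdorff_pre s m (A \<union> B)"
      using m sep by (intro hausdorff_pre_separated)
    also have "\<dots> \<le> hausdorff_outer s (A \<union> B)"
      using m by (intro hausdorff_pre_le_outer)
    finally show "hausdorff_pre s \<delta> A + hausdorff_pre s \<delta> B \<le> hausdorff_outer s (A \<union> B)" .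
  qed
  finally show ?thesis .
qed

lemma hausdorff_outer_separated_sum:
  fixes R :: "nat \<Rightarrow> 'a::metric_space set"
  assumes sep: "\<And>i j. i < j \<Longrightarrow> \<exists>e>0. \<forall>x\<in>R i. \<forall>y\<in>R j. e \<le> dist x y"
  shows "(\<Sum>i<n. hausdorff_outer s (R i)) \<le> hausdorff_outer s (\<Union>i<n. R i)"
proof (induction n)
  case (Suc n)
  obtain e where e: "\<And>i. i < n \<Longrightarrow> e i > 0 \<and> (\<forall>x\<in>R i. \<forall>y\<in>R n. e i \<le> dist x y)"
  proof -
    have "\<exists>e. \<forall>i<n. e i > 0 \<and> (\<forall>x\<in>R i. \<forall>y\<in>R n. e i \<le> dist x y)"
    proof (intro choice allI)
      fix i
      show "\<exists>e. i < n \<longrightarrow> e > 0 \<and> (\<forall>x\<in>R i. \<forall>y\<in>R n. e \<le> dist x y)"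
        using sep[of i n] by (cases "i < n") auto
    qed
    then show thesis using that by blast
  qed
  define d where "d = Min (insert 1 (e ` {..<n}))"
  have d0: "d > 0" using e by (auto simp: d_def)
  have "d \<le> e i" if "i < n" for i using that by (auto simp: d_def)
  then have "hausdorff_outer s (\<Union>i<n. R i) + hausdorff_outer s (R n)
      \<le> hausdorff_outer s ((\<Union>i<n. R i) \<union> R n)"
    using e by (intro hausdorff_outer_separated[OF d0]) fastforce
  with add_right_mono[OF Suc.IH, of "hausdorff_outer s (R n)"]
  have "(\<Sum>i<n. hausdorff_outer s (R i)) + hausdorff_outer s (R n)
      \<le> hausdorff_outer s ((\<Union>i<n. R i) \<union> R n)"
    by (rule order_trans)
  then show ?case
    by (simp add: lessThan_Suc Un_commute add.commute)
qed simp

lemma closed_in_hausdorff_lambda_system: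
  assumes "closed (C :: 'a::metric_space set)"
  shows "C \<in> lambda_system UNIV UNIV (hausdorff_outer s)"
proof -
  have le: "hausdorff_outer s (C \<inter> A) + hausdorff_outer s (A - C) \<le> hausdorff_outer s A" for A
  proof (cases "C = {} \<or> hausdorff_outer s A = top")
    case True
    then show ?thesis by auto
  next
    case False
    define a where "a k = inverse (real (Suc k))" for k
    have a: "a k > 0" "j < k \<Longrightarrow> a k < a j" for j k by (auto simp: a_def)
    define D where "D n = {x \<in> A. a n < infdist x C}" for n
    define R where "R k = {x \<in> A. a (Suc k) < infdist x C \<and> infdist x C \<le> a k}" for k
    have RA: "R k \<subseteq> A" for k by (auto simp: R_def)
    have lip: "infdist x C \<le> infdist y C + dist x y" for x y
      by (rule infdist_triangle)
    have Rsep: "\<exists>e>0. \<forall>x\<in>R i. \<forall>y\<in>R j. e \<le> dist x y" if "Suc i < j" for i j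
    proof (intro exI conjI ballI)
      show "0 < a (Suc i) - a j" using a(2)[OF that] by simp
      fix x y assume "x \<in> R i" "y \<in> R j"
      then show "a (Suc i) - a j \<le> dist x y"
        using lip[of x y] by (auto simp: R_def)
    qed
    have half: "(\<Sum>i<n. hausdorff_outer s (R (2 * i + p))) \<le> hausdorff_outer s A" for n p
    proof -
      have "(\<Sum>i<n. hausdorff_outer s (R (2 * i + p))) \<le> hausdorff_outer s (\<Union>i<n. R (2 * i + p))"
        by (rule hausdorff_outer_separated_sum) (rule Rsep, simp)
      also have "\<dots> \<le> hausdorff_outer s A"
        using RA by (intro hausdorff_outer_mono) blast
      finally show ?thesis .
    qed
    have split: "(\<Sum>i<2*n. f i) = (\<Sum>i<n. f (2*i)) + (\<Sum>i<n. f (2*i+1))"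
      for f :: "nat \<Rightarrow> ennreal" and n
      by (induction n) (auto simp: algebra_simps)
    have "(\<Sum>i. hausdorff_outer s (R i)) \<le> hausdorff_outer s A + hausdorff_outer s A"
    proof (rule suminf_le_const)
      fix n
      have "(\<Sum>i<n. hausdorff_outer s (R i)) \<le> (\<Sum>i<2*n. hausdorff_outer s (R i))"
        by (intro sum_mono2) auto
      also have "\<dots> \<le> hausdorff_outer s A + hausdorff_outer s A"
        unfolding split using half[where p=0] half[where p=1] by (intro add_mono) auto
      finally show "(\<Sum>i<n. hausdorff_outer s (R i)) \<le> hausdorff_outer s A + hausdorff_outer s A" .
    qed simp
    also have "\<dots> < top"
      using False by (simp add: less_top[symmetric])
    finally have fin: "(\<Sum>i. hausdorff_outer s (R i)) < top" .
    have tail: "(\<lambda>n. \<Sum>i. hausdorff_outer s (R (i + n))) \<longlonglongrightarrow> 0"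
    proof -
      define r where "r i = enn2real (hausdorff_outer s (R i))" for i
      have r: "hausdorff_outer s (R i) = ennreal (r i)" for i
        using ennreal_suminf_lessD[OF fin, of i] by (simp add: r_def)
      have r0: "0 \<le> r i" for i by (simp add: r_def)
      have sr: "summable r"
        using fin r0 by (intro summable_suminf_not_top) (auto simp: r)
      have "(\<lambda>n. ennreal (\<Sum>i. r (i + n))) \<longlonglongrightarrow> ennreal 0"
        using suminf_exist_split2[OF sr] by (intro tendsto_ennrealI)
      moreover have "(\<Sum>i. hausdorff_outer s (R (i + n))) = ennreal (\<Sum>i. r (i + n))" for n
        using r0 sr by (simp add: r suminf_ennreal2 summable_ignore_initial_segment)
      ultimately show ?thesis by simp
    qed
    have bound: "hausdorff_outer s (C \<inter> A) + hausdorff_outer s (A - C)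
        \<le> hausdorff_outer s A + (\<Sum>i. hausdorff_outer s (R (i + n)))" for n
    proof -
      have "A - C \<subseteq> D n \<union> (\<Union>i. R (i + n))"
      proof
        fix x assume x: "x \<in> A - C"
        then have pos: "infdist x C > 0"
          using assms False in_closed_iff_infdist_zero[of C x] infdist_nonneg[of x C] by auto
        then obtain m where m: "a m < infdist x C"
          using reals_Archimedean[OF pos] by (auto simp: a_def)
        define m0 where "m0 = (LEAST m. a m < infdist x C)"
        have m0: "a m0 < infdist x C" unfolding m0_def using m by (rule LeastI)
        have least: "\<not> a k < infdist x C" if "k < m0" for k
          using that unfolding m0_def by (rule not_less_Least)
        show "x \<in> D n \<union> (\<Union>i. R (i + n))"
        proof (cases "m0 \<le> n")
          case True
          then have "a n \<le> a m0" by (auto simp: a_def)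
          then show ?thesis using m0 x by (auto simp: D_def)
        next
          case f: False
          define k where "k = m0 - 1"
          have k: "m0 = Suc k" "k = (k - n) + n" using f by (auto simp: k_def)
          have "x \<in> R k" using m0 least[of k] x k(1) by (auto simp: R_def)
          then have "x \<in> R ((k - n) + n)" using k(2) by simp
          then show ?thesis by blast
        qed
      qed
      then have "hausdorff_outer s (A - C) \<le> hausdorff_outer s (D n \<union> (\<Union>i. R (i + n)))"
        by (rule hausdorff_outer_mono)
      also have "\<dots> \<le> hausdorff_outer s (D n) + (\<Sum>i. hausdorff_outer s (R (i + n)))"
        by (rule order_trans[OF hausdorff_outer_Un add_left_mono[OF hausdorff_outer_UN]])
      finally have 1: "hausdorff_outer s (A - C)
          \<le> hausdorff_outer s (D n) + (\<Sum>i. hausdorff_outer s (R (i + n)))" .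
      have "hausdorff_outer s (C \<inter> A) + hausdorff_outer s (D n) \<le> hausdorff_outer s ((C \<inter> A) \<union> D n)"
      proof (rule hausdorff_outer_separated[OF a(1)[of n]])
        fix x y assume "x \<in> C \<inter> A" "y \<in> D n"
        then show "a n \<le> dist x y"
          using infdist_le[of x C y] by (auto simp: D_def dist_commute)
      qed
      also have "\<dots> \<le> hausdorff_outer s A"
        by (intro hausdorff_outer_mono) (auto simp: D_def)
      finally have 2: "hausdorff_outer s (C \<inter> A) + hausdorff_outer s (D n) \<le> hausdorff_outer s A" .
      show ?thesis
        using add_left_mono[OF 1, of "hausdorff_outer s (C \<inter> A)"]
          add_right_mono[OF 2, of "\<Sum>i. hausdorff_outer s (R (i + n))"]
        by (simp only: add.assoc)
    qed
    have "(\<lambda>n. hausdorff_outer s A + (\<Sum>i. hausdorff_outer s (R (i + n)))) \<longlonglongrightarrow> hausdorff_outer s A + 0"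
      by (intro tendsto_add tendsto_const tail)
    then show ?thesis
      using bound by (intro LIMSEQ_le_const[where X="\<lambda>n. hausdorff_outer s A + (\<Sum>i. hausdorff_outer s (R (i + n)))"]) auto
  qed
  have "hausdorff_outer s A \<le> hausdorff_outer s (C \<inter> A) + hausdorff_outer s (A - C)" for A
  proof -
    have "(C \<inter> A) \<union> (A - C) = A" by blast
    then show ?thesis using hausdorff_outer_Un[of s "C \<inter> A" "A - C"] by simp
  qed
  with le have eq: "hausdorff_outer s (C \<inter> A) + hausdorff_outer s (A - C) = hausdorff_outer s A" for A
    by (intro antisym)
  have "(UNIV - C) \<inter> A = A - C" for A by blast
  with eq have "hausdorff_outer s (C \<inter> A) + hausdorff_outer s ((UNIV - C) \<inter> A) = hausdorff_outer s A" for A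
    by simp
  then show ?thesis by (simp add: lambda_system_def)
qed

lemma measure_space_hausdorff:
  "measure_space UNIV (sets (borel :: 'a::metric_space measure)) (hausdorff_outer s)"
proof -
  interpret sigma_algebra UNIV UNIV using sigma_algebra_Pow[of UNIV] by simp
  let ?L = "lambda_system UNIV UNIV (hausdorff_outer s :: 'a set \<Rightarrow> ennreal)"
  have L: "measure_space UNIV ?L (hausdorff_outer s)"
    by (rule caratheodory_lemma[OF outer_measure_space_hausdorff])
  then interpret L: sigma_algebra UNIV ?L by (simp add: measure_space_def)
  have "sets (borel :: 'a measure) \<subseteq> ?L"
    unfolding borel_eq_closed using closed_in_hausdorff_lambda_system
    by (auto intro!: L.sigma_sets_subset)
  then show ?thesis
    using L sets.sigma_algebra_axioms[of "borel :: 'a measure"]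
    unfolding measure_space_def positive_def countably_additive_def by auto
qed

lemma space_hausdorff_measure [simp]: "space (hausdorff_measure s) = UNIV"
  by (simp add: hausdorff_measure_def)

lemma sets_hausdorff_measure [simp, measurable_cong]: "sets (hausdorff_measure s) = sets borel"
  by (simp add: hausdorff_measure_def) (metis sets.sigma_sets_eq space_borel)

lemma emeasure_hausdorff_measure:
  "A \<in> sets borel \<Longrightarrow> emeasure (hausdorff_measure s) A = hausdorff_outer s A"
  using measure_space_hausdorff[of s] unfolding hausdorff_measure_def measure_space_def
  by (intro emeasure_measure_of_sigma) auto

definition convex_body :: "'a::euclidean_space set \<Rightarrow> bool" where
  "convex_body K \<longleftrightarrow> convex K \<and> compact K \<and> interior K \<noteq> {}"

definition rolls_freely :: "'a::euclidean_space set \<Rightarrow> 'a set \<Rightarrow> bool" where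
  "rolls_freely B K \<longleftrightarrow> (\<forall>p \<in> frontier K. \<exists>v. p \<in> (+) v ` B \<and> (+) v ` B \<subseteq> K)"

definition support_fun :: "'a::euclidean_space set \<Rightarrow> 'a \<Rightarrow> real" where
  "support_fun M u = (SUP x\<in>M. u \<bullet> x)"

text \<open>
  A weight on \<open>\<real> \<times> S\<^sup>d\<^sup>-\<^sup>1\<close> is a function on \<^typ>\<open>real \<times> 'a\<close> whose values off
  \<^term>\<open>UNIV \<times> sphere 0 1\<close> are irrelevant.
\<close>

definition locally_integrable_weight :: "(real \<times> 'a::euclidean_space \<Rightarrow> real) \<Rightarrow> bool" where
  "locally_integrable_weight q \<longleftrightarrow>
     q \<in> borel_measurable (restrict_space borel (UNIV \<times> sphere 0 1)) \<and>
     (\<forall>s. \<forall>u \<in> sphere 0 1. 0 \<le> q (s, u)) \<and>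
     (\<forall>C. compact C \<longrightarrow>
        (\<integral>\<^sup>+u\<in>sphere 0 1. (\<integral>\<^sup>+s\<in>C. ennreal (q (s, u)) \<partial>lborel)
           \<partial>hausdorff_measure (DIM('a) - 1)) < \<infinity>)"

text \<open>The interval integral has the orientation convention built in.\<close>

definition weighted_mean_width :: "(real \<times> 'a::euclidean_space \<Rightarrow> real) \<Rightarrow> 'a set \<Rightarrow> real" where
  "weighted_mean_width q M =
     2 / (real DIM('a) * measure lborel (ball (0::'a) 1)) *
     (LINT u:sphere 0 1|hausdorff_measure (DIM('a) - 1). (LBINT s=0..support_fun M u. q (s, u)))"

definition support_graph :: "'a::euclidean_space set \<Rightarrow> (real \<times> 'a) set" where
  "support_graph K = {(t, u). 0 \<le> t \<and> u \<in> sphere 0 1 \<and> t = support_fun K u}"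

definition prob_density_on :: "'a::euclidean_space set \<Rightarrow> ('a \<Rightarrow> real) \<Rightarrow> bool" where
  "prob_density_on K \<rho> \<longleftrightarrow>
     \<rho> \<in> borel_measurable (restrict_space borel K) \<and> (\<forall>x\<in>K. 0 \<le> \<rho> x) \<and>
     (\<integral>\<^sup>+x\<in>K. ennreal (\<rho> x) \<partial>lborel) = 1"

definition iid_points :: "'a::euclidean_space set \<Rightarrow> ('a \<Rightarrow> real) \<Rightarrow> nat \<Rightarrow> (nat \<Rightarrow> 'a) measure" where
  "iid_points K \<rho> n = (\<Pi>\<^sub>M i\<in>{..<n}. density lborel (\<lambda>x. ennreal (\<rho> x) * indicator K x))"

definition random_polytope :: "nat \<Rightarrow> (nat \<Rightarrow> 'a::euclidean_space) \<Rightarrow> 'a set" where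
  "random_polytope n x = convex hull (x ` {..<n})"

end

theory Submission
  imports Defs "HOL-Real_Asymp.Real_Asymp"
begin

text \<open>
  By the Efron--Stein inequality the variance is at most \<open>n\<close> times the expected square of the
  increment of \<open>W\<^sub>q\<close> caused by adding one point \<open>y\<close> to \<open>m = n - 1\<close> points. In direction \<open>u\<close> the
  increment is governed by the gap \<open>T(u)\<close> between the support functions of \<open>K\<close> and of the polytope,
  and it vanishes unless \<open>y\<close> lies in the cap of height \<open>T(u)\<close>. Writing the square as a double
  integral over directions \<open>u, v\<close> with \<open>T(v) \<le> T(u)\<close>, the rolling ball confines \<open>v\<close> to a
  spherical cap of radius of order \<open>sqrt (T(u))\<close>, which leaves the single integral of
  \<open>T(u)^((d+3)/2)\<close> over the caps containing \<open>y\<close>. The rolling ball also bounds the probability \<open>G(t)\<close> of a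
  cap of height \<open>t\<close> from below by a multiple of \<open>t^((d+1)/2)\<close>. No upper bound for \<open>G\<close> is available
  (\<open>K\<close> may have flat parts), but none is needed: the expectation over \<open>y\<close> contributes the factor
  \<open>G(T)\<close>, and \<open>G(T)\<close> is stochastically at most the minimum of \<open>m\<close> uniform variables, whose moment
  of order \<open>1 + (d+3)/(d+1)\<close> decays like the corresponding power of \<open>1/m\<close>.
\<close>

section \<open>Hausdorff measure of spherical caps\<close>

text \<open>Only orders of magnitude matter, so surface and volume are estimated by crude coverings
  and translations, never computed. The exponents fit together as follows. With
  \<open>b = (d+3)/(d+1)\<close>, \<open>(d+3)/2 = 2 + (d-1)/2\<close>: two factors T come from the
  square and \<open>T^((d-1)/2)\<close> from the area of the spherical cap. Since G(T) is at least a
  multiple of \<open>T^((d+1)/2)\<close>, the power \<open>T^((d+3)/2)\<close> is at most a multiple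
  of \<open>G(T)^b\<close>. Together with the factor G(T) for the added point, this gives a moment
  of order \<open>1 + b\<close>; the surplus 1/m pays for the n terms of the Efron-Stein sum. The
  obstacle is that q and the density are controlled only near the boundary. Both the bound on q and
  the lower bound on G therefore hold only for small T. The event that some direction has a large
  gap is contained in a set of exponentially small probability, obtained from a finite net of
  directions. On that set the increment is bounded merely by twice the largest possible width, which
  is finite by local integrability.\<close>

lemma hausdorff_pre_le_sum:
  fixes U :: "'i \<Rightarrow> 'a::metric_space set"
  assumes I: "finite I" and cover: "A \<subseteq> (\<Union>i\<in>I. U i)" and \<delta>: "0 \<le> \<delta>"
    and U: "\<And>i. i \<in> I \<Longrightarrow> bounded (U i)" "\<And>i. i \<in> I \<Longrightarrow> diameter (U i) \<le> \<delta>"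
  shows "hausdorff_pre s \<delta> A \<le> (\<Sum>i\<in>I. hausdorff_weight s (U i))"
proof -
  obtain f where f: "bij_betw f {0..<card I} I"
    using ex_bij_betw_nat_finite[OF I] by blast
  \<comment> \<open>Padding a finite cover with empty sets costs nothing, as
    \<open>hausdorff_weight\<close> gives the empty set 0 even for s = 0.\<close>
  define V where "V k = (if k < card I then U (f k) else {})" for k
  have fI: "f k \<in> I" if "k < card I" for k
    using f that by (auto simp: bij_betw_def)
  have "A \<subseteq> (\<Union>k. V k)"
  proof
    fix x assume "x \<in> A"
    then obtain i where i: "i \<in> I" "x \<in> U i" using cover by blast
    then obtain k where "k < card I" "f k = i" using f unfolding bij_betw_def by (metis atLeastLessThan_iff imageE)
    then have "x \<in> V k" using i by (simp add: V_def)
    then show "x \<in> (\<Union>k. V k)" by blast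
  qed
  then have "hausdorff_pre s \<delta> A \<le> (\<Sum>k. hausdorff_weight s (V k))"
    unfolding hausdorff_pre_def using fI U \<delta> by (intro INF_lower) (simp add: V_def)
  also have "\<dots> = (\<Sum>k\<in>{0..<card I}. hausdorff_weight s (V k))"
    by (rule suminf_finite) (auto simp: V_def hausdorff_weight_def)
  also have "\<dots> = (\<Sum>k\<in>{0..<card I}. hausdorff_weight s (U (f k)))"
    by (simp add: V_def)
  also have "\<dots> = (\<Sum>i\<in>I. hausdorff_weight s (U i))"
    by (rule sum.reindex_bij_betw[OF f])
  finally show ?thesis .
qed

text \<open>On the part of the sphere where \<open>\<bar>v \<bullet> b\<bar> \<ge> 1/d\<close>, the coordinate along \<open>b\<close> is a Lipschitz function of the
  other \<open>d - 1\<close> coordinates, so a grid in the latter yields a covering by small sets.\<close>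

lemma sphere_grid_cell_diameter:
  fixes v v' b :: "'a::euclidean_space" and e \<sigma> :: real
  assumes v: "norm v = 1" "norm v' = 1" and b: "b \<in> Basis"
    and \<sigma>: "\<sigma> \<in> {1, -1}"
    and vb: "1 / DIM('a) \<le> \<sigma> * (v \<bullet> b)" "1 / DIM('a) \<le> \<sigma> * (v' \<bullet> b)"
    and close: "\<And>i. i \<in> Basis - {b} \<Longrightarrow> \<bar>v \<bullet> i - v' \<bullet> i\<bar> \<le> e" and e: "0 \<le> e"
  shows "norm (v - v') \<le> (DIM('a) + DIM('a) ^ 2) * e"
proof -
  let ?d = "real DIM('a)"
  have d: "?d \<ge> 1" by (simp add: Suc_leI)
  have le1: "\<bar>x \<bullet> i\<bar> \<le> 1" if "norm x = 1" "i \<in> Basis" for x i :: 'a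
    using Basis_le_norm[OF that(2), of x] that by simp
  have sq: "(\<Sum>i\<in>Basis. (x \<bullet> i)^2) = 1" if "norm x = 1" for x :: 'a
    using that euclidean_inner[of x x] by (simp add: norm_eq_1 power2_eq_square)
  have split: "(x \<bullet> b)^2 = 1 - (\<Sum>i\<in>Basis - {b}. (x \<bullet> i)^2)" if "norm x = 1" for x :: 'a
    using sq[OF that] b by (simp add: sum.remove[of Basis b])
  have "(v \<bullet> b)^2 - (v' \<bullet> b)^2 = (\<Sum>i\<in>Basis - {b}. (v' \<bullet> i)^2 - (v \<bullet> i)^2)"
    using split v by (simp add: sum_subtractf)
  also have "\<bar>\<dots>\<bar> \<le> (\<Sum>i\<in>Basis - {b}. \<bar>(v' \<bullet> i)^2 - (v \<bullet> i)^2\<bar>)"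
    by (rule sum_abs)
  also have "\<dots> \<le> (\<Sum>i\<in>Basis - {b}. 2 * e)"
  proof (rule sum_mono)
    fix i assume i: "i \<in> Basis - {b}"
    have "\<bar>(v' \<bullet> i)^2 - (v \<bullet> i)^2\<bar> = \<bar>v' \<bullet> i + v \<bullet> i\<bar> * \<bar>v \<bullet> i - v' \<bullet> i\<bar>"
      by (simp add: abs_mult[symmetric] power2_eq_square algebra_simps abs_minus_commute)
    also have "\<dots> \<le> 2 * e"
      using le1[OF v(1), of i] le1[OF v(2), of i] i close[OF i] by (intro mult_mono) auto
    finally show "\<bar>(v' \<bullet> i)^2 - (v \<bullet> i)^2\<bar> \<le> 2 * e" .
  qed
  also have "\<dots> \<le> 2 * e * ?d"
    using e b by (simp add: algebra_simps)
  finally have A: "\<bar>(v \<bullet> b)^2 - (v' \<bullet> b)^2\<bar> \<le> 2 * e * ?d" .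
  \<comment> \<open>Both coordinates along b have sign \<sigma> and modulus at least 1/d, so their
    sum has modulus at least 2/d; the bound on the difference of squares can be divided by
    it.\<close>
  have "2 / ?d * \<bar>v \<bullet> b - v' \<bullet> b\<bar> \<le> \<bar>v \<bullet> b + v' \<bullet> b\<bar> * \<bar>v \<bullet> b - v' \<bullet> b\<bar>"
    using \<sigma> vb by (intro mult_right_mono) auto
  also have "\<dots> = \<bar>(v \<bullet> b)^2 - (v' \<bullet> b)^2\<bar>"
    by (simp add: abs_mult[symmetric] power2_eq_square algebra_simps)
  finally have "2 / ?d * \<bar>v \<bullet> b - v' \<bullet> b\<bar> \<le> 2 * e * ?d" using A by simp
  then have B: "\<bar>v \<bullet> b - v' \<bullet> b\<bar> \<le> ?d^2 * e"
    using d by (simp add: field_simps power2_eq_square)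
  have "norm (v - v') \<le> (\<Sum>i\<in>Basis. \<bar>(v - v') \<bullet> i\<bar>)" by (rule norm_le_l1)
  also have "\<dots> = \<bar>v \<bullet> b - v' \<bullet> b\<bar> + (\<Sum>i\<in>Basis - {b}. \<bar>v \<bullet> i - v' \<bullet> i\<bar>)"
    using b by (simp add: sum.remove[of Basis b] inner_diff_left)
  also have "\<dots> \<le> ?d^2 * e + (\<Sum>i\<in>Basis - {b}. e)"
    by (intro add_mono B sum_mono close)
  also have "\<dots> \<le> ?d^2 * e + ?d * e"
    using e b by (simp add: mult_right_mono)
  finally show ?thesis by (simp add: algebra_simps)
qed

text \<open>Cutting d - 1 coordinates into pieces of length 2s/m yields about \<open>m^(d-1)\<close>
  cells of diameter O(s/m), so the weights add up to \<open>O(s^(d-1))\<close> uniformly in m. The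
  factor 2d counts the choices of the distinguished axis and its sign. The centre w is an arbitrary
  point of the space.\<close>

lemma hausdorff_outer_sphere_cap:
  fixes w :: "'a::euclidean_space" and s :: real
  assumes s: "0 < s"
  defines "k \<equiv> DIM('a) - 1"
  shows "hausdorff_outer k (sphere 0 1 \<inter> cball w s)
    \<le> ennreal (2 * DIM('a) * unit_ball_vol k * (2 * (real DIM('a) + DIM('a) ^ 2) * s) ^ k)"
  unfolding hausdorff_outer_def
proof (rule SUP_least)
  let ?d = "real DIM('a)" and ?A = "sphere 0 1 \<inter> cball w s"
  let ?L = "2 * (real DIM('a) + DIM('a) ^ 2) * s"
  fix \<delta> :: real assume "\<delta> \<in> {0<..}"
  then have \<delta>: "\<delta> > 0" by simp
  have d: "?d \<ge> 1" by (simp add: Suc_leI)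
  obtain m :: nat where m: "?L / \<delta> < real m" using reals_Archimedean2 by blast
  have L0: "0 < ?L" using s d by (simp add: add_pos_nonneg)
  have "0 < real m" using m L0 \<delta> by (metis divide_pos_pos less_trans)
  then have m0: "m > 0" by simp
  have m\<delta>: "?L / m \<le> \<delta>" using m \<delta> m0 by (simp add: field_simps)
  define e where "e = 2 * s / m"
  have e0: "0 < e" using s m0 by (simp add: e_def)
  \<comment> \<open>Cell numbers include m: a coordinate at the far end of its range of length 2s
    has floor exactly m.\<close>
  define I where "I = (SIGMA b:(Basis::'a set). {1, -1::real} \<times> ((Basis - {b}) \<rightarrow>\<^sub>E {0..m}))"
  define U where "U = (\<lambda>(b::'a, \<sigma>::real, f :: 'a \<Rightarrow> nat). {v \<in> sphere 0 1. 1 / ?d \<le> \<sigma> * (v \<bullet> b) \<and>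
    (\<forall>i\<in>Basis - {b}. real (f i) * e \<le> v \<bullet> i - w \<bullet> i + s \<and> v \<bullet> i - w \<bullet> i + s \<le> (real (f i) + 1) * e)})"
  have finI: "finite I" unfolding I_def by (intro finite_SigmaI finite_cartesian_product finite_PiE) auto
  have cardI: "card I = DIM('a) * (2 * (m + 1) ^ k)"
    unfolding I_def by (subst card_SigmaI) (auto simp: finite_PiE card_cartesian_product card_PiE k_def)
  have diam: "norm (v - v') \<le> ?L / m" if i: "i \<in> I" and v: "v \<in> U i" "v' \<in> U i" for i v v'
  proof -
    obtain b \<sigma> f where [simp]: "i = (b, \<sigma>, f)" by (cases i)
    have b: "b \<in> Basis" "\<sigma> \<in> {1, -1}" using i by (auto simp: I_def)
    have "norm (v - v') \<le> (DIM('a) + DIM('a) ^ 2) * e"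
    proof (rule sphere_grid_cell_diameter[where b = b and \<sigma> = \<sigma>])
      fix j assume j: "j \<in> Basis - {b}"
      then have "real (f j) * e \<le> v \<bullet> j - w \<bullet> j + s" "v \<bullet> j - w \<bullet> j + s \<le> (real (f j) + 1) * e"
        "real (f j) * e \<le> v' \<bullet> j - w \<bullet> j + s" "v' \<bullet> j - w \<bullet> j + s \<le> (real (f j) + 1) * e"
        using v unfolding U_def by (auto simp only: split_conv mem_Collect_eq \<open>i = (b, \<sigma>, f)\<close>)
      then show "\<bar>v \<bullet> j - v' \<bullet> j\<bar> \<le> e" unfolding distrib_right by linarith
    qed (use v b e0 in \<open>auto simp: U_def\<close>)
    then show ?thesis by (simp add: e_def field_simps)
  qed
  have bdd: "bounded (U i)" for i
    by (rule bounded_subset[OF bounded_sphere[of 0 1]]) (auto simp: U_def split: prod.splits)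
  have diamU: "diameter (U i) \<le> ?L / m" if "i \<in> I" for i
    using diam[OF that] L0 by (intro diameter_le) auto
  have cover: "?A \<subseteq> (\<Union>i\<in>I. U i)"
  proof
    fix v assume v: "v \<in> ?A"
    \<comment> \<open>Pigeonhole: the d absolute coordinates add up to at least the Euclidean norm,
      which is 1.\<close>
    have "\<exists>b\<in>Basis. 1 / ?d \<le> \<bar>v \<bullet> b\<bar>"
    proof (rule ccontr)
      assume "\<not> ?thesis"
      then have "(\<Sum>b\<in>Basis. \<bar>v \<bullet> b\<bar>) < (\<Sum>b\<in>(Basis::'a set). 1 / ?d)"
        by (intro sum_strict_mono) auto
      then show False using norm_le_l1[of v] v by auto
    qed
    then obtain b where b: "b \<in> Basis" "1 / ?d \<le> \<bar>v \<bullet> b\<bar>" by blast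
    define \<sigma> where "\<sigma> = (if v \<bullet> b \<ge> 0 then 1 else -1::real)"
    define f where "f = restrict (\<lambda>i. nat \<lfloor>(v \<bullet> i - w \<bullet> i + s) / e\<rfloor>) (Basis - {b})"
    have bnd: "0 \<le> v \<bullet> i - w \<bullet> i + s" "v \<bullet> i - w \<bullet> i + s \<le> 2 * s" if "i \<in> Basis" for i
      using Basis_le_norm[OF that, of "v - w"] v by (auto simp: dist_norm inner_diff_left norm_minus_commute)
    have "f i \<le> m" if "i \<in> Basis - {b}" for i
    proof -
      have "(v \<bullet> i - w \<bullet> i + s) / e \<le> m"
        using divide_right_mono[OF bnd(2)[of i], of e] that e0 m0 s by (simp add: e_def)
      then show ?thesis using that by (simp add: f_def nat_le_iff floor_le_iff)
    qed
    then have "(b, \<sigma>, f) \<in> I" using b by (auto simp: I_def \<sigma>_def f_def)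
    moreover have "v \<in> U (b, \<sigma>, f)"
    proof -
      have "real (f i) * e \<le> v \<bullet> i - w \<bullet> i + s \<and> v \<bullet> i - w \<bullet> i + s \<le> (real (f i) + 1) * e"
        if i: "i \<in> Basis - {b}" for i
      proof -
        have nn: "0 \<le> (v \<bullet> i - w \<bullet> i + s) / e" using bnd[of i] i e0 by simp
        have "real (f i) = of_int \<lfloor>(v \<bullet> i - w \<bullet> i + s) / e\<rfloor>"
          using i nn by (simp add: f_def)
        then have "real (f i) \<le> (v \<bullet> i - w \<bullet> i + s) / e" "(v \<bullet> i - w \<bullet> i + s) / e \<le> real (f i) + 1"
          by linarith+
        then show ?thesis using e0 by (simp add: field_simps)
      qed
      then show ?thesis using v b by (auto simp: U_def \<sigma>_def abs_if split: if_splits)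
    qed
    ultimately show "v \<in> (\<Union>i\<in>I. U i)" by blast
  qed
  have "hausdorff_pre k \<delta> ?A \<le> (\<Sum>i\<in>I. hausdorff_weight k (U i))"
    using \<delta> diamU m\<delta> by (intro hausdorff_pre_le_sum finI cover bdd) (auto intro: order_trans)
  also have "\<dots> \<le> (\<Sum>i\<in>I. ennreal (unit_ball_vol k * (?L / m / 2) ^ k))"
  proof (rule sum_mono)
    fix i assume i: "i \<in> I"
    show "hausdorff_weight k (U i) \<le> ennreal (unit_ball_vol k * (?L / m / 2) ^ k)"
      unfolding hausdorff_weight_def using diamU[OF i] diameter_ge_0[OF bdd[of i]]
      by (auto intro!: ennreal_leI mult_left_mono power_mono)
  qed
  also have "\<dots> = ennreal (card I * (unit_ball_vol k * (?L / m / 2) ^ k))"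
    using L0 by (subst sum_constant) (simp add: ennreal_mult' ennreal_of_nat_eq_real_of_nat)
  also have "\<dots> \<le> ennreal (2 * DIM('a) * unit_ball_vol k * ?L ^ k)"
  proof (rule ennreal_leI)
    have "real (card I) * (unit_ball_vol k * a ^ k)
        = 2 * DIM('a) * unit_ball_vol k * ((real m + 1) * a) ^ k" for a
      unfolding cardI by (simp add: power_mult_distrib add.commute)
    then have "real (card I) * (unit_ball_vol k * (?L / m / 2) ^ k)
        = 2 * DIM('a) * unit_ball_vol k * ((real m + 1) * (?L / m / 2)) ^ k" .
    also have "\<dots> \<le> 2 * DIM('a) * unit_ball_vol k * ?L ^ k"
    proof -
      \<comment> \<open>The weight uses half the diameter, and this factor 1/2 absorbs the surplus
        cell through m + 1 \<le> 2m.\<close>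
      have "(real m + 1) * (?L / m / 2) = ?L * ((real m + 1) / (2 * m))"
        by (simp add: mult.commute)
      also have "\<dots> \<le> ?L * 1"
        using m0 L0 by (intro mult_left_mono) (auto simp: field_simps)
      finally show ?thesis using L0 by (intro mult_left_mono power_mono) auto
    qed
    finally show "real (card I) * (unit_ball_vol k * (?L / m / 2) ^ k)
      \<le> 2 * DIM('a) * unit_ball_vol k * ?L ^ k" .
  qed
  finally show "hausdorff_pre k \<delta> ?A \<le> ennreal (2 * DIM('a) * unit_ball_vol k * ?L ^ k)" .
qed

section \<open>Surface measure on the unit sphere\<close>

definition sphere_measure :: "'a::euclidean_space measure" where
  "sphere_measure = restrict_space (hausdorff_measure (DIM('a) - 1)) (sphere 0 1)"

lemma space_sphere_measure [simp]: "space sphere_measure = sphere 0 1"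
  by (simp add: sphere_measure_def space_restrict_space)

lemma sets_sphere_measure [measurable_cong]: "sets sphere_measure = sets (restrict_space borel (sphere 0 1))"
  unfolding sphere_measure_def by (rule sets_restrict_space_cong) simp

lemma borel_measurable_sphere_measure: "f \<in> borel_measurable borel \<Longrightarrow> f \<in> borel_measurable sphere_measure"
  unfolding measurable_cong_sets[OF sets_sphere_measure refl] by (rule measurable_restrict_space1)

lemma ident_sphere_measure: "(\<lambda>u. u) \<in> sphere_measure \<rightarrow>\<^sub>M borel"
  by (intro borel_measurable_sphere_measure) simp

text \<open>The constant of \<open>hausdorff_outer_sphere_cap\<close> with the power of the radius
  split off. It depends on the dimension alone, hence the type argument.\<close>

definition sphere_cap_const :: "'a::euclidean_space itself \<Rightarrow> real" where
  "sphere_cap_const _ = 2 * DIM('a) * unit_ball_vol (DIM('a) - 1) * (2 * (real DIM('a) + DIM('a) ^ 2)) ^ (DIM('a) - 1)"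

lemma sphere_cap_const_nonneg: "0 \<le> sphere_cap_const TYPE('a::euclidean_space)"
  by (simp add: sphere_cap_const_def)

lemma emeasure_sphere_measure_cap:
  fixes w :: "'a::euclidean_space"
  assumes "0 < s" "A \<subseteq> sphere 0 1 \<inter> cball w s"
  shows "emeasure sphere_measure A \<le> ennreal (sphere_cap_const TYPE('a) * s ^ (DIM('a) - 1))"
proof -
  let ?C = "sphere 0 1 \<inter> cball w s"
  have C: "?C \<in> sets borel" by simp
  \<comment> \<open>A may be non-measurable; monotonicity asks for measurability of the larger set
    only.\<close>
  have "emeasure sphere_measure A \<le> emeasure sphere_measure ?C"
    using assms C by (intro emeasure_mono) (auto simp: sets_sphere_measure sets_restrict_space)
  also have "\<dots> = emeasure (hausdorff_measure (DIM('a) - 1)) ?C"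
    unfolding sphere_measure_def by (rule emeasure_restrict_space) auto
  also have "\<dots> = hausdorff_outer (DIM('a) - 1) ?C" by (rule emeasure_hausdorff_measure[OF C])
  also have "\<dots> \<le> ennreal (sphere_cap_const TYPE('a) * s ^ (DIM('a) - 1))"
    using hausdorff_outer_sphere_cap[OF assms(1), of w]
    by (simp add: sphere_cap_const_def power_mult_distrib mult_ac)
  finally show ?thesis .
qed

text \<open>The sphere is the cap of radius 1 around 0. Finiteness makes Fubini available, which
  fails to apply to the ambient Hausdorff measure because that is not sigma-finite.\<close>

lemma finite_measure_sphere_measure: "finite_measure (sphere_measure :: 'a::euclidean_space measure)"
proof
  have "emeasure sphere_measure (space sphere_measure :: 'a set) \<le> ennreal (sphere_cap_const TYPE('a) * 1 ^ (DIM('a) - 1))"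
    by (rule emeasure_sphere_measure_cap[where w = 0]) auto
  then have "emeasure sphere_measure (space sphere_measure :: 'a set) < top"
    by (rule order_le_less_trans) simp
  then show "emeasure sphere_measure (space sphere_measure :: 'a set) \<noteq> \<infinity>" by simp
qed

interpretation sphere: finite_measure "sphere_measure :: 'a::euclidean_space measure"
  by (rule finite_measure_sphere_measure)

section \<open>The Efron--Stein inequality\<close>

text \<open>Moving the centre from the mean to c adds the squared offset. Hence the variance is the
  least mean square deviation, and c = 0 gives Jensen's inequality for squares.\<close>

lemma (in prob_space) expectation_square_diff:
  fixes Z :: "'a \<Rightarrow> real"
  assumes Z: "Z \<in> borel_measurable M" and bnd: "\<And>x. x \<in> space M \<Longrightarrow> \<bar>Z x\<bar> \<le> B"
  shows "expectation (\<lambda>x. (Z x - c)^2) = variance Z + (expectation Z - c)^2"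
proof -
  have i1: "integrable M Z"
    using bnd by (intro integrable_const_bound[where B = B] Z AE_I2) auto
  have i2: "integrable M (\<lambda>x. (Z x)^2)"
    using power_mono[OF bnd abs_ge_zero, of _ 2] Z
    by (intro integrable_const_bound[where B = "B^2"] AE_I2) auto
  have "expectation (\<lambda>x. (Z x - a)^2) = expectation (\<lambda>x. (Z x)^2) - 2 * a * expectation Z + a^2" for a
  proof -
    have "expectation (\<lambda>x. (Z x - a)^2) = expectation (\<lambda>x. (Z x)^2 - 2 * a * Z x + a^2)"
      by (simp add: power2_diff algebra_simps)
    also have "\<dots> = expectation (\<lambda>x. (Z x)^2) - 2 * a * expectation Z + a^2"
      using i1 i2 by (simp add: prob_space)
    finally show ?thesis .
  qed
  note this[of c] this[of "expectation Z"]
  then show ?thesis by (simp add: power2_diff) (simp add: power2_eq_square)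
qed

lemma (in prob_space) expectation_square_le:
  fixes Z :: "'a \<Rightarrow> real"
  assumes "Z \<in> borel_measurable M" "\<And>x. x \<in> space M \<Longrightarrow> \<bar>Z x\<bar> \<le> B"
  shows "(expectation Z)^2 \<le> expectation (\<lambda>x. (Z x)^2)"
  using expectation_square_diff[OF assms, of 0] variance_positive[of Z] by simp

text \<open>Induction on the coordinates through the law of total variance for the last one.
  \<open>G i\<close> may be any bounded measurable function that ignores coordinate i, such as a
  leave-one-out statistic; it need not be a conditional expectation. Uniform bounds settle all
  integrability questions.\<close>

lemma Efron_Stein:
  fixes F :: "('i \<Rightarrow> 'b) \<Rightarrow> real" and G :: "'i \<Rightarrow> ('i \<Rightarrow> 'b) \<Rightarrow> real"
  assumes M: "prob_space M" and I: "finite I"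
    and F: "F \<in> borel_measurable (\<Pi>\<^sub>M i\<in>I. M)" "\<And>x. x \<in> space (\<Pi>\<^sub>M i\<in>I. M) \<Longrightarrow> \<bar>F x\<bar> \<le> B"
    and G: "\<And>i. i \<in> I \<Longrightarrow> G i \<in> borel_measurable (\<Pi>\<^sub>M i\<in>I. M)"
      "\<And>i x. i \<in> I \<Longrightarrow> x \<in> space (\<Pi>\<^sub>M i\<in>I. M) \<Longrightarrow> \<bar>G i x\<bar> \<le> B"
    and indep: "\<And>i x y. i \<in> I \<Longrightarrow> G i (x(i := y)) = G i x"
  shows "prob_space.variance (\<Pi>\<^sub>M i\<in>I. M) F \<le> (\<Sum>i\<in>I. \<integral>x. (F x - G i x)^2 \<partial>(\<Pi>\<^sub>M i\<in>I. M))"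
  using I F G indep
proof (induction I arbitrary: F G rule: finite_induct)
  case empty
  interpret P: prob_space "\<Pi>\<^sub>M i\<in>({}::'i set). M" by (rule prob_space_PiM) auto
  have "P.expectation F = P.expectation (\<lambda>_. F (\<lambda>_. undefined))"
    by (rule Bochner_Integration.integral_cong) (auto simp: space_PiM)
  then have "P.expectation F = F (\<lambda>_. undefined)" by (simp add: P.prob_space)
  then have "P.variance F = P.expectation (\<lambda>_. 0)"
    by (intro Bochner_Integration.integral_cong[OF refl]) (simp add: space_PiM)
  then show ?case by simp
next
  case (insert j I)
  interpret M: prob_space M by fact
  interpret P: prob_space "\<Pi>\<^sub>M i\<in>I. M" by (rule prob_space_PiM) (rule M)
  interpret Q: prob_space "\<Pi>\<^sub>M i\<in>insert j I. M" by (rule prob_space_PiM) (rule M)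
  interpret pp: product_prob_space "\<lambda>_. M" "insert j I" by unfold_locales
  interpret PM: pair_prob_space "\<Pi>\<^sub>M i\<in>I. M" M ..
  let ?P = "\<Pi>\<^sub>M i\<in>I. M" and ?Q = "\<Pi>\<^sub>M i\<in>insert j I. M"
  note [measurable] = insert.prems(1)
  have Gm[measurable]: "G i \<in> borel_measurable ?Q" if "i \<in> insert j I" for i
    using insert.prems(3) that .
  have upd: "x(j := y) \<in> space ?Q" if "x \<in> space ?P" "y \<in> space M" for x y
    using that by (auto simp: space_PiM PiE_def extensional_def)
  have upd_meas[measurable]: "(\<lambda>p. (fst p)(j := snd p)) \<in> measurable (?P \<Otimes>\<^sub>M M) ?Q"
    using measurable_add_dim[of j I "\<lambda>_. M"] by (simp add: case_prod_unfold)
  have upd1[measurable]: "(\<lambda>x. x(j := y)) \<in> measurable ?P ?Q" if "y \<in> space M" for y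
    using measurable_compose[OF measurable_Pair[OF measurable_ident_sets[OF refl] measurable_const[OF that]] upd_meas]
    by simp
  have split: "Q.expectation h = (\<integral>y. (\<integral>x. h (x(j := y)) \<partial>?P) \<partial>M)"
    and int2: "integrable M (\<lambda>y. \<integral>x. h (x(j := y)) \<partial>?P)"
    if h: "h \<in> borel_measurable ?Q" "\<And>x. x \<in> space ?Q \<Longrightarrow> \<bar>h x\<bar> \<le> C" for h :: "_ \<Rightarrow> real" and C
  proof -
    note [measurable] = h(1)
    have "integrable ?Q h" using h by (intro Q.integrable_const_bound[where B = C]) auto
    then have "Q.expectation h = (\<integral>x. (\<integral>y. h (x(j := y)) \<partial>M) \<partial>?P)"
      using insert.hyps by (intro pp.product_integral_insert)
    moreover have i: "integrable (?P \<Otimes>\<^sub>M M) (\<lambda>(x, y). h (x(j := y)))"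
      using h(2) upd
      by (intro PM.integrable_const_bound[where B = C]) (auto simp: space_pair_measure case_prod_unfold)
    ultimately show "Q.expectation h = (\<integral>y. (\<integral>x. h (x(j := y)) \<partial>?P) \<partial>M)"
      using PM.Fubini_integral[OF i] by simp
    show "integrable M (\<lambda>y. \<integral>x. h (x(j := y)) \<partial>?P)"
      using PM.integrable_snd[OF i] .
  qed
  define c where "c = Q.expectation F"
  define \<phi> where "\<phi> y = (\<integral>x. F (x(j := y)) \<partial>?P)" for y
  have B0: "0 \<le> B"
    using insert.prems(2) Q.not_empty by (meson abs_ge_zero ex_in_conv order_trans)
  have Fb: "\<bar>F (x(j := y))\<bar> \<le> B" if "x \<in> space ?P" "y \<in> space M" for x y
    using insert.prems(2) upd that by blast
  have Gb: "\<bar>G i (x(j := y))\<bar> \<le> B" if "x \<in> space ?P" "y \<in> space M" "i \<in> insert j I" for x y i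
    using insert.prems(4) upd that by blast
  have \<phi>m[measurable]: "\<phi> \<in> borel_measurable M"
    unfolding \<phi>_def using int2[OF insert.prems(1,2)] by auto
  have \<phi>b: "\<bar>\<phi> y\<bar> \<le> B" if y: "y \<in> space M" for y
  proof -
    have "\<bar>\<phi> y\<bar> \<le> (\<integral>x. \<bar>F (x(j := y))\<bar> \<partial>?P)" unfolding \<phi>_def by (rule integral_abs_bound)
    also have "\<dots> \<le> (\<integral>x. B \<partial>?P)"
      using Fb y B0 by (intro integral_mono') auto
    finally show ?thesis by (simp add: P.prob_space)
  qed
  have c: "c = M.expectation \<phi>"
    unfolding c_def \<phi>_def by (rule split[OF insert.prems(1,2)])
  have sqb: "\<bar>(a - b)^2\<bar> \<le> (2 * B)^2" if "\<bar>a\<bar> \<le> B" "\<bar>b\<bar> \<le> B" for a b :: real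
  proof -
    have "\<bar>a - b\<bar> \<le> 2 * B" using that by linarith
    from power_mono[OF this abs_ge_zero, of 2] show ?thesis by simp
  qed
  have cB: "\<bar>c\<bar> \<le> B"
  proof -
    have "\<bar>c\<bar> \<le> Q.expectation (\<lambda>x. \<bar>F x\<bar>)" unfolding c_def by (rule integral_abs_bound)
    also have "\<dots> \<le> Q.expectation (\<lambda>x. B)"
      using insert.prems(2) B0 by (intro integral_mono') auto
    finally show ?thesis by (simp add: Q.prob_space)
  qed
  have FG: "\<bar>(F x - G i x)^2\<bar> \<le> (2 * B)^2" if "x \<in> space ?Q" "i \<in> insert j I" for x i
    using insert.prems(2,4) that by (intro sqb) auto
  have FGm: "(\<lambda>x. (F x - G i x)^2) \<in> borel_measurable ?Q" if "i \<in> insert j I" for i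
    using that by measurable
  note FGi = int2[OF FGm FG] and FGs = split[OF FGm FG]
  obtain x0 y0 where x0: "x0 \<in> space ?P" "y0 \<in> space M"
    using P.not_empty M.not_empty by blast
  \<comment> \<open>As \<open>G j\<close> ignores coordinate j, inserting any fixed value there
    turns it into a function of the other coordinates.\<close>
  define g where "g x = G j (x(j := y0))" for x
  have g: "G j (x(j := y)) = g x" for x y
    unfolding g_def by (metis insert.prems(5) insertI1)
  have gm[measurable]: "g \<in> borel_measurable ?P"
    unfolding g_def by (rule measurable_compose[OF upd1[OF x0(2)] Gm]) simp
  define e where "e = P.expectation g"
  have gb: "\<bar>g x\<bar> \<le> B" if "x \<in> space ?P" for x
    unfolding g_def using Gb x0(2) that by blast
  \<comment> \<open>Conditional variance given the last coordinate: the induction hypothesis for the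
    section at y.\<close>
  have fixed: "(\<integral>x. (F (x(j := y)) - \<phi> y)^2 \<partial>?P) \<le> (\<Sum>i\<in>I. \<integral>x. (F (x(j := y)) - G i (x(j := y)))^2 \<partial>?P)"
    if y: "y \<in> space M" for y
    unfolding \<phi>_def
  proof (rule insert.IH)
    show "(\<lambda>x. F (x(j := y))) \<in> borel_measurable ?P"
      by (rule measurable_compose[OF upd1[OF y] insert.prems(1)])
    show "(\<lambda>x. G i (x(j := y))) \<in> borel_measurable ?P" if "i \<in> I" for i
      using that by (intro measurable_compose[OF upd1[OF y] Gm]) simp
    show "G i ((x(i := z))(j := y)) = G i (x(j := y))" if "i \<in> I" for i x z
    proof -
      have "(x(i := z))(j := y) = (x(j := y))(i := z)"
        using insert.hyps that by (intro fun_upd_twist) auto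
      then show ?thesis using that by (metis insert.prems(5) insertI2)
    qed
    show "\<bar>F (x(j := y))\<bar> \<le> B" if "x \<in> space ?P" for x
      using Fb that y by blast
    show "\<bar>G i (x(j := y))\<bar> \<le> B" if "i \<in> I" "x \<in> space ?P" for i x
      using Gb that y by blast
  qed
  \<comment> \<open>Jensen: the left side is the square of the mean of F - \<open>G j\<close> over
    the other coordinates.\<close>
  have last: "(\<phi> y - e)^2 \<le> (\<integral>x. (F (x(j := y)) - G j (x(j := y)))^2 \<partial>?P)" if y: "y \<in> space M" for y
  proof -
    have m: "(\<lambda>x. F (x(j := y))) \<in> borel_measurable ?P"
      by (rule measurable_compose[OF upd1[OF y] insert.prems(1)])
    have "integrable ?P (\<lambda>x. F (x(j := y)))" "integrable ?P g"
      using Fb gb y m by (auto intro!: P.integrable_const_bound[where B = B])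
    then have "\<phi> y - e = (\<integral>x. F (x(j := y)) - g x \<partial>?P)"
      unfolding \<phi>_def e_def by simp
    then have "(\<phi> y - e)^2 = (P.expectation (\<lambda>x. F (x(j := y)) - g x))^2" by simp
    also have "\<dots> \<le> P.expectation (\<lambda>x. (F (x(j := y)) - g x)^2)"
    proof (rule P.expectation_square_le[where B = "2 * B"])
      fix x assume "x \<in> space ?P"
      then show "\<bar>F (x(j := y)) - g x\<bar> \<le> 2 * B"
        using Fb[of x y] gb[of x] y by linarith
    qed (use m in measurable)
    finally show ?thesis by (simp add: g)
  qed
  have "Q.variance F = (\<integral>y. (\<integral>x. (F (x(j := y)) - c)^2 \<partial>?P) \<partial>M)"
    unfolding c_def[symmetric]
  proof (rule split)
    show "\<bar>(F x - c)^2\<bar> \<le> (2 * B)^2" if "x \<in> space ?Q" for x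
      using insert.prems(2) that cB by (intro sqb)
  qed measurable
  also have "\<dots> = (\<integral>y. (\<integral>x. (F (x(j := y)) - \<phi> y)^2 \<partial>?P) + (\<phi> y - c)^2 \<partial>M)"
  proof (rule Bochner_Integration.integral_cong[OF refl])
    fix y assume y: "y \<in> space M"
    have "(\<lambda>x. F (x(j := y))) \<in> borel_measurable ?P"
      by (rule measurable_compose[OF upd1[OF y] insert.prems(1)])
    then show "(\<integral>x. (F (x(j := y)) - c)^2 \<partial>?P) = (\<integral>x. (F (x(j := y)) - \<phi> y)^2 \<partial>?P) + (\<phi> y - c)^2"
      unfolding \<phi>_def using Fb y by (intro P.expectation_square_diff) auto
  qed
  also have "\<dots> \<le> (\<integral>y. (\<Sum>i\<in>I. \<integral>x. (F (x(j := y)) - G i (x(j := y)))^2 \<partial>?P) + (\<phi> y - c)^2 \<partial>M)"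
  proof (rule integral_mono')
    show "integrable M (\<lambda>y. (\<Sum>i\<in>I. \<integral>x. (F (x(j := y)) - G i (x(j := y)))^2 \<partial>?P) + (\<phi> y - c)^2)"
      using FGi \<phi>b cB sqb
      by (intro Bochner_Integration.integrable_add Bochner_Integration.integrable_sum)
         (auto intro!: M.integrable_const_bound[where B = "(2 * B)^2"])
  qed (use fixed in \<open>auto intro!: add_nonneg_nonneg sum_nonneg\<close>)
  also have "\<dots> = (\<Sum>i\<in>I. \<integral>y. \<integral>x. (F (x(j := y)) - G i (x(j := y)))^2 \<partial>?P \<partial>M) + (\<integral>y. (\<phi> y - c)^2 \<partial>M)"
  proof -
    have 1: "integrable M (\<lambda>y. (\<phi> y - c)^2)"
      using \<phi>b cB sqb by (intro M.integrable_const_bound[where B = "(2 * B)^2"]) auto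
    show ?thesis using FGi 1 by (subst Bochner_Integration.integral_add) (auto simp: Bochner_Integration.integral_sum)
  qed
  also have "\<dots> = (\<Sum>i\<in>I. \<integral>x. (F x - G i x)^2 \<partial>?Q) + (\<integral>y. (\<phi> y - c)^2 \<partial>M)"
    using FGs by (auto intro!: sum.cong)
  \<comment> \<open>The variance of the conditional mean only grows when its centre c is replaced by
    e, the mean of \<open>G j\<close>, which is comparable with F pointwise.\<close>
  also have "(\<integral>y. (\<phi> y - c)^2 \<partial>M) \<le> (\<integral>y. (\<phi> y - e)^2 \<partial>M)"
    using M.expectation_square_diff[OF \<phi>m \<phi>b, of c] M.expectation_square_diff[OF \<phi>m \<phi>b, of e]
    by (simp add: c)
  also have "\<dots> \<le> (\<integral>y. (\<integral>x. (F (x(j := y)) - G j (x(j := y)))^2 \<partial>?P) \<partial>M)"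
    using last FGi[of j] by (intro integral_mono') auto
  also have "\<dots> = (\<integral>x. (F x - G j x)^2 \<partial>?Q)"
    using FGs[of j] by simp
  finally show ?case using insert.hyps by (simp add: add.commute)
qed

section \<open>Order statistics and moment bounds\<close>

text \<open>The distribution function with strict inequality, evaluated at Y itself, is
  stochastically at most uniform even if Y has atoms. With \<tau> the largest point where it is at
  most s, the event Y \<le> \<tau> has probability at least s and forces the value to be at most
  s.\<close>

lemma (in prob_space) prob_less_self_le:
  fixes Y :: "'a \<Rightarrow> real"
  assumes Y: "random_variable borel Y" and s: "0 \<le> s" "s \<le> 1"
  shows "prob {x \<in> space M. s < prob {y \<in> space M. Y y < Y x}} \<le> 1 - s"
proof -
  note [measurable] = Y
  define G where "G t = prob {y \<in> space M. Y y < t}" for t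
  have mono: "G t \<le> G t'" if "t \<le> t'" for t t'
    unfolding G_def using that by (intro finite_measure_mono) auto
  have [measurable]: "G \<in> borel_measurable borel"
    by (rule borel_measurable_mono) (simp add: mono_def mono)
  have ge: "s \<le> prob {x \<in> space M. G (Y x) \<le> s}"
  \<comment> \<open>These are the cases in which the level set has no usable supremum: it is the
    whole line or empty.\<close>
  proof (cases "(\<forall>t. G t \<le> s) \<or> (\<forall>t. s < G t)")
    case True
    then show ?thesis
    proof
      assume "\<forall>t. G t \<le> s"
      then show ?thesis using s by (simp add: prob_space)
    next
      assume *: "\<forall>t. s < G t"
      have "(\<lambda>n. prob {y \<in> space M. Y y < - real n}) \<longlonglongrightarrow> prob (\<Inter>n. {y \<in> space M. Y y < - real n})"
        by (intro finite_Lim_measure_decseq) (auto simp: decseq_def)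
      moreover have "(\<Inter>n. {y \<in> space M. Y y < - real n}) = {}"
      proof safe
        fix x assume x: "x \<in> (\<Inter>n. {y \<in> space M. Y y < - real n})"
        obtain n where "- Y x < real n" using reals_Archimedean2 by blast
        moreover have "Y x < - real n" using x by blast
        ultimately show "x \<in> {}" by simp
      qed
      ultimately have "(\<lambda>n. G (- real n)) \<longlonglongrightarrow> 0" by (simp add: G_def)
      then have "s \<le> 0" using * by (intro LIMSEQ_le_const) (auto intro: less_imp_le)
      then show ?thesis using measure_nonneg order_trans by blast
    qed
  next
    case False
    then obtain t0 t1 where t: "G t0 \<le> s" "s < G t1" by (auto simp: not_le not_less)
    define A where "A = {t. G t \<le> s}"
    have bdd: "bdd_above A"
    proof
      fix t assume "t \<in> A"
      then show "t \<le> t1" using mono[of t1 t] t by (fastforce simp: A_def)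
    qed
    have A0: "A \<noteq> {}" using t by (auto simp: A_def)
    define \<tau> where "\<tau> = Sup A"
    have below: "G t' \<le> s" if lt: "t' < \<tau>" for t'
    proof -
      obtain t where "t \<in> A" "t' < t" using lt unfolding \<tau>_def less_cSup_iff[OF A0 bdd] by blast
      then show ?thesis using mono[of t' t] by (auto simp: A_def)
    qed
    have above: "s < G t'" if "\<tau> < t'" for t'
      using that cSup_upper[of t' A] bdd unfolding \<tau>_def A_def by force
    \<comment> \<open>Left continuity of G puts \<tau> itself into the level set.\<close>
    have "(\<lambda>n. prob {y \<in> space M. Y y < \<tau> - 1 / Suc n}) \<longlonglongrightarrow> prob (\<Union>n. {y \<in> space M. Y y < \<tau> - 1 / Suc n})"
    proof (intro finite_Lim_measure_incseq)
      show "incseq (\<lambda>n. {y \<in> space M. Y y < \<tau> - 1 / Suc n})"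
        unfolding incseq_def
      proof safe
        fix m n :: nat and x assume "m \<le> n" "Y x < \<tau> - 1 / Suc m"
        moreover have "1 / real (Suc n) \<le> 1 / Suc m" using \<open>m \<le> n\<close> by (simp add: frac_le)
        ultimately show "Y x < \<tau> - 1 / Suc n" by linarith
      qed
    qed auto
    moreover have "(\<Union>n. {y \<in> space M. Y y < \<tau> - 1 / Suc n}) = {y \<in> space M. Y y < \<tau>}"
    proof safe
      fix x assume x: "x \<in> space M" "Y x < \<tau>"
      then obtain n where "1 / real (Suc n) < \<tau> - Y x" using nat_approx_posE[of "\<tau> - Y x"] by auto
      then show "x \<in> (\<Union>n. {y \<in> space M. Y y < \<tau> - 1 / Suc n})" using x by (auto intro!: exI[of _ n] simp: algebra_simps)
    next
      fix x n assume "Y x < \<tau> - 1 / real (Suc n)"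
      moreover have "0 < 1 / real (Suc n)" by simp
      ultimately show "Y x < \<tau>" by linarith
    qed
    ultimately have "(\<lambda>n. G (\<tau> - 1 / Suc n)) \<longlonglongrightarrow> G \<tau>" by (simp add: G_def)
    then have G\<tau>: "G \<tau> \<le> s" using below by (intro LIMSEQ_le_const2) auto
    \<comment> \<open>The limit from the right is the probability of Y \<le> \<tau>, atom included,
      and it is at least s.\<close>
    have "(\<lambda>n. prob {y \<in> space M. Y y < \<tau> + 1 / Suc n}) \<longlonglongrightarrow> prob (\<Inter>n. {y \<in> space M. Y y < \<tau> + 1 / Suc n})"
    proof (intro finite_Lim_measure_decseq)
      show "decseq (\<lambda>n. {y \<in> space M. Y y < \<tau> + 1 / Suc n})"
        unfolding decseq_def
      proof safe
        fix m n :: nat and x assume "m \<le> n" "Y x < \<tau> + 1 / Suc n"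
        moreover have "1 / real (Suc n) \<le> 1 / Suc m" using \<open>m \<le> n\<close> by (simp add: frac_le)
        ultimately show "Y x < \<tau> + 1 / Suc m" by linarith
      qed
    qed auto
    moreover have "(\<Inter>n. {y \<in> space M. Y y < \<tau> + 1 / Suc n}) = {y \<in> space M. Y y \<le> \<tau>}"
    proof safe
      fix x assume x: "x \<in> (\<Inter>n. {y \<in> space M. Y y < \<tau> + 1 / Suc n})"
      show "Y x \<le> \<tau>"
      proof (rule ccontr)
        assume "\<not> ?thesis"
        then obtain n where "1 / real (Suc n) < Y x - \<tau>" using nat_approx_posE[of "Y x - \<tau>"] by auto
        moreover have "Y x < \<tau> + 1 / Suc n" using x by blast
        ultimately show False by simp
      qed
    next
      fix x n assume "Y x \<le> \<tau>"
      moreover have "0 < 1 / real (Suc n)" by simp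
      ultimately show "Y x < \<tau> + 1 / real (Suc n)" by linarith
    qed auto
    ultimately have "(\<lambda>n. G (\<tau> + 1 / Suc n)) \<longlonglongrightarrow> prob {y \<in> space M. Y y \<le> \<tau>}" by (simp add: G_def)
    moreover have "s \<le> G (\<tau> + 1 / Suc n)" for n
      by (rule less_imp_le[OF above]) simp
    ultimately have "s \<le> prob {y \<in> space M. Y y \<le> \<tau>}"
      by (intro LIMSEQ_le_const) auto
    also have "\<dots> \<le> prob {x \<in> space M. G (Y x) \<le> s}"
      using mono G\<tau> by (intro finite_measure_mono) (auto intro: order_trans)
    finally show ?thesis .
  qed
  have "prob {x \<in> space M. s < G (Y x)} = 1 - prob {x \<in> space M. G (Y x) \<le> s}"
    by (subst prob_compl[symmetric]) (auto intro!: arg_cong[where f = prob])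
  then show ?thesis using ge by (simp add: G_def)
qed

section \<open>Moments of the quantile of a sample minimum\<close>

lemma summable_powr_exp: "summable (\<lambda>k. real (Suc k) powr \<gamma> * exp (- real k))"
proof (rule summable_comparison_test_bigo)
  have "summable (\<lambda>k. exp (- 1 / 2 :: real) ^ k)" by (rule summable_geometric) simp
  then show "summable (\<lambda>k. norm (exp (- real k / 2)))" by (simp add: exp_of_nat_mult[symmetric])
  show "(\<lambda>k. real (Suc k) powr \<gamma> * exp (- real k)) \<in> O(\<lambda>k. exp (- real k / 2))" by real_asymp
qed

text \<open>G is monotone, so G at the minimum exceeds s only if it does so at every sample point.
  By \<open>prob_less_self_le\<close> and independence this has probability at most
  \<open>(1-s)^m \<le> exp(-sm)\<close>. Slicing [0,1] into m pieces of length 1/m gives the sum in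
  the constant.\<close>

lemma (in prob_space) nn_integral_Min_quantile_powr_le:
  fixes Y :: "'a \<Rightarrow> real" and \<gamma> :: real
  assumes Y: "random_variable borel Y" and I: "finite I" "I \<noteq> {}" and \<gamma>: "0 \<le> \<gamma>"
  defines "m \<equiv> card I" and "G \<equiv> \<lambda>t. prob {y \<in> space M. Y y < t}"
  shows "(\<integral>\<^sup>+x. ennreal (G (Min ((\<lambda>i. Y (x i)) ` I)) powr \<gamma>) \<partial>(\<Pi>\<^sub>M i\<in>I. M))
    \<le> ennreal ((\<Sum>k. real (Suc k) powr \<gamma> * exp (- real k)) * real m powr (-\<gamma>))"
proof -
  interpret pp: product_prob_space "\<lambda>_. M" I by unfold_locales
  let ?P = "\<Pi>\<^sub>M i\<in>I. M"
  note [measurable] = Y I(1)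
  have m: "m > 0" using I by (simp add: m_def card_gt_0_iff)
  have mono: "G t \<le> G t'" if "t \<le> t'" for t t'
    unfolding G_def using that by (intro finite_measure_mono) auto
  have [measurable]: "G \<in> borel_measurable borel"
    by (rule borel_measurable_mono) (simp add: mono_def mono)
  have G01: "0 \<le> G t" "G t \<le> 1" for t by (auto simp: G_def)
  define T where "T x = Min ((\<lambda>i. Y (x i)) ` I)" for x
  have Tm[measurable]: "T \<in> borel_measurable ?P"
    unfolding T_def by (intro borel_measurable_Min I) (rule measurable_compose[OF measurable_component_singleton[where M = "\<lambda>_. M"] Y])
  have tail: "emeasure ?P {x \<in> space ?P. s < G (T x)} \<le> ennreal (exp (- s * m))"
    if s: "0 \<le> s" "s \<le> 1" for s
  proof -
    let ?X = "{y \<in> space M. s < G (Y y)}"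
    have "emeasure ?P {x \<in> space ?P. s < G (T x)} \<le> emeasure ?P {x \<in> space ?P. \<forall>i\<in>I. x i \<in> ?X}"
    proof (intro emeasure_mono)
      show "{x \<in> space ?P. s < G (T x)} \<subseteq> {x \<in> space ?P. \<forall>i\<in>I. x i \<in> ?X}"
      proof safe
        fix x i assume x: "x \<in> space ?P" "s < G (T x)" "i \<in> I"
        have "T x \<le> Y (x i)" using x I by (auto simp: T_def)
        then show "s < G (Y (x i))" using mono x by (meson order_less_le_trans)
        show "x i \<in> space M" using x by (auto simp: space_PiM)
      qed
    qed measurable
    also have "\<dots> = (\<Prod>i\<in>I. emeasure M ?X)"
      using I by (intro pp.emeasure_PiM_Collect) auto
    also have "\<dots> = ennreal (prob ?X ^ m)"
      by (simp add: emeasure_eq_measure m_def ennreal_power)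
    also have "\<dots> \<le> ennreal (exp (- s) ^ m)"
      using prob_less_self_le[OF Y s] exp_ge_add_one_self[of "-s"]
      by (intro ennreal_leI power_mono) (auto simp: G_def)
    finally show ?thesis by (simp add: exp_of_nat_mult[symmetric] mult.commute)
  qed
  define w where "w k = (real (Suc k) / m) powr \<gamma>" for k
  have point: "ennreal (g powr \<gamma>) \<le> (\<Sum>k<m. ennreal (w k) * indicator {g. k = 0 \<or> real k / m < g} g)"
    if g: "0 \<le> g" "g \<le> 1" for g
  proof -
    \<comment> \<open>The slice with k < gm \<le> k + 1. For g = 0 truncation in \<open>nat\<close>
      gives k = 0, where the strict inequality fails; hence the alternative k = 0 in the
      indicator.\<close>
    define k where "k = nat (\<lceil>g * m\<rceil> - 1)"
    have "\<lceil>g * m\<rceil> \<le> int m" using g m by (simp add: ceiling_le_iff mult_left_le_one_le)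
    then have km: "k < m" using m by (auto simp: k_def)
    have kg: "k = 0 \<or> real k < g * m"
      unfolding k_def by linarith
    have gk: "g * m \<le> Suc k" unfolding k_def by linarith
    have "ennreal (g powr \<gamma>) \<le> ennreal (w k) * indicator {g. k = 0 \<or> real k / m < g} g"
      using kg gk g \<gamma> m by (auto simp: w_def field_simps intro!: ennreal_leI powr_mono2)
    also have "\<dots> \<le> (\<Sum>k<m. ennreal (w k) * indicator {g. k = 0 \<or> real k / m < g} g)"
      using km by (intro member_le_sum) auto
    finally show ?thesis .
  qed
  have "(\<integral>\<^sup>+x. ennreal (G (T x) powr \<gamma>) \<partial>?P)
      \<le> (\<integral>\<^sup>+x. (\<Sum>k<m. ennreal (w k) * indicator {g. k = 0 \<or> real k / m < g} (G (T x))) \<partial>?P)"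
    using G01 by (intro nn_integral_mono point)
  also have "\<dots> = (\<Sum>k<m. ennreal (w k) * (\<integral>\<^sup>+x. indicator {g. k = 0 \<or> real k / m < g} (G (T x)) \<partial>?P))"
    by (subst nn_integral_sum) (auto simp: nn_integral_cmult)
  also have "\<dots> \<le> (\<Sum>k<m. ennreal (w k) * ennreal (exp (- real k)))"
  proof (intro sum_mono mult_left_mono)
    fix k assume k: "k \<in> {..<m}"
    have "(\<integral>\<^sup>+x. indicator {g. k = 0 \<or> real k / m < g} (G (T x)) \<partial>?P)
        = (\<integral>\<^sup>+x. indicator {x \<in> space ?P. k = 0 \<or> real k / m < G (T x)} x \<partial>?P)"
      by (intro nn_integral_cong) (auto simp: indicator_def)
    also have "\<dots> = emeasure ?P {x \<in> space ?P. k = 0 \<or> real k / m < G (T x)}"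
      by (subst nn_integral_indicator) auto
    also have "\<dots> \<le> ennreal (exp (- real k))"
    proof (cases "k = 0")
      case True
      then show ?thesis using pp.emeasure_space_1 by simp
    next
      case False
      then show ?thesis using tail[of "real k / m"] k m by simp
    qed
    finally show "(\<integral>\<^sup>+x. indicator {g. k = 0 \<or> real k / m < g} (G (T x)) \<partial>?P) \<le> ennreal (exp (- real k))" .
  qed auto
  also have "\<dots> = ennreal (\<Sum>k<m. w k * exp (- real k))"
    by (simp add: ennreal_mult'[symmetric] w_def)
  also have "\<dots> \<le> ennreal ((\<Sum>k. real (Suc k) powr \<gamma> * exp (- real k)) * real m powr (-\<gamma>))"
  proof (rule ennreal_leI)
    have "(\<Sum>k<m. w k * exp (- real k)) = (\<Sum>k<m. real (Suc k) powr \<gamma> * exp (- real k)) * real m powr (-\<gamma>)"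
    proof -
      have "w k = real (Suc k) powr \<gamma> * real m powr (-\<gamma>)" for k
        by (simp add: w_def powr_divide powr_minus_divide)
      then show ?thesis by (simp add: sum_distrib_left mult_ac)
    qed
    also have "\<dots> \<le> (\<Sum>k. real (Suc k) powr \<gamma> * exp (- real k)) * real m powr (-\<gamma>)"
      by (intro mult_right_mono sum_le_suminf summable_powr_exp) auto
    finally show "(\<Sum>k<m. w k * exp (- real k)) \<le> (\<Sum>k. real (Suc k) powr \<gamma> * exp (- real k)) * real m powr (-\<gamma>)" .
  qed
  finally show ?thesis by (simp add: T_def)
qed

lemma exp_le_powr:
  fixes p \<gamma> :: real
  assumes "0 < p"
  obtains C where "0 \<le> C" "\<And>m::nat. 0 < m \<Longrightarrow> exp (- p * m) \<le> C * real m powr (- \<gamma>)"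
proof -
  have "(\<lambda>m::nat. real m powr \<gamma> * exp (- p * m)) \<longlonglongrightarrow> 0" using assms by real_asymp
  then have "Bseq (\<lambda>m::nat. real m powr \<gamma> * exp (- p * m))" by (rule convergent_imp_Bseq[OF convergentI])
  then obtain C where C: "0 < C" "\<And>m::nat. norm (real m powr \<gamma> * exp (- p * m)) \<le> C"
    by (rule BseqE) auto
  have "exp (- p * m) \<le> C * real m powr (- \<gamma>)" if "0 < m" for m :: nat
  proof -
    have "exp (- p * m) = (real m powr \<gamma> * exp (- p * m)) * real m powr (- \<gamma>)"
      using that by (simp add: powr_minus)
    also have "\<dots> \<le> C * real m powr (- \<gamma>)"
      using C(2)[of m] by (intro mult_right_mono) auto
    finally show ?thesis .
  qed
  then show thesis using that C(1) by (meson less_imp_le)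
qed

text \<open>In the double integral the factor with the larger T dominates both: if T v \<le> T u,
  then the product is at most \<open>(T u)^2\<close> and v satisfies Y v < T u, a set of measure at
  most \<open>C (T u)^\<kappa>\<close>. In the application Y is the depth of the new point below the
  supporting hyperplane and T is the gap.\<close>

lemma (in sigma_finite_measure) nn_integral_square_le:
  fixes Y T :: "'a \<Rightarrow> real" and \<kappa> :: real
  assumes [measurable]: "Y \<in> borel_measurable M" "T \<in> borel_measurable M"
    and cap: "\<And>t. 0 < t \<Longrightarrow> emeasure M {v \<in> space M. Y v < t} \<le> ennreal (C * t powr \<kappa>)"
    and Y: "\<And>v. v \<in> space M \<Longrightarrow> 0 \<le> Y v" and C: "0 \<le> C"
  shows "(\<integral>\<^sup>+u. ennreal (T u) * indicator {u. Y u < T u} u \<partial>M)^2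
    \<le> ennreal (2 * C) * (\<integral>\<^sup>+u. ennreal (T u powr (2 + \<kappa>)) * indicator {u. Y u < T u} u \<partial>M)"
proof -
  define f where "f u = ennreal (T u) * indicator {u. Y u < T u} u" for u
  define \<phi> where "\<phi> u v = ennreal (T u ^ 2) * indicator {u. Y u < T u} u * indicator {v. Y v < T u} v" for u v
  have [measurable]: "f \<in> borel_measurable M" unfolding f_def by measurable
  have [measurable]: "case_prod \<phi> \<in> borel_measurable (M \<Otimes>\<^sub>M M)" unfolding \<phi>_def by measurable
  \<comment> \<open>Adding both majorants avoids splitting the domain; by symmetry they have the
    same integral, whence the factor 2.\<close>
  have ff: "f u * f v \<le> \<phi> u v + \<phi> v u" if u: "u \<in> space M" and v: "v \<in> space M" for u v
  proof (cases "Y u < T u \<and> Y v < T v")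
    case True
    then have T0: "0 < T u" "0 < T v" using Y[OF u] Y[OF v] by linarith+
    show ?thesis
    proof (cases "T v \<le> T u")
      case le: True
      have "f u * f v = ennreal (T u * T v)" using True T0 by (simp add: f_def ennreal_mult)
      also have "\<dots> \<le> ennreal (T u ^ 2)" using le T0 by (intro ennreal_leI) (simp add: power2_eq_square)
      also have "\<dots> = \<phi> u v" using True le by (simp add: \<phi>_def)
      finally show ?thesis by (simp add: add_increasing2)
    next
      case ge: False
      have "f u * f v = ennreal (T u * T v)" using True T0 by (simp add: f_def ennreal_mult)
      also have "\<dots> \<le> ennreal (T v ^ 2)" using ge T0 by (intro ennreal_leI) (simp add: power2_eq_square)
      also have "\<dots> = \<phi> v u" using True ge by (simp add: \<phi>_def)
      finally show ?thesis by (simp add: add_increasing)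
    qed
  qed (auto simp: f_def)
  have inner: "(\<integral>\<^sup>+v. \<phi> u v \<partial>M) \<le> ennreal C * (ennreal (T u powr (2 + \<kappa>)) * indicator {u. Y u < T u} u)"
    if u: "u \<in> space M" for u
  proof (cases "Y u < T u")
    case True
    then have T0: "0 < T u" using Y[OF u] by linarith
    have "(\<integral>\<^sup>+v. \<phi> u v \<partial>M) = (\<integral>\<^sup>+v. ennreal (T u ^ 2) * indicator {v \<in> space M. Y v < T u} v \<partial>M)"
      using True by (intro nn_integral_cong) (auto simp: \<phi>_def indicator_def)
    also have "\<dots> = ennreal (T u ^ 2) * emeasure M {v \<in> space M. Y v < T u}"
      by (subst nn_integral_cmult_indicator) auto
    also have "\<dots> \<le> ennreal (T u ^ 2) * ennreal (C * T u powr \<kappa>)"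
      using cap[OF T0] by (intro mult_left_mono) auto
    also have "\<dots> = ennreal C * ennreal (T u powr (2 + \<kappa>))"
      using T0 C by (simp add: ennreal_mult'[symmetric] powr_add powr_numeral mult_ac)
    finally show ?thesis using True by simp
  qed (simp add: \<phi>_def)
  have "(\<integral>\<^sup>+u. f u \<partial>M)^2 = (\<integral>\<^sup>+u. (\<integral>\<^sup>+v. f u * f v \<partial>M) \<partial>M)"
  proof -
    have "(\<integral>\<^sup>+u. (\<integral>\<^sup>+v. f u * f v \<partial>M) \<partial>M) = (\<integral>\<^sup>+u. f u * (\<integral>\<^sup>+v. f v \<partial>M) \<partial>M)"
      by (intro nn_integral_cong nn_integral_cmult) measurable
    also have "\<dots> = (\<integral>\<^sup>+u. f u \<partial>M) * (\<integral>\<^sup>+v. f v \<partial>M)"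
      by (rule nn_integral_multc) measurable
    finally show ?thesis by (simp add: power2_eq_square)
  qed
  also have "\<dots> \<le> (\<integral>\<^sup>+u. (\<integral>\<^sup>+v. \<phi> u v + \<phi> v u \<partial>M) \<partial>M)"
    by (intro nn_integral_mono ff)
  also have "\<dots> = (\<integral>\<^sup>+u. (\<integral>\<^sup>+v. \<phi> u v \<partial>M) \<partial>M) + (\<integral>\<^sup>+u. (\<integral>\<^sup>+v. \<phi> v u \<partial>M) \<partial>M)"
  proof -
    have "(\<integral>\<^sup>+u. (\<integral>\<^sup>+v. \<phi> u v + \<phi> v u \<partial>M) \<partial>M)
        = (\<integral>\<^sup>+u. (\<integral>\<^sup>+v. \<phi> u v \<partial>M) + (\<integral>\<^sup>+v. \<phi> v u \<partial>M) \<partial>M)"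
      by (intro nn_integral_cong nn_integral_add) measurable
    also have "\<dots> = (\<integral>\<^sup>+u. (\<integral>\<^sup>+v. \<phi> u v \<partial>M) \<partial>M) + (\<integral>\<^sup>+u. (\<integral>\<^sup>+v. \<phi> v u \<partial>M) \<partial>M)"
      by (rule nn_integral_add) measurable
    finally show ?thesis .
  qed
  also have "(\<integral>\<^sup>+u. (\<integral>\<^sup>+v. \<phi> v u \<partial>M) \<partial>M) = (\<integral>\<^sup>+u. (\<integral>\<^sup>+v. \<phi> u v \<partial>M) \<partial>M)"
  proof -
    interpret p: pair_sigma_finite M M ..
    show ?thesis by (rule p.Fubini') measurable
  qed
  also have "(\<integral>\<^sup>+u. (\<integral>\<^sup>+v. \<phi> u v \<partial>M) \<partial>M) + (\<integral>\<^sup>+u. (\<integral>\<^sup>+v. \<phi> u v \<partial>M) \<partial>M)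
      = 2 * (\<integral>\<^sup>+u. (\<integral>\<^sup>+v. \<phi> u v \<partial>M) \<partial>M)" by (simp add: mult_2)
  also have "\<dots> \<le> 2 * (\<integral>\<^sup>+u. ennreal C * (ennreal (T u powr (2 + \<kappa>)) * indicator {u. Y u < T u} u) \<partial>M)"
    by (intro mult_left_mono nn_integral_mono inner) auto
  also have "\<dots> = ennreal (2 * C) * (\<integral>\<^sup>+u. ennreal (T u powr (2 + \<kappa>)) * indicator {u. Y u < T u} u \<partial>M)"
    using C by (subst nn_integral_cmult) (auto simp: ennreal_mult mult.assoc)
  finally show ?thesis by (simp add: f_def)
qed

section \<open>Bodies in which a ball rolls freely\<close>

lemma support_fun_ge:
  fixes M :: "'a::euclidean_space set"
  assumes "compact M" "x \<in> M" shows "u \<bullet> x \<le> support_fun M u"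
proof -
  have "compact ((\<bullet>) u ` M)"
    using assms by (intro compact_continuous_image continuous_intros)
  then show ?thesis
    unfolding support_fun_def using assms
    by (intro cSUP_upper compact_imp_bounded bounded_imp_bdd_above)
qed

lemma support_fun_attained:
  fixes M :: "'a::euclidean_space set"
  assumes "compact M" "M \<noteq> {}" obtains x where "x \<in> M" "u \<bullet> x = support_fun M u"
proof -
  have "continuous_on M ((\<bullet>) u)" by (intro continuous_intros)
  then obtain x where x: "x \<in> M" "\<And>y. y \<in> M \<Longrightarrow> u \<bullet> y \<le> u \<bullet> x"
    using continuous_attains_sup[of M "(\<bullet>) u"] assms by blast
  have "support_fun M u = u \<bullet> x"
    unfolding support_fun_def using x by (intro cSup_eq_maximum) auto
  then show ?thesis using that x by simp
qed

lemma support_fun_lipschitz: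
  fixes M :: "'a::euclidean_space set"
  assumes M: "compact M" "M \<noteq> {}" "M \<subseteq> cball 0 R"
  shows "\<bar>support_fun M u - support_fun M v\<bar> \<le> R * norm (u - v)"
proof -
  have le: "support_fun M u \<le> support_fun M v + R * norm (u - v)" for u v
  proof -
    obtain x where x: "x \<in> M" "u \<bullet> x = support_fun M u" by (rule support_fun_attained[OF M(1,2)])
    have "u \<bullet> x = v \<bullet> x + (u - v) \<bullet> x" by (simp add: inner_diff_left)
    also have "\<dots> \<le> support_fun M v + norm (u - v) * norm x"
      by (intro add_mono support_fun_ge M x norm_cauchy_schwarz)
    also have "\<dots> \<le> support_fun M v + norm (u - v) * R"
      using x M(3) by (auto intro!: mult_left_mono)
    finally show ?thesis using x by (simp add: mult.commute)
  qed
  from le[of u v] le[of v u] show ?thesis by (simp add: norm_minus_commute abs_le_iff)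
qed

lemma continuous_on_support_fun:
  fixes M :: "'a::euclidean_space set"
  assumes M: "compact M" "M \<noteq> {}"
  shows "continuous_on A (support_fun M)"
proof -
  obtain R where R: "M \<subseteq> cball 0 R"
    using compact_imp_bounded[OF M(1)] bounded_subset_ballD[of M 0] ball_subset_cball by (metis order_trans)
  then have "R \<ge> 0" using M(2) by (auto simp: subset_iff) (meson norm_ge_zero order_trans)
  then have "R-lipschitz_on A (support_fun M)"
    using support_fun_lipschitz[OF M R] by (auto intro!: lipschitz_onI simp: dist_norm)
  then show ?thesis by (rule lipschitz_on_continuous_on)
qed

lemma support_fun_convex_hull_finite:
  fixes x :: "'i \<Rightarrow> 'a::euclidean_space"
  assumes "finite I" "I \<noteq> {}"
  shows "support_fun (convex hull (x ` I)) u = Max ((\<lambda>i. u \<bullet> x i) ` I)"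
proof -
  let ?m = "Max ((\<lambda>i. u \<bullet> x i) ` I)"
  have "convex hull (x ` I) \<subseteq> {y. u \<bullet> y \<le> ?m}"
    using assms by (intro hull_minimal convex_halfspace_le) (auto intro!: Max_ge)
  moreover have "?m \<in> (\<lambda>i. u \<bullet> x i) ` I" using assms by (intro Max_in) auto
  then have "?m \<in> (\<lambda>y. u \<bullet> y) ` (convex hull (x ` I))"
    using hull_subset[of "x ` I" convex] by blast
  ultimately show ?thesis unfolding support_fun_def
    by (intro cSup_eq_maximum) auto
qed

lemma emeasure_lborel_translation:
  fixes A :: "'a::euclidean_space set"
  assumes "A \<in> sets borel"
  shows "emeasure lborel {x. x - c \<in> A} = emeasure lborel A"
proof -
  have "emeasure lborel A = emeasure (distr lborel borel ((+) (- c))) A"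
    by (simp add: lborel_distr_plus)
  also have "\<dots> = emeasure lborel {x. x - c \<in> A}"
    using assms by (subst emeasure_distr) (auto simp: vimage_def algebra_simps)
  finally show ?thesis by simp
qed

text \<open>The slices of a ball of radius \<open>R/4\<close> orthogonal to \<open>u\<close> with thickness \<open>e\<close> can all be
  translated along \<open>u\<close> into the slab, which avoids any rotation or slicing of the Lebesgue measure.\<close>

lemma emeasure_slab_ball_ge:
  fixes u :: "'a::euclidean_space"
  assumes u: "norm u = 1" and e: "0 < e" "e \<le> R / 4"
  shows "ennreal (unit_ball_vol DIM('a) * (R / 4) ^ (DIM('a) - 1) * (e / 5))
    \<le> emeasure lborel {y. norm y \<le> R \<and> e \<le> u \<bullet> y \<and> u \<bullet> y < 2 * e}" (is "_ \<le> emeasure lborel ?D")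
proof -
  define R' where "R' = R / 4"
  have R': "0 < R'" "e \<le> R'" using e by (auto simp: R'_def)
  define N where "N = \<lceil>R' / e\<rceil>"
  define S where "S j = {y \<in> cball 0 R'. of_int j * e \<le> u \<bullet> y \<and> u \<bullet> y < (of_int j + 1) * e}" for j :: int
  have D: "?D \<in> sets borel" by measurable
  have S: "S j \<in> sets borel" for j unfolding S_def by measurable
  have N: "N \<ge> 0" "real_of_int N \<le> R' / e + 1" "R' / e \<le> real_of_int N"
  proof -
    have "0 \<le> R' / e" using e R' by simp
    then show "N \<ge> 0" "real_of_int N \<le> R' / e + 1" "R' / e \<le> real_of_int N"
      unfolding N_def by linarith+
  qed
  have SD: "emeasure lborel (S j) \<le> emeasure lborel ?D" if j: "j \<in> {-N..N}" for j
  proof -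
    \<comment> \<open>This shift moves slice j to the heights between e and 2e. It increases the
      norm to at most 2R' + 2e, which is at most R because e \<le> R/4.\<close>
    define c where "c = ((of_int j - 1) * e) *\<^sub>R u"
    have nc: "norm c \<le> R' + 2 * e"
    proof -
      have "norm c = \<bar>of_int j - 1\<bar> * e" using u e by (simp add: c_def abs_mult)
      also have "\<dots> \<le> (of_int N + 1) * e"
        using j e by (intro mult_right_mono) auto
      also have "\<dots> \<le> (R' / e + 2) * e" using N e by (intro mult_right_mono) auto
      also have "\<dots> = R' + 2 * e" using e by (simp add: field_simps)
      finally show ?thesis .
    qed
    have uc: "u \<bullet> c = (of_int j - 1) * e"
      using u by (simp add: c_def dot_square_norm)
    have "S j \<subseteq> {y. y - c \<in> ?D}"
    proof
      fix y assume y: "y \<in> S j"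
      have "norm (y - c) \<le> norm y + norm c" by (rule norm_triangle_ineq4)
      also have "\<dots> \<le> R' + (R' + 2 * e)" using y nc by (intro add_mono) (auto simp: S_def)
      also have "\<dots> \<le> R" using e by (simp add: R'_def)
      finally show "y \<in> {y. y - c \<in> ?D}"
        using y uc by (auto simp: S_def inner_diff_right algebra_simps)
    qed
    then have "emeasure lborel (S j) \<le> emeasure lborel {y. y - c \<in> ?D}"
      using D by (intro emeasure_mono) (auto simp: measurable_sets_borel)
    then show ?thesis using emeasure_lborel_translation[OF D] by simp
  qed
  have "cball 0 R' \<subseteq> (\<Union>j\<in>{-N..N}. S j)"
  proof
    fix y :: 'a assume y: "y \<in> cball 0 R'"
    have uy: "\<bar>u \<bullet> y\<bar> \<le> R'"
      using Cauchy_Schwarz_ineq2[of u y] u y by auto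
    define j where "j = \<lfloor>u \<bullet> y / e\<rfloor>"
    have "y \<in> S j"
    proof -
      have "of_int j \<le> u \<bullet> y / e" "u \<bullet> y / e < of_int j + 1" unfolding j_def by linarith+
      then show ?thesis using y e by (auto simp: S_def field_simps)
    qed
    moreover have "j \<in> {-N..N}"
    proof -
      have "\<bar>u \<bullet> y / e\<bar> \<le> of_int N"
        using uy e N(3) by (auto simp: abs_divide intro: order_trans[OF divide_right_mono])
      then have "u \<bullet> y / e \<le> of_int N" "of_int (- N) \<le> u \<bullet> y / e" by linarith+
      then show ?thesis unfolding j_def by (auto simp: floor_le_iff le_floor_iff)
    qed
    ultimately show "y \<in> (\<Union>j\<in>{-N..N}. S j)" by blast
  qed
  then have "emeasure lborel (cball 0 R' :: 'a set) \<le> emeasure lborel (\<Union>j\<in>{-N..N}. S j)"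
    using S by (intro emeasure_mono) auto
  also have "\<dots> \<le> (\<Sum>j\<in>{-N..N}. emeasure lborel (S j))"
    using S by (intro emeasure_subadditive_finite) auto
  also have "\<dots> \<le> (\<Sum>j\<in>{-N..N}. emeasure lborel ?D)" by (intro sum_mono SD)
  also have "\<dots> = ennreal (2 * of_int N + 1) * emeasure lborel ?D"
    using N(1) by (simp add: ennreal_of_nat_eq_real_of_nat)
  \<comment> \<open>There are 2N + 1 \<le> 2R'/e + 3 slices, and 1 \<le> R'/e turns this into
    5R'/e.\<close>
  also have "\<dots> \<le> ennreal (5 * R' / e) * emeasure lborel ?D"
  proof (intro mult_right_mono ennreal_leI)
    have "1 \<le> R' / e" using R' e by simp
    then have "2 * of_int N + 1 \<le> 5 * (R' / e)" using N(2) by linarith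
    then show "2 * of_int N + 1 \<le> 5 * R' / e" by simp
  qed auto
  finally have le: "ennreal (unit_ball_vol DIM('a) * R' ^ DIM('a)) \<le> ennreal (5 * R' / e) * emeasure lborel ?D"
    using R' by (simp add: emeasure_cball)
  have fin: "emeasure lborel ?D < \<infinity>"
    by (rule order_le_less_trans[OF emeasure_mono[of _ "cball 0 R"] emeasure_bounded_finite]) auto
  then obtain v where v: "emeasure lborel ?D = ennreal v" "0 \<le> v"
    using less_top_ennreal by auto
  have "unit_ball_vol DIM('a) * R' ^ DIM('a) \<le> 5 * R' / e * v"
    using le R' e v by (simp add: ennreal_mult'[symmetric])
  moreover have "R' ^ DIM('a) = R' * R' ^ (DIM('a) - 1)"
    by (metis DIM_positive Suc_diff_1 power_Suc)
  ultimately have "unit_ball_vol DIM('a) * R' ^ (DIM('a) - 1) * (e / 5) \<le> v"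
    using R' e by (simp add: field_simps)
  then show ?thesis unfolding v R'_def[symmetric] by (rule ennreal_leI)
qed

text \<open>A finite subcover makes the bound uniform and its Lebesgue number makes the
  neighbourhood uniform. The sum of the absolute values dominates all local bounds and makes sense
  for an empty cover too. The points y range over a neighbourhood of C, not just over C.\<close>

lemma compact_locally_uniform:
  fixes P :: "real \<Rightarrow> 'a::metric_space \<Rightarrow> bool"
  assumes C: "compact C" and mono: "\<And>B B' y. B \<le> B' \<Longrightarrow> P B y \<Longrightarrow> P B' y"
    and loc: "\<And>z. z \<in> C \<Longrightarrow> \<exists>e>0. \<exists>B. \<forall>y\<in>ball z e. P B y"
  obtains \<eta> B where "\<eta> > 0" "\<And>z y. z \<in> C \<Longrightarrow> dist z y < \<eta> \<Longrightarrow> P B y"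
proof -
  obtain e B where eB: "\<And>z. z \<in> C \<Longrightarrow> e z > 0 \<and> (\<forall>y\<in>ball z (e z). P (B z) y)"
    using loc by metis
  obtain D where D: "D \<subseteq> C" "finite D" "C \<subseteq> (\<Union>z\<in>D. ball z (e z))"
  proof (rule compactE_image[OF C, of C "\<lambda>z. ball z (e z)"])
    show "C \<subseteq> (\<Union>z\<in>C. ball z (e z))" using eB by force
  qed auto
  obtain \<eta> where \<eta>: "\<eta> > 0" "\<And>x. x \<in> C \<Longrightarrow> \<exists>G\<in>(\<lambda>z. ball z (e z)) ` D. ball x \<eta> \<subseteq> G"
    using Heine_Borel_lemma[OF C, of "(\<lambda>z. ball z (e z)) ` D"] D(3) by auto
  have "P (\<Sum>z\<in>D. \<bar>B z\<bar>) y" if zy: "z \<in> C" "dist z y < \<eta>" for z y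
  proof -
    obtain w where w: "w \<in> D" "y \<in> ball w (e w)" using \<eta>(2)[OF zy(1)] zy(2) by auto
    have "B w \<le> \<bar>B w\<bar>" by simp
    also have "\<dots> \<le> (\<Sum>z\<in>D. \<bar>B z\<bar>)" using w D by (intro member_le_sum) auto
    finally show ?thesis using mono eB w D(1) by blast
  qed
  then show thesis using that \<eta>(1) by blast
qed

text \<open>Of the rolling ball only the radius is kept, since a translate amounts to a choice of
  centre.\<close>

locale rolling_body =
  fixes K :: "'a::euclidean_space set" and r :: real
  assumes convex_K: "convex K" and compact_K: "compact K" and interior_K: "0 \<in> interior K"
    and r_pos: "0 < r"
    and rolling: "\<And>p. p \<in> frontier K \<Longrightarrow> \<exists>c. p \<in> cball c r \<and> cball c r \<subseteq> K"
begin

abbreviation h :: "'a \<Rightarrow> real" where "h \<equiv> support_fun K"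

lemma K_nonempty: "K \<noteq> {}"
  using interior_K interior_subset by auto

text \<open>An interior point lies on a chord of \<open>K\<close>; the convex hull of the two balls touching at its
  endpoints contains the required ball.\<close>

lemma interior_ball:
  assumes "x \<in> K" obtains c where "x \<in> cball c r" "cball c r \<subseteq> K"
proof (cases "x \<in> interior K")
  case False
  then have "x \<in> frontier K"
    using assms closure_subset by (auto simp: frontier_def)
  then show ?thesis using rolling that by blast
next
  case True
  obtain b :: 'a where b: "b \<in> Basis" using nonempty_Basis by blast
  then have b0: "b \<noteq> 0" "- b \<noteq> 0" by auto
  have bd: "bounded K" by (rule compact_imp_bounded[OF compact_K])
  obtain d1 where d1: "0 < d1" "x + d1 *\<^sub>R b \<in> frontier K"
    using ray_to_frontier[OF bd True b0(1)] by metis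
  obtain d2 where d2: "0 < d2" "x + d2 *\<^sub>R (- b) \<in> frontier K"
    using ray_to_frontier[OF bd True b0(2)] by metis
  define p1 p2 where "p1 = x + d1 *\<^sub>R b" and "p2 = x + d2 *\<^sub>R (- b)"
  obtain c1 where c1: "p1 \<in> cball c1 r" "cball c1 r \<subseteq> K" using rolling[OF d1(2)] by (auto simp: p1_def)
  obtain c2 where c2: "p2 \<in> cball c2 r" "cball c2 r \<subseteq> K" using rolling[OF d2(2)] by (auto simp: p2_def)
  \<comment> \<open>The weight of p1 in x on the chord, proportional to the distance from x to the
    opposite endpoint p2.\<close>
  define s where "s = d2 / (d1 + d2)"
  have s: "0 \<le> s" "s \<le> 1" "1 - s = d1 / (d1 + d2)" using d1 d2 by (auto simp: s_def field_simps)
  have sx: "s *\<^sub>R p1 + (1 - s) *\<^sub>R p2 = x"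
  proof -
    have "s *\<^sub>R p1 + (1 - s) *\<^sub>R p2 = x + (s * d1 - (1 - s) * d2) *\<^sub>R b"
      by (simp add: p1_def p2_def algebra_simps)
    also have "s * d1 - (1 - s) * d2 = 0" unfolding s(3) by (simp add: s_def)
    finally show ?thesis by simp
  qed
  define c where "c = s *\<^sub>R c1 + (1 - s) *\<^sub>R c2"
  have "norm (c - x) \<le> r"
  proof -
    have "c - x = s *\<^sub>R (c1 - p1) + (1 - s) *\<^sub>R (c2 - p2)"
      unfolding c_def sx[symmetric] by (simp add: algebra_simps)
    also have "norm \<dots> \<le> s * norm (c1 - p1) + (1 - s) * norm (c2 - p2)"
      by (rule order_trans[OF norm_triangle_ineq]) (use s(1,2) in \<open>simp add: abs_of_nonneg\<close>)
    also have "\<dots> \<le> s * r + (1 - s) * r"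
      using c1(1) c2(1) s by (intro add_mono mult_left_mono) (auto simp: dist_norm)
    finally show ?thesis by (simp add: algebra_simps)
  qed
  moreover have "cball c r \<subseteq> K"
  proof
    fix y assume y: "y \<in> cball c r"
    have "c1 + (y - c) \<in> K" "c2 + (y - c) \<in> K"
      using y c1(2) c2(2) by (auto simp: subset_iff dist_norm norm_minus_commute)
    then have "s *\<^sub>R (c1 + (y - c)) + (1 - s) *\<^sub>R (c2 + (y - c)) \<in> K"
      using s by (intro convexD[OF convex_K]) auto
    then show "y \<in> K" by (simp add: c_def algebra_simps)
  qed
  ultimately show ?thesis using that by (simp add: dist_norm)
qed

lemma support_point_in_frontier:
  assumes "norm u = 1" "p \<in> K" "u \<bullet> p = h u" shows "p \<in> frontier K"
proof -
  have "p \<notin> interior K"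
  proof
    assume "p \<in> interior K"
    then obtain e where e: "e > 0" "cball p e \<subseteq> K" by (auto simp: mem_interior_cball)
    have "u \<bullet> (p + e *\<^sub>R u) \<le> h u"
      using e assms(1) by (intro support_fun_ge compact_K) (auto simp: subset_iff dist_norm)
    then show False using assms e by (simp add: inner_add_right dot_square_norm)
  qed
  then show ?thesis using assms closure_subset by (auto simp: frontier_def)
qed

text \<open>The ball at a support point p has height at least h u at its top and, lying in K, at
  most h u. Its top is thus a support point and serves as contact point in place of p.\<close>

lemma touching_ball:
  assumes u: "norm u = 1"
  obtains c where "cball c r \<subseteq> K" "h u = u \<bullet> c + r" "c + r *\<^sub>R u \<in> frontier K"
proof -
  obtain p where p: "p \<in> K" "u \<bullet> p = h u" by (rule support_fun_attained[OF compact_K K_nonempty])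
  obtain c where c: "p \<in> cball c r" "cball c r \<subseteq> K"
    using rolling support_point_in_frontier[OF u p] by blast
  have top: "c + r *\<^sub>R u \<in> K" using c r_pos u by (auto simp: subset_iff dist_norm)
  have utop: "u \<bullet> (c + r *\<^sub>R u) = u \<bullet> c + r" using u by (simp add: inner_add_right dot_square_norm)
  have "u \<bullet> (p - c) \<le> norm u * norm (p - c)" by (rule norm_cauchy_schwarz)
  then have "h u \<le> u \<bullet> c + r"
    using c(1) u p by (simp add: inner_diff_right dist_norm norm_minus_commute)
  moreover have "u \<bullet> c + r \<le> h u" using support_fun_ge[OF compact_K top, of u] utop by simp
  ultimately have "h u = u \<bullet> c + r" by simp
  then show ?thesis using that c(2) support_point_in_frontier[OF u top] utop by simp
qed

text \<open>Comparison with the ball around c gives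
  \<open>h v - v \<bullet> x \<ge> r - \<rho> (v \<bullet> w)\<close>, so normals of caps of height
  t containing x make an angle of order sqrt (t/r) with w. One centre w serves all t.\<close>

lemma cap_normals_subset:
  assumes x: "x \<in> K"
  obtains w where "\<And>t. {v \<in> sphere 0 1. h v - v \<bullet> x < t} \<subseteq> sphere 0 1 \<inter> cball w (2 * sqrt (t / r))"
proof -
  obtain c where c: "x \<in> cball c r" "cball c r \<subseteq> K" by (rule interior_ball[OF x])
  obtain b :: 'a where b: "b \<in> Basis" using nonempty_Basis by blast
  \<comment> \<open>At the centre of the ball every direction is equally good; b is an arbitrary
    unit vector.\<close>
  define w where "w = (if x = c then b else sgn (x - c))"
  define \<rho> where "\<rho> = norm (x - c)"
  have w: "norm w = 1" "x - c = \<rho> *\<^sub>R w" using b by (auto simp: w_def \<rho>_def norm_sgn sgn_div_norm)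
  have \<rho>: "0 \<le> \<rho>" "\<rho> \<le> r" using c(1) by (auto simp: \<rho>_def dist_norm norm_minus_commute)
  have "v \<in> cball w (2 * sqrt (t / r))" if v: "norm v = 1" "h v - v \<bullet> x < t" for v t
  proof -
    have "v \<bullet> (c + r *\<^sub>R v) \<le> h v"
      using c(2) v r_pos by (intro support_fun_ge compact_K) (auto simp: subset_iff dist_norm)
    then have "v \<bullet> c + r \<le> h v" using v(1) by (simp add: inner_add_right dot_square_norm)
    moreover have "v \<bullet> x = v \<bullet> c + \<rho> * (v \<bullet> w)"
      using arg_cong[OF w(2), of "(\<bullet>) v"] by (simp add: inner_diff_right)
    ultimately have lt: "r - \<rho> * (v \<bullet> w) < t" using v(2) by linarith
    have vw: "\<bar>v \<bullet> w\<bar> \<le> 1" using Cauchy_Schwarz_ineq2[of v w] v w by simp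
    \<comment> \<open>For v on the side of w the bound is even t, weakened by t > 0. On the opposite
      side r < t already suffices, as 1 - v \<bullet> w is at most 2.\<close>
    have "r * (1 - v \<bullet> w) \<le> 2 * t"
    proof (cases "v \<bullet> w \<ge> 0")
      case True
      then have "\<rho> * (v \<bullet> w) \<le> r * (v \<bullet> w)" using \<rho> by (intro mult_right_mono)
      moreover have "\<rho> * (v \<bullet> w) \<le> r * 1" using \<rho> vw True by (intro mult_mono) auto
      ultimately show ?thesis using lt by (simp add: algebra_simps)
    next
      case False
      then have "\<rho> * (v \<bullet> w) \<le> 0" using \<rho> by (simp add: mult_nonneg_nonpos)
      moreover have "r * (1 - v \<bullet> w) \<le> r * 2" using vw r_pos by (intro mult_left_mono) auto
      ultimately show ?thesis using lt by simp
    qed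
    moreover have "(norm (v - w))^2 = 2 * (1 - v \<bullet> w)"
      unfolding power2_norm_eq_inner using v(1)[unfolded norm_eq_1] w(1)[unfolded norm_eq_1]
      by (simp add: inner_diff_left inner_diff_right inner_commute)
    then have "r * (norm (v - w))^2 = 2 * (r * (1 - v \<bullet> w))" by simp
    ultimately have "r * (norm (v - w))^2 \<le> 4 * t" by linarith
    then have "(norm (v - w))^2 \<le> 4 * (t / r)" using r_pos by (simp add: field_simps)
    then have "norm (v - w) \<le> sqrt (4 * (t / r))" by (rule real_le_rsqrt)
    then show ?thesis unfolding real_sqrt_mult by (simp add: dist_norm norm_minus_commute)
  qed
  then show thesis by (intro that[of w] subsetI) auto
qed

text \<open>P is the top of the touching ball. For z = x - P, \<open>|z|^2 \<le> r t\<close> and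
  \<open>u \<bullet> z \<le> -t/2\<close> give \<open>|r u + z|^2 \<le> r^2 - r t + r t\<close>, so
  x lies in that ball. The form \<open>2 * (t / 2)\<close> matches
  \<open>emeasure_slab_ball_ge\<close> with e = t/2.\<close>

lemma cap_contains_slab:
  assumes u: "norm u = 1" and t: "0 < t"
  obtains P where "P \<in> frontier K"
    "\<And>x. norm (x - P) \<le> sqrt (r * t) \<Longrightarrow> t / 2 \<le> - u \<bullet> (x - P) \<Longrightarrow> - u \<bullet> (x - P) < 2 * (t / 2) \<Longrightarrow>
      x \<in> K \<and> h u - u \<bullet> x < t"
proof -
  obtain c where c: "cball c r \<subseteq> K" "h u = u \<bullet> c + r" "c + r *\<^sub>R u \<in> frontier K"
    by (rule touching_ball[OF u])
  show thesis
  proof (rule that[OF c(3)])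
    fix x assume x: "norm (x - (c + r *\<^sub>R u)) \<le> sqrt (r * t)"
      "t / 2 \<le> - u \<bullet> (x - (c + r *\<^sub>R u))" "- u \<bullet> (x - (c + r *\<^sub>R u)) < 2 * (t / 2)"
    define z where "z = x - (c + r *\<^sub>R u)"
    have z: "norm z \<le> sqrt (r * t)" "t / 2 \<le> - (u \<bullet> z)" "- (u \<bullet> z) < t" "x = c + r *\<^sub>R u + z"
      using x by (auto simp: z_def)
    have "(norm z)^2 \<le> r * t"
      using z(1) r_pos t power_mono[OF z(1), of 2] by simp
    moreover have "r * t \<le> - 2 * r * (u \<bullet> z)" using mult_left_mono[OF z(2), of "2 * r"] r_pos by simp
    moreover have "(norm (r *\<^sub>R u + z))^2 = r^2 + 2 * r * (u \<bullet> z) + (norm z)^2"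
      unfolding power2_norm_eq_inner using u[unfolded norm_eq_1]
      by (simp add: inner_add_left inner_add_right inner_commute power2_eq_square)
    ultimately have "(norm (r *\<^sub>R u + z))^2 \<le> r^2" by linarith
    then have "norm (r *\<^sub>R u + z) \<le> r" using r_pos by (simp add: power2_le_iff_abs_le)
    moreover have "x - c = r *\<^sub>R u + z" using z(4) by simp
    ultimately have "x \<in> cball c r" by (metis dist_norm dist_commute mem_cball)
    moreover have "h u - u \<bullet> x < t" unfolding z(4) c(2) using z(3) u by (simp add: inner_add_right dot_square_norm)
    ultimately show "x \<in> K \<and> h u - u \<bullet> x < t" using c(1) by blast
  qed
qed

end

section \<open>Random points and cap probabilities\<close>

text \<open>Equal to 2 + (d-1)/2: the squared gap times the area of the directions whose caps
  contain a given point.\<close>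

abbreviation gap_exp :: "nat \<Rightarrow> real" where "gap_exp d \<equiv> (real d + 3) / 2"

text \<open>The quotient of \<open>gap_exp\<close> by (d+1)/2, that is, the same power expressed
  through the cap probability; it is also the rate of the theorem.\<close>

abbreviation quantile_exp :: "nat \<Rightarrow> real" where "quantile_exp d \<equiv> (real d + 3) / (real d + 1)"

locale random_body = rolling_body K r for K :: "'a::euclidean_space set" and r +
  fixes \<rho> :: "'a \<Rightarrow> real" and q :: "real \<times> 'a \<Rightarrow> real"
  assumes dim: "DIM('a) \<ge> 2"
    and density: "prob_density_on K \<rho>"
    and weight: "locally_integrable_weight q"
    and \<rho>_boundary: "\<And>p. p \<in> frontier K \<Longrightarrow> \<rho> p > 0 \<and> continuous (at p within K) \<rho>"
    and q_boundary: "\<And>z. z \<in> support_graph K \<Longrightarrow> continuous (at z within UNIV \<times> sphere 0 1) q"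
begin

definition M :: "'a measure" where
  "M = density lborel (\<lambda>x. ennreal (\<rho> x) * indicator K x)"

lemma K_borel [measurable]: "K \<in> sets borel"
  using compact_K by (simp add: borel_closed compact_imp_closed)

lemma density_measurable [measurable]: "(\<lambda>x. ennreal (\<rho> x) * indicator K x) \<in> borel_measurable borel"
proof -
  have "\<rho> \<in> borel_measurable (restrict_space borel K)" using density by (simp add: prob_density_on_def)
  then have "(\<lambda>x. ennreal (\<rho> x)) \<in> borel_measurable (restrict_space borel K)" by measurable
  then show ?thesis
    by (rule borel_measurable_restrict_space_iff_ennreal[THEN iffD1, rotated]) simp
qed

lemma sets_M [simp, measurable_cong]: "sets M = sets borel" by (simp add: M_def)

lemma space_M [simp]: "space M = UNIV" by (simp add: M_def)

sublocale M: prob_space M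
proof
  show "emeasure M (space M) = 1"
    unfolding M_def using density density_measurable
    by (subst emeasure_density) (auto simp: prob_density_on_def)
qed

lemma AE_M_in_K: "AE x in M. x \<in> K"
proof -
  have "(\<lambda>x. ennreal (\<rho> x) * indicator K x) \<in> borel_measurable lborel"
    using density_measurable by (simp only: measurable_lborel1 measurable_lborel2)
  then show ?thesis
    unfolding M_def by (simp only: AE_density) (auto simp: indicator_def)
qed

lemma iid_points_eq: "iid_points K \<rho> n = (\<Pi>\<^sub>M i\<in>{..<n}. M)"
  by (simp add: iid_points_def M_def)

text \<open>Fixed once so that all support values of points of K in unit directions lie in one
  compact interval, to which local integrability of q applies.\<close>

definition R :: real where "R = (SOME R. 0 < R \<and> K \<subseteq> cball 0 R)"

lemma R: "0 < R" "K \<subseteq> cball 0 R"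
proof -
  obtain R' where "0 < R'" "K \<subseteq> ball 0 R'"
    using bounded_subset_ballD[OF compact_imp_bounded[OF compact_K], of 0] by blast
  then have "\<exists>R. 0 < R \<and> K \<subseteq> cball 0 R" using ball_subset_cball by blast
  from someI_ex[OF this] show "0 < R" "K \<subseteq> cball 0 R" by (auto simp: R_def)
qed

lemma inner_le_R: "u \<in> sphere 0 1 \<Longrightarrow> x \<in> K \<Longrightarrow> \<bar>u \<bullet> x\<bar> \<le> R"
  using Cauchy_Schwarz_ineq2[of u x] R(2) by auto

lemma h_measurable [measurable]: "h \<in> borel_measurable borel"
  by (intro borel_measurable_continuous_onI continuous_on_support_fun compact_K K_nonempty)

lemma h_nonneg: "0 \<le> h u"
  using support_fun_ge[OF compact_K, of 0 u] interior_K interior_subset by auto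

definition normals_const :: real where
  "normals_const = sphere_cap_const TYPE('a) * (2 / sqrt r) ^ (DIM('a) - 1)"

lemma normals_const_nonneg: "0 \<le> normals_const"
  using r_pos by (simp add: normals_const_def sphere_cap_const_nonneg)

lemma sqrt_power_eq_powr: "0 < t \<Longrightarrow> sqrt t ^ n = t powr (real n / 2)"
  by (simp add: powr_half_sqrt[symmetric] powr_realpow[symmetric] powr_powr)

lemma emeasure_cap_normals_le:
  assumes "x \<in> K" "0 < t"
  shows "emeasure sphere_measure {v \<in> space sphere_measure. h v - v \<bullet> x < t}
    \<le> ennreal (normals_const * t powr (real (DIM('a) - 1) / 2))"
proof -
  obtain w where "{v \<in> sphere 0 1. h v - v \<bullet> x < t} \<subseteq> sphere 0 1 \<inter> cball w (2 * sqrt (t / r))"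
    using cap_normals_subset[OF assms(1)] by metis
  then have "emeasure sphere_measure {v \<in> space sphere_measure. h v - v \<bullet> x < t}
      \<le> ennreal (sphere_cap_const TYPE('a) * (2 * sqrt (t / r)) ^ (DIM('a) - 1))"
    using assms r_pos by (intro emeasure_sphere_measure_cap[where w = w]) auto
  also have "(2 * sqrt (t / r)) ^ (DIM('a) - 1) = (2 / sqrt r) ^ (DIM('a) - 1) * sqrt t ^ (DIM('a) - 1)"
    by (simp add: power_mult_distrib[symmetric] real_sqrt_divide)
  also have "sqrt t ^ (DIM('a) - 1) = t powr (real (DIM('a) - 1) / 2)"
    by (rule sqrt_power_eq_powr[OF assms(2)])
  finally show ?thesis by (simp add: normals_const_def mult.assoc)
qed

section \<open>Uniform bounds for the weight and the density near the boundary\<close>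

lemma compact_support_graph: "compact (support_graph K)"
proof -
  have "support_graph K = (\<lambda>u. (h u, u)) ` sphere 0 1"
    using h_nonneg by (auto simp: support_graph_def)
  then show ?thesis
    by (simp add: compact_continuous_image continuous_on_Pair continuous_on_support_fun
        compact_K K_nonempty)
qed

text \<open>Continuity bounds q locally at each point of the support graph, and compactness of the
  graph makes the bound uniform. Continuity of q enters the proof through this bound alone.\<close>

lemma weight_bounded_near_boundary:
  obtains \<tau> B where "0 < \<tau>" "0 \<le> B"
    "\<And>s u. u \<in> sphere 0 1 \<Longrightarrow> \<bar>s - h u\<bar> < \<tau> \<Longrightarrow> q (s, u) \<le> B"
proof -
  obtain \<eta> B where \<eta>: "\<eta> > 0"
    and B: "\<And>z y. z \<in> support_graph K \<Longrightarrow> dist z y < \<eta> \<Longrightarrow> y \<in> UNIV \<times> sphere 0 1 \<longrightarrow> q y \<le> B"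
  proof (rule compact_locally_uniform[OF compact_support_graph,
        where P = "\<lambda>B y. y \<in> UNIV \<times> sphere 0 1 \<longrightarrow> q y \<le> B"])
    fix z assume z: "z \<in> support_graph K"
    then obtain e where e: "e > 0" "\<And>y. y \<in> UNIV \<times> sphere 0 1 \<Longrightarrow> dist y z < e \<Longrightarrow> dist (q y) (q z) < 1"
      using q_boundary[OF z] unfolding continuous_within_eps_delta by (metis zero_less_one)
    show "\<exists>e>0. \<exists>B. \<forall>y\<in>ball z e. y \<in> UNIV \<times> sphere 0 1 \<longrightarrow> q y \<le> B"
    proof (rule exI[of _ e], rule conjI[OF e(1)], rule exI[of _ "q z + 1"], intro ballI impI)
      fix y assume "y \<in> ball z e" "y \<in> UNIV \<times> sphere 0 1"
      then have "dist (q y) (q z) < 1" using e(2)[of y] by (simp add: dist_commute)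
      then show "q y \<le> q z + 1" unfolding dist_real_def by linarith
    qed
  next
    fix B B' and y :: "real \<times> 'a" assume "B \<le> (B'::real)" "y \<in> UNIV \<times> sphere 0 1 \<longrightarrow> q y \<le> B"
    then show "y \<in> UNIV \<times> sphere 0 1 \<longrightarrow> q y \<le> B'" by linarith
  qed blast
  show thesis
  proof (rule that[OF \<eta>, of "max 0 B"])
    fix s u assume u: "u \<in> sphere 0 1" and s: "\<bar>s - h u\<bar> < \<eta>"
    have "(h u, u) \<in> support_graph K" using u h_nonneg by (simp add: support_graph_def)
    moreover have "dist (h u, u) (s, u) < \<eta>" using s by (simp add: dist_Pair_Pair dist_real_def abs_minus_commute)
    ultimately show "q (s, u) \<le> max 0 B" using B u by fastforce
  qed simp
qed

lemma compact_frontier_K: "compact (frontier K)"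
  using compact_K by (rule compact_frontier)

text \<open>\<open>compact_locally_uniform\<close> needs a property that weakens as B grows; writing
  the lower bound as exp (-B) achieves this and keeps it positive.\<close>

lemma density_bounded_below_near_boundary:
  obtains \<eta> c where "0 < \<eta>" "0 < c"
    "\<And>p x. p \<in> frontier K \<Longrightarrow> x \<in> K \<Longrightarrow> dist p x < \<eta> \<Longrightarrow> c \<le> \<rho> x"
proof -
  obtain \<eta> B where \<eta>: "\<eta> > 0"
    and B: "\<And>p y. p \<in> frontier K \<Longrightarrow> dist p y < \<eta> \<Longrightarrow> y \<in> K \<longrightarrow> exp (- B) \<le> \<rho> y"
  proof (rule compact_locally_uniform[OF compact_frontier_K, where P = "\<lambda>B y. y \<in> K \<longrightarrow> exp (- B) \<le> \<rho> y"])
    fix B B' y assume "B \<le> (B'::real)" "y \<in> K \<longrightarrow> exp (- B) \<le> \<rho> y"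
    then show "y \<in> K \<longrightarrow> exp (- B') \<le> \<rho> y" by (meson exp_le_cancel_iff neg_le_iff_le order_trans)
  next
    fix p assume p: "p \<in> frontier K"
    then have "\<rho> p > 0" "continuous (at p within K) \<rho>" using \<rho>_boundary by auto
    then obtain e where e: "e > 0" "\<And>y. y \<in> K \<Longrightarrow> dist y p < e \<Longrightarrow> dist (\<rho> y) (\<rho> p) < \<rho> p / 2"
      unfolding continuous_within_eps_delta by (metis half_gt_zero)
    show "\<exists>e>0. \<exists>B. \<forall>y\<in>ball p e. y \<in> K \<longrightarrow> exp (- B) \<le> \<rho> y"
    proof (rule exI[of _ e], rule conjI[OF e(1)], rule exI[of _ "- ln (\<rho> p / 2)"], intro ballI impI)
      fix y assume "y \<in> ball p e" "y \<in> K"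
      then have "dist (\<rho> y) (\<rho> p) < \<rho> p / 2" using e(2)[of y] by (simp add: dist_commute)
      then have "\<rho> p / 2 \<le> \<rho> y" unfolding dist_real_def by linarith
      then show "exp (- (- ln (\<rho> p / 2))) \<le> \<rho> y" using \<open>\<rho> p > 0\<close> by simp
    qed
  qed blast
  then show thesis using that[OF \<eta>, of "exp (- B)"] by auto
qed

text \<open>The cap contains a piece of the touching ball of extent sqrt (r t) across and t/2 in
  height. Its volume is of order \<open>t^((d-1)/2) t\<close>, and the density is bounded below on
  it.\<close>

lemma prob_cap_ge:
  obtains c t0 where "0 < c" "0 < t0"
    "\<And>u t. u \<in> sphere 0 1 \<Longrightarrow> 0 < t \<Longrightarrow> t \<le> t0 \<Longrightarrow>
      c * t powr ((real DIM('a) + 1) / 2) \<le> M.prob {x. h u - u \<bullet> x < t}"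
proof -
  obtain \<eta> c0 where \<eta>: "0 < \<eta>" and c0: "0 < c0"
    and lower: "\<And>p x. p \<in> frontier K \<Longrightarrow> x \<in> K \<Longrightarrow> dist p x < \<eta> \<Longrightarrow> c0 \<le> \<rho> x"
    using density_bounded_below_near_boundary by blast
  define k where "k = DIM('a) - 1"
  \<comment> \<open>The value of \<open>emeasure_slab_ball_ge\<close> at radius sqrt (r t) and e =
    t/2, freed of its powers of t; 10 is 5 times 2.\<close>
  define c where "c = c0 * (unit_ball_vol DIM('a) * (sqrt r / 4) ^ k / 10)"
  \<comment> \<open>The first bound ensures t/2 \<le> s/4, as the slab estimate requires; the second
    ensures s < \<eta>, so that the slab stays where the density is at least c0.\<close>
  define t0 where "t0 = min (r / 4) (\<eta>^2 / (2 * r))"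
  have ubv: "unit_ball_vol (real DIM('a)) > 0" by (rule unit_ball_vol_pos) simp
  have "0 < c" using c0 r_pos ubv by (simp add: c_def)
  moreover have "0 < t0" using r_pos \<eta> by (simp add: t0_def)
  moreover have "c * t powr ((real DIM('a) + 1) / 2) \<le> M.prob {x. h u - u \<bullet> x < t}"
    if u: "u \<in> sphere 0 1" and t: "0 < t" "t \<le> t0" for u t
  proof -
    define s where "s = sqrt (r * t)"
    have nu: "norm u = 1" "norm (- u) = 1" using u by auto
    have "r * t < \<eta>^2"
    proof -
      have "r * t \<le> r * (\<eta>^2 / (2 * r))" using t r_pos by (intro mult_left_mono) (auto simp: t0_def)
      also have "\<dots> < \<eta>^2" using r_pos \<eta> by simp
      finally show ?thesis .
    qed
    then have s\<eta>: "s < \<eta>" using real_sqrt_less_mono[of "r * t" "\<eta>^2"] \<eta> by (simp add: s_def)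
    have ts: "t / 2 \<le> s / 4"
    proof -
      have "4 * t \<le> r" using t by (simp add: t0_def)
      then have "(2 * t)^2 \<le> r * t" using t by (simp add: power2_eq_square)
      then have "2 * t \<le> s" unfolding s_def by (rule real_le_rsqrt)
      then show ?thesis by simp
    qed
    obtain P where P: "P \<in> frontier K"
      "\<And>x. norm (x - P) \<le> sqrt (r * t) \<Longrightarrow> t / 2 \<le> - u \<bullet> (x - P) \<Longrightarrow> - u \<bullet> (x - P) < 2 * (t / 2) \<Longrightarrow>
      x \<in> K \<and> h u - u \<bullet> x < t"
      using cap_contains_slab[OF nu(1) t(1)] by blast
    define D where "D = {z. norm z \<le> s \<and> t / 2 \<le> - u \<bullet> z \<and> - u \<bullet> z < 2 * (t / 2)}"
    have D[measurable]: "D \<in> sets borel" unfolding D_def by measurable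
    define A where "A = {x. x - P \<in> D}"
    have A[measurable]: "A \<in> sets borel" unfolding A_def by measurable
    have AK: "x \<in> K \<and> h u - u \<bullet> x < t" if "x \<in> A" for x
      using that P(2)[of x] by (auto simp: A_def D_def s_def)
    have A\<rho>: "c0 \<le> \<rho> x" if "x \<in> A" for x
      using that lower[OF P(1)] AK[OF that] s\<eta> by (auto simp: A_def D_def dist_norm norm_minus_commute)
    have "c * t powr ((real DIM('a) + 1) / 2) = c0 * (unit_ball_vol DIM('a) * (s / 4) ^ k * (t / 2 / 5))"
    proof -
      have eq: "(real DIM('a) + 1) / 2 = real k / 2 + 1" using dim by (simp add: k_def of_nat_diff field_simps)
      have "t powr ((real DIM('a) + 1) / 2) = sqrt t ^ k * t"
        unfolding eq powr_add sqrt_power_eq_powr[OF t(1)] using t by simp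
      moreover have "(s / 4) ^ k = (sqrt r / 4) ^ k * sqrt t ^ k"
        by (simp add: s_def power_mult_distrib[symmetric] real_sqrt_mult)
      ultimately show ?thesis by (simp add: c_def)
    qed
    then have "ennreal (c * t powr ((real DIM('a) + 1) / 2))
        = ennreal c0 * ennreal (unit_ball_vol DIM('a) * (s / 4) ^ k * (t / 2 / 5))"
      by (simp only: ennreal_mult'[OF less_imp_le[OF c0]])
    also have "\<dots> \<le> ennreal c0 * emeasure lborel D"
      unfolding D_def k_def using t ts nu
      by (intro mult_left_mono emeasure_slab_ball_ge) auto
    also have "\<dots> = ennreal c0 * emeasure lborel A"
      unfolding A_def by (simp add: emeasure_lborel_translation[OF D])
    also have "\<dots> = (\<integral>\<^sup>+x. ennreal c0 * indicator A x \<partial>lborel)"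
      by (rule nn_integral_cmult_indicator[symmetric]) simp
    also have "\<dots> \<le> (\<integral>\<^sup>+x. (ennreal (\<rho> x) * indicator K x) * indicator A x \<partial>lborel)"
      using A\<rho> AK by (intro nn_integral_mono) (auto simp: indicator_def intro: ennreal_leI)
    also have "\<dots> = emeasure M A"
      unfolding M_def using density_measurable by (subst emeasure_density) auto
    also have "\<dots> \<le> emeasure M {x. h u - u \<bullet> x < t}"
      using AK by (intro emeasure_mono) auto
    finally show ?thesis by (simp add: M.emeasure_eq_measure)
  qed
  ultimately show thesis using that by blast
qed

section \<open>Small gaps in all directions outside an exponentially rare event\<close>

lemma sphere_net:
  assumes "0 < (e::real)"
  obtains D :: "'a set" where "finite D" "D \<subseteq> sphere 0 1" "\<And>u. u \<in> sphere 0 1 \<Longrightarrow> \<exists>w\<in>D. norm (u - w) < e"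
proof -
  have "sphere 0 1 \<subseteq> (\<Union>u\<in>sphere (0::'a) 1. ball u e)" using assms by auto
  then obtain D where D: "D \<subseteq> sphere (0::'a) 1" "finite D" "sphere 0 1 \<subseteq> (\<Union>u\<in>D. ball u e)"
    using compactE_image[OF compact_sphere[of "0::'a" 1], of "sphere 0 1" "\<lambda>u. ball u e"] by (metis open_ball)
  have "\<exists>w\<in>D. norm (u - w) < e" if "u \<in> sphere 0 1" for u
    using D(3) that by (fastforce simp: dist_norm norm_minus_commute)
  then show thesis using that D by blast
qed

text \<open>The set \<open>bad I\<close> says that some direction of a finite net has an empty cap.
  Each such cap is missed with probability at most \<open>(1-p)^m\<close>. Lipschitz continuity
  carries the other case from the net to all directions, with p and N independent of the index
  set.\<close>

lemma bad_event:
  assumes t: "0 < (t::real)"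
  obtains N p :: real and bad :: "nat set \<Rightarrow> (nat \<Rightarrow> 'a) set" where "0 < p" "0 \<le> N"
    "\<And>I. finite I \<Longrightarrow> bad I \<in> sets (\<Pi>\<^sub>M i\<in>I. M)"
    "\<And>I. finite I \<Longrightarrow> emeasure (\<Pi>\<^sub>M i\<in>I. M) (bad I) \<le> ennreal (N * exp (- p * card I))"
    "\<And>I x u. finite I \<Longrightarrow> x \<in> space (\<Pi>\<^sub>M i\<in>I. M) \<Longrightarrow> x \<notin> bad I \<Longrightarrow> \<forall>i\<in>I. x i \<in> K \<Longrightarrow> u \<in> sphere 0 1 \<Longrightarrow>
      \<exists>i\<in>I. h u - u \<bullet> x i < t"
proof -
  obtain c t0 where c: "0 < c" "0 < t0"
    and cap: "\<And>u t. u \<in> sphere 0 1 \<Longrightarrow> 0 < t \<Longrightarrow> t \<le> t0 \<Longrightarrow>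
      c * t powr ((real DIM('a) + 1) / 2) \<le> M.prob {x. h u - u \<bullet> x < t}"
    using prob_cap_ge by blast
  define s where "s = min t0 (t / 2)"
  have s: "0 < s" "s \<le> t0" "s \<le> t / 2" using c t by (auto simp: s_def)
  define p where "p = c * s powr ((real DIM('a) + 1) / 2)"
  have p: "0 < p" using c s by (simp add: p_def)
  \<comment> \<open>With mesh t/(4R), replacing u by a net point changes h u and u \<bullet> x by
    less than t/4 each; together with s \<le> t/2 this stays below t.\<close>
  obtain D :: "'a set" where D: "finite D" "D \<subseteq> sphere 0 1"
    "\<And>u. u \<in> sphere 0 1 \<Longrightarrow> \<exists>w\<in>D. norm (u - w) < t / (4 * R)"
    using sphere_net[of "t / (4 * R)"] t R(1) by auto
  define X where "X w = {x. s \<le> h w - w \<bullet> x}" for w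
  have X[measurable]: "X w \<in> sets borel" for w unfolding X_def by measurable
  define bad where "bad I = (\<Union>w\<in>D. {x \<in> space (\<Pi>\<^sub>M i\<in>I. M). \<forall>i\<in>I. x i \<in> X w})" for I :: "nat set"
  have meas: "{x \<in> space (\<Pi>\<^sub>M i\<in>I. M). \<forall>i\<in>I. x i \<in> X w} \<in> sets (\<Pi>\<^sub>M i\<in>I. M)" if "finite I" for I :: "nat set" and w
    using that by measurable
  show thesis
  proof (rule that[of p "real (card D)" bad])
    fix I :: "nat set" assume I: "finite I"
    interpret pp: product_prob_space "\<lambda>_. M" I by unfold_locales
    show "bad I \<in> sets (\<Pi>\<^sub>M i\<in>I. M)"
      unfolding bad_def using D(1) meas[OF I] by (intro sets.finite_UN) auto
    have "emeasure (\<Pi>\<^sub>M i\<in>I. M) (bad I) \<le> (\<Sum>w\<in>D. emeasure (\<Pi>\<^sub>M i\<in>I. M) {x \<in> space (\<Pi>\<^sub>M i\<in>I. M). \<forall>i\<in>I. x i \<in> X w})"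
      unfolding bad_def using D(1) meas[OF I] by (intro emeasure_subadditive_finite) auto
    also have "\<dots> \<le> (\<Sum>w\<in>D. ennreal (exp (- p * card I)))"
    proof (rule sum_mono)
      fix w assume w: "w \<in> D"
      have "emeasure (\<Pi>\<^sub>M i\<in>I. M) {x \<in> space (\<Pi>\<^sub>M i\<in>I. M). \<forall>i\<in>I. x i \<in> X w} = (\<Prod>i\<in>I. emeasure M (X w))"
        using I by (intro pp.emeasure_PiM_Collect) auto
      also have "\<dots> = ennreal (M.prob (X w) ^ card I)"
        by (simp add: M.emeasure_eq_measure ennreal_power)
      also have "\<dots> \<le> ennreal (exp (- p) ^ card I)"
      proof (intro ennreal_leI power_mono)
        have "X w = space M - {x. h w - w \<bullet> x < s}" by (auto simp: X_def)
        then have "M.prob (X w) = 1 - M.prob {x. h w - w \<bullet> x < s}"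
          using M.prob_compl[of "{x. h w - w \<bullet> x < s}"] by simp
        also have "\<dots> \<le> 1 - p" using cap[of w s] w D(2) s by (auto simp: p_def)
        also have "\<dots> \<le> exp (- p)" using exp_ge_add_one_self[of "-p"] by simp
        finally show "M.prob (X w) \<le> exp (- p)" .
      qed simp
      finally show "emeasure (\<Pi>\<^sub>M i\<in>I. M) {x \<in> space (\<Pi>\<^sub>M i\<in>I. M). \<forall>i\<in>I. x i \<in> X w} \<le> ennreal (exp (- p * card I))"
        by (simp add: exp_of_nat_mult[symmetric] mult.commute)
    qed
    also have "\<dots> = ennreal (real (card D) * exp (- p * card I))"
      by (simp add: ennreal_mult ennreal_of_nat_eq_real_of_nat)
    finally show "emeasure (\<Pi>\<^sub>M i\<in>I. M) (bad I) \<le> ennreal (real (card D) * exp (- p * card I))" .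
    fix x and u :: 'a assume x: "x \<in> space (\<Pi>\<^sub>M i\<in>I. M)" "x \<notin> bad I" "\<forall>i\<in>I. x i \<in> K" and u: "u \<in> sphere 0 1"
    obtain w where w: "w \<in> D" "norm (u - w) < t / (4 * R)" using D(3)[OF u] by blast
    obtain i where i: "i \<in> I" "x i \<notin> X w" using x w(1) unfolding bad_def by blast
    have xi: "x i \<in> K" using i x by blast
    have "R * norm (u - w) < t / 4" using w(2) R(1) by (simp add: field_simps)
    moreover have "\<bar>h u - h w\<bar> \<le> R * norm (u - w)"
      by (rule support_fun_lipschitz[OF compact_K K_nonempty R(2)])
    moreover have "\<bar>(u - w) \<bullet> x i\<bar> \<le> R * norm (u - w)"
    proof -
      have "\<bar>(u - w) \<bullet> x i\<bar> \<le> norm (u - w) * norm (x i)" by (rule Cauchy_Schwarz_ineq2)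
      also have "\<dots> \<le> norm (u - w) * R" using xi R(2) by (intro mult_left_mono) auto
      finally show ?thesis by (simp add: mult.commute)
    qed
    moreover have "h w - w \<bullet> x i < s" using i by (simp add: X_def)
    ultimately have "h u - u \<bullet> x i < t" using s(3) by (simp add: inner_diff_left)
    then show "\<exists>i\<in>I. h u - u \<bullet> x i < t" using i by blast
  qed (use p in auto)
qed

section \<open>Weighted mean width of a random polytope\<close>

text \<open>Extension of q by zero off the sphere, which turns measurability on the product with the
  sphere into joint Borel measurability.\<close>

definition qs :: "'a \<Rightarrow> real \<Rightarrow> real" where "qs u s = indicator (sphere 0 1) u * q (s, u)"

lemma qs_nonneg: "0 \<le> qs u s"
  using weight by (simp add: qs_def locally_integrable_weight_def indicator_def)

lemma qs_measurable [measurable]: "case_prod qs \<in> borel_measurable (borel \<Otimes>\<^sub>M borel)"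
proof -
  have "q \<in> borel_measurable (restrict_space borel (UNIV \<times> sphere 0 1))"
    using weight by (simp add: locally_integrable_weight_def)
  then have "(\<lambda>z. indicator (UNIV \<times> sphere 0 1) z *\<^sub>R q z) \<in> borel_measurable borel"
    by (subst (asm) borel_measurable_restrict_space_iff) (auto simp: closed_Times borel_closed)
  then have "(\<lambda>z. indicator (UNIV \<times> sphere 0 1) z *\<^sub>R q z) \<in> borel_measurable (borel \<Otimes>\<^sub>M borel)"
    by (simp add: borel_prod)
  from measurable_compose[OF measurable_pair_swap' this]
  show ?thesis by (simp add: qs_def case_prod_unfold indicator_def cong: if_cong)
qed

lemma qs_measurable' [measurable (raw)]:
  assumes "f \<in> borel_measurable N" "g \<in> borel_measurable N"
  shows "(\<lambda>x. qs (f x) (g x)) \<in> borel_measurable N"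
  using measurable_compose[OF measurable_Pair[OF assms] qs_measurable] by simp

lemma qs_measurable1 [measurable]: "qs u \<in> borel_measurable borel"
  using qs_measurable'[of "\<lambda>_. u" borel "\<lambda>s. s"] by simp

text \<open>Mass of q in direction u over all support values that can occur. It is integrable over
  the sphere by local integrability, hence finite for almost every u only, and serves as dominating
  function.\<close>

definition q_mass :: "'a \<Rightarrow> ennreal" where
  "q_mass u = (\<integral>\<^sup>+s. ennreal (qs u s) * indicator {-R..R} s \<partial>lborel)"

lemma q_mass_measurable [measurable]: "q_mass \<in> borel_measurable borel"
  unfolding q_mass_def by measurable

lemma q_mass_finite: "(\<integral>\<^sup>+u. q_mass u \<partial>sphere_measure) < \<infinity>"
proof -
  have "(\<integral>\<^sup>+u. q_mass u \<partial>sphere_measure)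
      = (\<integral>\<^sup>+u. q_mass u * indicator (sphere 0 1) u \<partial>hausdorff_measure (DIM('a) - 1))"
    unfolding sphere_measure_def by (rule nn_integral_restrict_space) simp
  also have "\<dots> = (\<integral>\<^sup>+u\<in>sphere 0 1. (\<integral>\<^sup>+s\<in>{-R..R}. ennreal (q (s, u)) \<partial>lborel) \<partial>hausdorff_measure (DIM('a) - 1))"
    by (intro nn_integral_cong) (auto simp: q_mass_def qs_def indicator_def)
  also have "\<dots> < \<infinity>"
    using weight compact_Icc[of "-R" R] unfolding locally_integrable_weight_def by blast
  finally show ?thesis .
qed

lemma AE_q_mass_finite: "AE u in sphere_measure. q_mass u < \<infinity>"
proof -
  have "q_mass \<in> borel_measurable sphere_measure" by (rule borel_measurable_sphere_measure) measurable
  from nn_integral_PInf_AE[OF this] q_mass_finite show ?thesis by (auto simp: top.not_eq_extremum)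
qed

text \<open>The oriented integral of q from 0 to a. The half-open intervals make the difference of
  two kernels, for a \<le> b, exactly the indicator of {a..<b}, whatever the signs of a and
  b.\<close>

definition Q :: "'a \<Rightarrow> real \<Rightarrow> real" where
  "Q u a = (\<integral>s. (indicator {0..<a} s - indicator {a..<0} s) * qs u s \<partial>lborel)"

lemma Q_measurable [measurable]: "case_prod Q \<in> borel_measurable (borel \<Otimes>\<^sub>M borel)"
proof -
  have "(\<lambda>(p::'a \<times> real, s::real). (indicator {0..<snd p} s - indicator {snd p..<0} s) * qs (fst p) s)
      \<in> borel_measurable ((borel \<Otimes>\<^sub>M borel) \<Otimes>\<^sub>M lborel)"
    unfolding indicator_def atLeastLessThan_iff case_prod_unfold by measurable
  from lborel.borel_measurable_lebesgue_integral[OF this]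
  show ?thesis by (simp add: Q_def case_prod_unfold)
qed

lemma interval_integral_q:
  assumes u: "u \<in> sphere 0 1"
  shows "(LBINT s=0..a. q (s, u)) = Q u a"
proof -
  \<comment> \<open>The interval integral uses open intervals; they differ from those of Q at most
    in 0 and a.\<close>
  have ae: "AE s in lborel. s \<noteq> 0 \<and> s \<noteq> a"
    using AE_lborel_singleton[of 0] AE_lborel_singleton[of a] by eventually_elim simp
  have qm: "(\<lambda>s. q (s, u)) \<in> borel_measurable borel"
    using qs_measurable'[of "\<lambda>_. u" borel "\<lambda>s. s"] u by (simp add: qs_def)
  note [measurable] = qm
  show ?thesis
  proof (cases "0 \<le> a")
    case True
    then have "(LBINT s=0..a. q (s, u)) = (\<integral>s. indicator {0<..<a} s * q (s, u) \<partial>lborel)"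
      by (simp add: interval_lebesgue_integral_def set_lebesgue_integral_def zero_ereal_def)
    also have "\<dots> = Q u a" unfolding Q_def
    proof (rule integral_cong_AE)
      show "AE s in lborel. indicator {0<..<a} s * q (s, u) = (indicator {0..<a} s - indicator {a..<0} s) * qs u s"
        using ae by eventually_elim (use True u in \<open>auto simp: qs_def indicator_def\<close>)
      show "(\<lambda>s. (indicator {0..<a} s - indicator {a..<0} s) * qs u s) \<in> borel_measurable lborel"
        by measurable
    qed measurable
    finally show ?thesis .
  next
    case False
    then have "(LBINT s=0..a. q (s, u)) = - (\<integral>s. indicator {a<..<0} s * q (s, u) \<partial>lborel)"
      by (simp add: interval_lebesgue_integral_def set_lebesgue_integral_def zero_ereal_def)
    also have "\<dots> = (\<integral>s. - (indicator {a<..<0} s * q (s, u)) \<partial>lborel)" by simp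
    also have "\<dots> = Q u a" unfolding Q_def
    proof (rule integral_cong_AE)
      show "AE s in lborel. - (indicator {a<..<0} s * q (s, u)) = (indicator {0..<a} s - indicator {a..<0} s) * qs u s"
        using ae by eventually_elim (use False u in \<open>auto simp: qs_def indicator_def\<close>)
      show "(\<lambda>s. (indicator {0..<a} s - indicator {a..<0} s) * qs u s) \<in> borel_measurable lborel"
        by measurable
    qed measurable
    finally show ?thesis .
  qed
qed

lemma integrable_qs:
  assumes "q_mass u < \<infinity>" and [measurable]: "A \<in> sets borel" and A: "A \<subseteq> {-R..R}"
  shows "integrable lborel (\<lambda>s. indicator A s * qs u s)"
proof (rule integrableI_bounded)
  show "(\<lambda>s. indicator A s * qs u s) \<in> borel_measurable lborel" by measurable
  have "(\<integral>\<^sup>+s. ennreal (norm (indicator A s * qs u s)) \<partial>lborel) \<le> q_mass u"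
    unfolding q_mass_def using A qs_nonneg
    by (intro nn_integral_mono) (auto simp: indicator_def)
  then show "(\<integral>\<^sup>+s. ennreal (norm (indicator A s * qs u s)) \<partial>lborel) < \<infinity>"
    using assms(1) by (rule order_le_less_trans)
qed

lemma integrable_Q_integrand:
  assumes "q_mass u < \<infinity>" "\<bar>a\<bar> \<le> R"
  shows "integrable lborel (\<lambda>s. (indicator {0..<a} s - indicator {a..<0} s) * qs u s)"
  unfolding left_diff_distrib using assms R(1)
  by (intro Bochner_Integration.integrable_diff integrable_qs) auto

lemma Q_diff:
  assumes "q_mass u < \<infinity>" "- R \<le> a" "a \<le> b" "b \<le> R"
  shows "ennreal (Q u b - Q u a) = (\<integral>\<^sup>+s. ennreal (qs u s) * indicator {a..<b} s \<partial>lborel)"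
    and "Q u a \<le> Q u b"
proof -
  have i: "integrable lborel (\<lambda>s. indicator {a..<b} s * qs u s)"
    using assms by (intro integrable_qs) auto
  have "Q u b - Q u a = (\<integral>s. ((indicator {0..<b} s - indicator {b..<0} s) * qs u s)
      - (indicator {0..<a} s - indicator {a..<0} s) * qs u s \<partial>lborel)"
    unfolding Q_def using assms
    by (intro Bochner_Integration.integral_diff[symmetric] integrable_Q_integrand) auto
  also have "\<dots> = (\<integral>s. indicator {a..<b} s * qs u s \<partial>lborel)"
    using assms by (intro Bochner_Integration.integral_cong) (auto simp: indicator_def)
  finally have eq: "Q u b - Q u a = (\<integral>s. indicator {a..<b} s * qs u s \<partial>lborel)" .
  have "ennreal (Q u b - Q u a) = (\<integral>\<^sup>+s. ennreal (indicator {a..<b} s * qs u s) \<partial>lborel)"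
    unfolding eq using qs_nonneg by (intro nn_integral_eq_integral[symmetric] i) auto
  also have "\<dots> = (\<integral>\<^sup>+s. ennreal (qs u s) * indicator {a..<b} s \<partial>lborel)"
    by (intro nn_integral_cong) (auto simp: indicator_def)
  finally show "ennreal (Q u b - Q u a) = (\<integral>\<^sup>+s. ennreal (qs u s) * indicator {a..<b} s \<partial>lborel)" .
  have "0 \<le> Q u b - Q u a" unfolding eq using qs_nonneg by (intro integral_nonneg_AE) auto
  then show "Q u a \<le> Q u b" by simp
qed

lemma Q_bound:
  assumes "q_mass u < \<infinity>" "\<bar>a\<bar> \<le> R"
  shows "\<bar>Q u a\<bar> \<le> enn2real (q_mass u)"
proof -
  have i: "integrable lborel (\<lambda>s. indicator {-R..R} s * qs u s)"
    using assms by (intro integrable_qs) auto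
  have "\<bar>Q u a\<bar> \<le> (\<integral>s. indicator {-R..R} s * qs u s \<partial>lborel)"
    unfolding Q_def using i
  proof (rule integral_abs_bound_integral[rotated])
    show "integrable lborel (\<lambda>s. (indicator {0..<a} s - indicator {a..<0} s) * qs u s)"
      using assms by (rule integrable_Q_integrand)
    show "\<bar>(indicator {0..<a} s - indicator {a..<0} s) * qs u s\<bar> \<le> indicator {-R..R} s * qs u s" for s
      using assms qs_nonneg[of u s] by (auto simp: indicator_def)
  qed
  also have "\<dots> = enn2real (\<integral>\<^sup>+s. ennreal (indicator {-R..R} s * qs u s) \<partial>lborel)"
    using i qs_nonneg by (intro integral_eq_nn_integral) auto
  also have "\<dots> = enn2real (q_mass u)"
    unfolding q_mass_def by (intro arg_cong[where f = enn2real] nn_integral_cong) (auto simp: indicator_def)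
  finally show ?thesis .
qed

text \<open>Indexed by a set rather than a number so that any single point can be left out.\<close>

definition W :: "nat set \<Rightarrow> (nat \<Rightarrow> 'a) \<Rightarrow> real" where
  "W J x = weighted_mean_width q (convex hull (x ` J))"

definition width_const :: real where
  "width_const = 2 / (real DIM('a) * measure lborel (ball (0::'a) 1))"

lemma width_const_nonneg: "0 \<le> width_const"
  by (simp add: width_const_def)

text \<open>The support function of the hull, by \<open>support_fun_convex_hull_finite\<close>. As a
  finite maximum it is visibly measurable in the points; it is meaningful only for nonempty
  J.\<close>

definition hmax :: "nat set \<Rightarrow> (nat \<Rightarrow> 'a) \<Rightarrow> 'a \<Rightarrow> real" where
  "hmax J x u = Max ((\<lambda>j. u \<bullet> x j) ` J)"

lemma Q_measurable' [measurable (raw)]: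
  assumes "f \<in> borel_measurable N" "g \<in> borel_measurable N"
  shows "(\<lambda>x. Q (f x) (g x)) \<in> borel_measurable N"
  using measurable_compose[OF measurable_Pair[OF assms] Q_measurable] by simp

lemma W_eq:
  assumes "finite J" "J \<noteq> {}"
  shows "W J x = width_const * (\<integral>u. Q u (hmax J x u) \<partial>sphere_measure)"
proof -
  have "(LINT u:sphere 0 1|hausdorff_measure (DIM('a) - 1). (LBINT s=0..support_fun (convex hull (x ` J)) u. q (s, u)))
      = (\<integral>u. (LBINT s=0..support_fun (convex hull (x ` J)) u. q (s, u)) \<partial>sphere_measure)"
    unfolding sphere_measure_def set_lebesgue_integral_def
    by (rule integral_restrict_space[symmetric]) simp
  also have "\<dots> = (\<integral>u. Q u (hmax J x u) \<partial>sphere_measure)"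
    by (intro Bochner_Integration.integral_cong refl)
      (simp add: interval_integral_q support_fun_convex_hull_finite[OF assms] hmax_def)
  finally show ?thesis by (simp add: W_def weighted_mean_width_def width_const_def)
qed

section \<open>Measurability and boundedness of the width functional\<close>

lemma hmax_measurable:
  assumes "finite J" "J \<noteq> {}" "J \<subseteq> I"
  shows "(\<lambda>p. hmax J (fst p) (snd p)) \<in> borel_measurable ((\<Pi>\<^sub>M i\<in>I. M) \<Otimes>\<^sub>M sphere_measure)"
  unfolding hmax_def
proof (rule borel_measurable_Max[OF assms(1)])
  fix j assume j: "j \<in> J"
  have [measurable]: "(\<lambda>p. snd p) \<in> borel_measurable ((\<Pi>\<^sub>M i\<in>I. M) \<Otimes>\<^sub>M sphere_measure)"
    by (rule measurable_compose[OF measurable_snd ident_sphere_measure])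
  have "(\<lambda>x. x j) \<in> borel_measurable (\<Pi>\<^sub>M i\<in>I. M)"
    using measurable_component_singleton[of j I "\<lambda>_. M"] j assms(3)
    by (auto simp: measurable_cong_sets[OF refl sets_M])
  then have [measurable]: "(\<lambda>p. fst p j) \<in> borel_measurable ((\<Pi>\<^sub>M i\<in>I. M) \<Otimes>\<^sub>M sphere_measure)"
    by (rule measurable_compose[OF measurable_fst])
  show "(\<lambda>p. snd p \<bullet> fst p j) \<in> borel_measurable ((\<Pi>\<^sub>M i\<in>I. M) \<Otimes>\<^sub>M sphere_measure)"
    by measurable
qed

lemma W_measurable:
  assumes "finite J" "J \<noteq> {}" "J \<subseteq> I"
  shows "W J \<in> borel_measurable (\<Pi>\<^sub>M i\<in>I. M)"
proof -
  have [measurable]: "(\<lambda>p. snd p) \<in> borel_measurable ((\<Pi>\<^sub>M i\<in>I. M) \<Otimes>\<^sub>M sphere_measure)"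
    by (rule measurable_compose[OF measurable_snd ident_sphere_measure])
  note hmax_measurable[OF assms, measurable]
  have "(\<lambda>(x, u). Q u (hmax J x u)) \<in> borel_measurable ((\<Pi>\<^sub>M i\<in>I. M) \<Otimes>\<^sub>M sphere_measure)"
    unfolding case_prod_unfold by measurable
  from sphere.borel_measurable_lebesgue_integral[OF this]
  have "(\<lambda>x. width_const * (\<integral>u. Q u (hmax J x u) \<partial>sphere_measure)) \<in> borel_measurable (\<Pi>\<^sub>M i\<in>I. M)"
    by measurable
  then show ?thesis using W_eq[OF assms(1,2)] by (simp cong: measurable_cong)
qed

lemma hmax_measurable_sphere [measurable]:
  assumes "finite J" "J \<noteq> {}"
  shows "hmax J x \<in> borel_measurable sphere_measure"
  unfolding hmax_def[abs_def]
  using assms by (intro borel_measurable_Max borel_measurable_sphere_measure) auto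

lemma abs_hmax_le:
  assumes "finite J" "J \<noteq> {}" "\<forall>j\<in>J. x j \<in> K" "u \<in> sphere 0 1"
  shows "\<bar>hmax J x u\<bar> \<le> R"
proof -
  have "hmax J x u \<in> (\<lambda>j. u \<bullet> x j) ` J" unfolding hmax_def using assms by (intro Max_in) auto
  then show ?thesis using inner_le_R assms by auto
qed

lemma integrable_q_mass: "integrable sphere_measure (\<lambda>u. enn2real (q_mass u))"
proof (rule integrableI_nonneg)
  have [measurable]: "q_mass \<in> borel_measurable sphere_measure"
    by (rule borel_measurable_sphere_measure) measurable
  show "(\<lambda>u. enn2real (q_mass u)) \<in> borel_measurable sphere_measure" by measurable
  have "(\<integral>\<^sup>+u. ennreal (enn2real (q_mass u)) \<partial>sphere_measure) \<le> (\<integral>\<^sup>+u. q_mass u \<partial>sphere_measure)"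
    by (intro nn_integral_mono) (simp add: ennreal_enn2real_if)
  then show "(\<integral>\<^sup>+u. ennreal (enn2real (q_mass u)) \<partial>sphere_measure) < \<infinity>"
    using q_mass_finite by (rule order_le_less_trans)
qed auto

lemma integrable_Q_hmax:
  assumes "finite J" "J \<noteq> {}" "\<forall>j\<in>J. x j \<in> K"
  shows "integrable sphere_measure (\<lambda>u. Q u (hmax J x u))"
proof (rule Bochner_Integration.integrable_bound[OF integrable_q_mass])
  note [measurable] = ident_sphere_measure hmax_measurable_sphere[OF assms(1,2)]
  show "(\<lambda>u. Q u (hmax J x u)) \<in> borel_measurable sphere_measure"
    by (rule Q_measurable'[OF ident_sphere_measure hmax_measurable_sphere[OF assms(1,2)]])
  have "AE u in sphere_measure. u \<in> sphere 0 1" using AE_space[of sphere_measure] by simp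
  with AE_q_mass_finite show "AE u in sphere_measure. norm (Q u (hmax J x u)) \<le> norm (enn2real (q_mass u))"
  proof eventually_elim
    case (elim u)
    then show ?case using Q_bound[of u "hmax J x u"] abs_hmax_le[OF assms, of u] by simp
  qed
qed

definition W_max :: real where
  "W_max = width_const * (\<integral>u. enn2real (q_mass u) \<partial>sphere_measure)"

lemma abs_W_le:
  assumes "finite J" "J \<noteq> {}" "\<forall>j\<in>J. x j \<in> K"
  shows "\<bar>W J x\<bar> \<le> W_max"
proof -
  have ae: "AE u in sphere_measure. u \<in> sphere 0 1" using AE_space[of sphere_measure] by simp
  have "\<bar>\<integral>u. Q u (hmax J x u) \<partial>sphere_measure\<bar> \<le> (\<integral>u. \<bar>Q u (hmax J x u)\<bar> \<partial>sphere_measure)"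
    by (rule integral_abs_bound)
  also have "\<dots> \<le> (\<integral>u. enn2real (q_mass u) \<partial>sphere_measure)"
  proof (rule integral_mono_AE)
    show "integrable sphere_measure (\<lambda>u. \<bar>Q u (hmax J x u)\<bar>)"
      by (intro integrable_abs integrable_Q_hmax assms)
    show "AE u in sphere_measure. \<bar>Q u (hmax J x u)\<bar> \<le> enn2real (q_mass u)"
      using AE_q_mass_finite ae
    proof eventually_elim
      case (elim u)
      then show ?case using Q_bound[of u "hmax J x u"] abs_hmax_le[OF assms, of u] by simp
    qed
  qed (rule integrable_q_mass)
  finally show ?thesis
    unfolding W_eq[OF assms(1,2)] W_max_def using width_const_nonneg
    by (simp add: abs_mult mult_left_mono)
qed

lemma hmax_insert:
  assumes "finite I" "I \<noteq> {}" "i \<notin> I"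
  shows "hmax (insert i I) (x(i := y)) u = max (u \<bullet> y) (hmax I x u)"
proof -
  have "(\<lambda>j. u \<bullet> (x(i := y)) j) ` I = (\<lambda>j. u \<bullet> x j) ` I"
    using assms(3) by (intro image_cong) auto
  then show ?thesis using assms by (simp add: hmax_def)
qed

text \<open>In direction u the new point raises the support value to the maximum in
  \<open>hmax_insert\<close>, so the increment is the mass of q in the layer between. The layer
  formula holds for almost every u, namely where \<open>q_mass\<close> is finite.\<close>

lemma W_increment_square_le:
  assumes I: "finite I" "I \<noteq> {}" "i \<notin> I" and x: "\<forall>j\<in>I. x j \<in> K" and y: "y \<in> K"
  shows "ennreal ((W (insert i I) (x(i := y)) - W I x)^2) \<le> ennreal (width_const^2) *
    (\<integral>\<^sup>+u. (\<integral>\<^sup>+s. ennreal (qs u s) * indicator {hmax I x u..<max (u \<bullet> y) (hmax I x u)} s \<partial>lborel) \<partial>sphere_measure)^2"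
proof -
  let ?x = "x(i := y)" and ?J = "insert i I"
  let ?f = "\<lambda>u. Q u (hmax ?J ?x u) - Q u (hmax I x u)"
  have J: "finite ?J" "?J \<noteq> {}" "\<forall>j\<in>?J. ?x j \<in> K" using I x y by auto
  have int: "integrable sphere_measure ?f"
    by (intro Bochner_Integration.integrable_diff integrable_Q_hmax J I x)
  have "W ?J ?x - W I x = width_const * (\<integral>u. ?f u \<partial>sphere_measure)"
    unfolding W_eq[OF J(1,2)] W_eq[OF I(1,2)] right_diff_distrib[symmetric]
      Bochner_Integration.integral_diff[OF integrable_Q_hmax[OF J] integrable_Q_hmax[OF I(1,2) x]] ..
  then have eq: "ennreal ((W ?J ?x - W I x)^2) = ennreal (width_const^2) * ennreal \<bar>\<integral>u. ?f u \<partial>sphere_measure\<bar>^2"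
    by (simp add: power_mult_distrib ennreal_mult ennreal_power)
  have "ennreal \<bar>\<integral>u. ?f u \<partial>sphere_measure\<bar> \<le> (\<integral>\<^sup>+u. ennreal (norm (?f u)) \<partial>sphere_measure)"
    using integral_norm_bound_ennreal[OF int] by simp
  also have "\<dots> = (\<integral>\<^sup>+u. (\<integral>\<^sup>+s. ennreal (qs u s) * indicator {hmax I x u..<max (u \<bullet> y) (hmax I x u)} s \<partial>lborel) \<partial>sphere_measure)"
  proof (rule nn_integral_cong_AE)
    have "AE u in sphere_measure. u \<in> sphere 0 1" using AE_space[of sphere_measure] by simp
    with AE_q_mass_finite show "AE u in sphere_measure. ennreal (norm (?f u)) =
        (\<integral>\<^sup>+s. ennreal (qs u s) * indicator {hmax I x u..<max (u \<bullet> y) (hmax I x u)} s \<partial>lborel)"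
    proof eventually_elim
      case (elim u)
      have b: "\<bar>hmax I x u\<bar> \<le> R" "\<bar>u \<bullet> y\<bar> \<le> R"
        using abs_hmax_le[OF I(1,2) x elim(2)] inner_le_R[OF elim(2) y] by auto
      have bounds: "- R \<le> hmax I x u" "hmax I x u \<le> max (u \<bullet> y) (hmax I x u)" "max (u \<bullet> y) (hmax I x u) \<le> R"
        using b by auto
      show ?case
        unfolding hmax_insert[OF I] Q_diff(1)[OF elim(1) bounds, symmetric]
        using Q_diff(2)[OF elim(1) bounds] by simp
    qed
  qed
  finally show ?thesis
    unfolding eq by (intro mult_left_mono power_mono) auto
qed

section \<open>The variance bound\<close>

definition gap :: "nat set \<Rightarrow> (nat \<Rightarrow> 'a) \<Rightarrow> 'a \<Rightarrow> real" where
  "gap I x u = h u - hmax I x u"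

lemma gap_measurable:
  assumes "finite I" "I \<noteq> {}"
  shows "(\<lambda>p. gap I (fst p) (snd p)) \<in> borel_measurable ((\<Pi>\<^sub>M i\<in>I. M) \<Otimes>\<^sub>M sphere_measure)"
proof -
  have "(\<lambda>p. h (snd p)) \<in> borel_measurable ((\<Pi>\<^sub>M i\<in>I. M) \<Otimes>\<^sub>M sphere_measure)"
    by (rule measurable_compose[OF measurable_snd borel_measurable_sphere_measure[OF h_measurable]])
  then show ?thesis
    unfolding gap_def using hmax_measurable[OF assms order_refl] by (rule borel_measurable_diff)
qed

lemma gap_measurable_sphere:
  assumes "finite I" "I \<noteq> {}"
  shows "gap I x \<in> borel_measurable sphere_measure"
  unfolding gap_def[abs_def] using hmax_measurable_sphere[OF assms] borel_measurable_sphere_measure[OF h_measurable]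
  by (intro borel_measurable_diff)

lemma gap_nonneg:
  assumes "finite I" "I \<noteq> {}" "\<forall>j\<in>I. x j \<in> K"
  shows "0 \<le> gap I x u"
  unfolding gap_def hmax_def using assms by (auto intro!: support_fun_ge compact_K)

text \<open>Presents the gap as a minimum of i.i.d. depths, the shape required by
  \<open>nn_integral_Min_quantile_powr_le\<close>.\<close>

lemma gap_eq_Min:
  assumes "finite I" "I \<noteq> {}"
  shows "gap I x u = Min ((\<lambda>i. h u - u \<bullet> x i) ` I)"
proof (rule Min_eqI[symmetric])
  have "hmax I x u \<in> (\<lambda>j. u \<bullet> x j) ` I" unfolding hmax_def using assms by (intro Max_in) auto
  then show "gap I x u \<in> (\<lambda>i. h u - u \<bullet> x i) ` I" by (auto simp: gap_def)
  show "gap I x u \<le> y" if "y \<in> (\<lambda>i. h u - u \<bullet> x i) ` I" for y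
    using that assms by (auto simp: gap_def hmax_def)
qed (use assms in auto)

text \<open>If all gaps are below \<tau>, the layers between the polytope and K lie where q \<le> B.
  Each layer added by y then has mass at most B times the gap, and is empty unless y lies in the
  cap. The square is handled by \<open>nn_integral_square_le\<close> with \<kappa> =
  (d-1)/2.\<close>

lemma increment_le_gap_integral:
  obtains C \<tau> where "0 \<le> C" "0 < \<tau>"
    "\<And>I i x y. finite I \<Longrightarrow> I \<noteq> {} \<Longrightarrow> i \<notin> I \<Longrightarrow> \<forall>j\<in>I. x j \<in> K \<Longrightarrow> y \<in> K \<Longrightarrow>
      \<forall>u\<in>sphere 0 1. gap I x u < \<tau> \<Longrightarrow>
      ennreal ((W (insert i I) (x(i := y)) - W I x)^2) \<le> ennreal C *
        (\<integral>\<^sup>+u. ennreal (gap I x u powr gap_exp DIM('a)) * indicator {u. h u - u \<bullet> y < gap I x u} u \<partial>sphere_measure)"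
proof -
  obtain \<tau> B where \<tau>: "0 < \<tau>" and B: "0 \<le> B"
    and qB: "\<And>s u. u \<in> sphere 0 1 \<Longrightarrow> \<bar>s - h u\<bar> < \<tau> \<Longrightarrow> q (s, u) \<le> B"
    using weight_bounded_near_boundary by blast
  have exp_eq: "gap_exp DIM('a) = 2 + real (DIM('a) - 1) / 2" using dim by (simp add: of_nat_diff field_simps)
  show thesis
  proof (rule that[of "width_const^2 * (B^2 * (2 * normals_const))", OF _ \<tau>])
    show "0 \<le> width_const^2 * (B^2 * (2 * normals_const))" using normals_const_nonneg by simp
    fix I :: "nat set" and i x y
    assume I: "finite I" "I \<noteq> {}" "i \<notin> I" and x: "\<forall>j\<in>I. x j \<in> K" and y: "y \<in> K"
      and good: "\<forall>u\<in>sphere 0 1. gap I x u < \<tau>"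
    let ?f = "\<lambda>u. ennreal (gap I x u) * indicator {u. h u - u \<bullet> y < gap I x u} u"
    let ?rhs = "\<integral>\<^sup>+u. ennreal (gap I x u powr gap_exp DIM('a)) * indicator {u. h u - u \<bullet> y < gap I x u} u \<partial>sphere_measure"
    have Tm[measurable]: "gap I x \<in> borel_measurable sphere_measure"
      by (rule gap_measurable_sphere[OF I(1,2)])
    have Ym[measurable]: "(\<lambda>u. h u - u \<bullet> y) \<in> borel_measurable sphere_measure"
      by (rule borel_measurable_sphere_measure) measurable
    have fm: "?f \<in> borel_measurable sphere_measure" by measurable
    have D: "(\<integral>\<^sup>+s. ennreal (qs u s) * indicator {hmax I x u..<max (u \<bullet> y) (hmax I x u)} s \<partial>lborel) \<le> ennreal B * ?f u"
      if u: "u \<in> sphere 0 1" for u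
    proof (cases "u \<bullet> y \<le> hmax I x u")
      case False
      have yh: "u \<bullet> y \<le> h u" by (rule support_fun_ge[OF compact_K y])
      have "(\<integral>\<^sup>+s. ennreal (qs u s) * indicator {hmax I x u..<max (u \<bullet> y) (hmax I x u)} s \<partial>lborel)
          \<le> (\<integral>\<^sup>+s. ennreal B * indicator {hmax I x u..<u \<bullet> y} s \<partial>lborel)"
      proof (rule nn_integral_mono)
        fix s
        have "qs u s \<le> B" if "hmax I x u \<le> s" "s < u \<bullet> y"
        proof -
          have "\<bar>s - h u\<bar> < \<tau>" using that yh good u by (force simp: gap_def)
          then show ?thesis using qB[OF u] u by (simp add: qs_def)
        qed
        then show "ennreal (qs u s) * indicator {hmax I x u..<max (u \<bullet> y) (hmax I x u)} s
            \<le> ennreal B * indicator {hmax I x u..<u \<bullet> y} s"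
          using False by (auto simp: indicator_def max_def intro!: ennreal_leI)
      qed
      also have "\<dots> = ennreal B * ennreal (u \<bullet> y - hmax I x u)"
        using False by (subst nn_integral_cmult_indicator) auto
      also have "\<dots> \<le> ennreal B * ?f u"
        using False yh by (intro mult_left_mono) (auto simp: gap_def intro!: ennreal_leI)
      finally show ?thesis .
    qed (simp add: max_def)
    have "ennreal ((W (insert i I) (x(i := y)) - W I x)^2) \<le> ennreal (width_const^2) *
      (\<integral>\<^sup>+u. (\<integral>\<^sup>+s. ennreal (qs u s) * indicator {hmax I x u..<max (u \<bullet> y) (hmax I x u)} s \<partial>lborel) \<partial>sphere_measure)^2"
      by (rule W_increment_square_le[OF I x y])
    also have "\<dots> \<le> ennreal (width_const^2) * (\<integral>\<^sup>+u. ennreal B * ?f u \<partial>sphere_measure)^2"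
      using D by (intro mult_left_mono power_mono nn_integral_mono) auto
    also have "(\<integral>\<^sup>+u. ennreal B * ?f u \<partial>sphere_measure) = ennreal B * (\<integral>\<^sup>+u. ?f u \<partial>sphere_measure)"
      by (rule nn_integral_cmult[OF fm])
    also have "(ennreal B * (\<integral>\<^sup>+u. ?f u \<partial>sphere_measure))^2 = ennreal (B^2) * (\<integral>\<^sup>+u. ?f u \<partial>sphere_measure)^2"
      using B by (simp add: power_mult_distrib ennreal_power)
    also have "ennreal (width_const^2) * (ennreal (B^2) * (\<integral>\<^sup>+u. ?f u \<partial>sphere_measure)^2)
        \<le> ennreal (width_const^2) * (ennreal (B^2) * (ennreal (2 * normals_const) * ?rhs))"
    proof (intro mult_left_mono)
      show "(\<integral>\<^sup>+u. ?f u \<partial>sphere_measure)^2 \<le> ennreal (2 * normals_const) * ?rhs"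
        unfolding exp_eq
      proof (rule sphere.nn_integral_square_le[OF Ym Tm])
        show "emeasure sphere_measure {v \<in> space sphere_measure. h v - v \<bullet> y < t}
            \<le> ennreal (normals_const * t powr (real (DIM('a) - 1) / 2))" if "0 < t" for t
          by (rule emeasure_cap_normals_le[OF y that])
        show "0 \<le> h v - v \<bullet> y" for v using support_fun_ge[OF compact_K y, of v] by simp
      qed (rule normals_const_nonneg)
    qed auto
    also have "\<dots> = ennreal (width_const^2 * (B^2 * (2 * normals_const))) * ?rhs"
      using normals_const_nonneg by (simp add: ennreal_mult mult.assoc)
    finally show "ennreal ((W (insert i I) (x(i := y)) - W I x)^2)
      \<le> ennreal (width_const^2 * (B^2 * (2 * normals_const))) * ?rhs" .
  qed
qed

section \<open>Expectation of the squared increment\<close>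

lemma AE_points_in_K: "finite I \<Longrightarrow> AE x in (\<Pi>\<^sub>M i\<in>I. M). \<forall>i\<in>I. x i \<in> K"
  by (intro AE_finite_allI AE_PiM_component AE_M_in_K M.prob_space_axioms)

text \<open>For small t the lower bound on cap probabilities gives
  \<open>t^((d+3)/2) \<le> (G t / c)^b\<close> with b = \<open>quantile_exp\<close>. The factor G t
  for the new point raises the order to 1 + b, and the moment bound for the sample minimum
  applies.\<close>

lemma expected_gap_le:
  obtains C \<tau> where "0 \<le> C" "0 < \<tau>"
    "\<And>I u. finite I \<Longrightarrow> I \<noteq> {} \<Longrightarrow> u \<in> sphere 0 1 \<Longrightarrow>
      (\<integral>\<^sup>+x. ennreal (gap I x u powr gap_exp DIM('a)) * indicator {x. gap I x u < \<tau>} x *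
        emeasure M {y. h u - u \<bullet> y < gap I x u} \<partial>(\<Pi>\<^sub>M i\<in>I. M)) \<le> ennreal (C * real (card I) powr (- (1 + quantile_exp DIM('a))))"
proof -
  obtain c t0 where c: "0 < c" and t0: "0 < t0"
    and cap: "\<And>u t. u \<in> sphere 0 1 \<Longrightarrow> 0 < t \<Longrightarrow> t \<le> t0 \<Longrightarrow>
      c * t powr ((real DIM('a) + 1) / 2) \<le> M.prob {x. h u - u \<bullet> x < t}"
    using prob_cap_ge by blast
  define S where "S = (\<Sum>k. real (Suc k) powr (1 + quantile_exp DIM('a)) * exp (- real k))"
  have S: "0 \<le> S" unfolding S_def by (intro suminf_nonneg summable_powr_exp) auto
  have beta: "0 \<le> quantile_exp DIM('a)" by simp
  show thesis
  proof (rule that[of "c powr (- quantile_exp DIM('a)) * S", OF _ t0])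
    show "0 \<le> c powr (- quantile_exp DIM('a)) * S" using S by simp
    fix I :: "nat set" and u :: 'a assume I: "finite I" "I \<noteq> {}" and u: "u \<in> sphere 0 1"
    define G where "G t = M.prob {y. h u - u \<bullet> y < t}" for t
    have "(\<integral>\<^sup>+x. ennreal (gap I x u powr gap_exp DIM('a)) * indicator {x. gap I x u < t0} x *
        emeasure M {y. h u - u \<bullet> y < gap I x u} \<partial>(\<Pi>\<^sub>M i\<in>I. M))
      \<le> (\<integral>\<^sup>+x. ennreal (c powr (- quantile_exp DIM('a))) * ennreal (G (gap I x u) powr (1 + quantile_exp DIM('a))) \<partial>(\<Pi>\<^sub>M i\<in>I. M))"
    proof (rule nn_integral_mono_AE)
      show "AE x in (\<Pi>\<^sub>M i\<in>I. M). ennreal (gap I x u powr gap_exp DIM('a)) * indicator {x. gap I x u < t0} x *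
          emeasure M {y. h u - u \<bullet> y < gap I x u} \<le> ennreal (c powr (- quantile_exp DIM('a))) * ennreal (G (gap I x u) powr (1 + quantile_exp DIM('a)))"
        using AE_points_in_K[OF I(1)]
      proof eventually_elim
        case (elim x)
        define t where "t = gap I x u"
        have t: "0 \<le> t" unfolding t_def using gap_nonneg[OF I elim] .
        show ?case
        proof (cases "0 < t \<and> t < t0")
          case True
          have Gt: "c * t powr ((real DIM('a) + 1) / 2) \<le> G t"
            unfolding G_def using cap[OF u] True by simp
          have G0: "0 < G t" 
          proof (rule less_le_trans[OF _ Gt])
            show "0 < c * t powr ((real DIM('a) + 1) / 2)" using c True by simp
          qed
          have "t powr gap_exp DIM('a) = (t powr ((real DIM('a) + 1) / 2)) powr quantile_exp DIM('a)"
          proof -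
            have "real DIM('a) + 1 \<noteq> 0" by linarith
            then have "(real DIM('a) + 1) / 2 * quantile_exp DIM('a) = gap_exp DIM('a)" by (simp add: divide_simps)
            then show ?thesis by (simp only: powr_powr)
          qed
          also have "\<dots> \<le> (G t / c) powr quantile_exp DIM('a)"
            using Gt c beta by (intro powr_mono2) (auto simp: field_simps)
          also have "\<dots> = c powr (- quantile_exp DIM('a)) * G t powr quantile_exp DIM('a)"
            using c G0 by (simp add: powr_divide powr_minus field_simps)
          finally have "t powr gap_exp DIM('a) * G t \<le> c powr (- quantile_exp DIM('a)) * G t powr quantile_exp DIM('a) * G t"
            using G0 by (intro mult_right_mono) auto
          also have "\<dots> = c powr (- quantile_exp DIM('a)) * G t powr (1 + quantile_exp DIM('a))"
            using G0 by (simp add: powr_add)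
          finally have le: "t powr gap_exp DIM('a) * G t \<le> c powr (- quantile_exp DIM('a)) * G t powr (1 + quantile_exp DIM('a))" .
          have "ennreal (t powr gap_exp DIM('a)) * emeasure M {y. h u - u \<bullet> y < t} = ennreal (t powr gap_exp DIM('a) * G t)"
            by (simp add: G_def M.emeasure_eq_measure ennreal_mult')
          also have "\<dots> \<le> ennreal (c powr (- quantile_exp DIM('a)) * G t powr (1 + quantile_exp DIM('a)))" by (rule ennreal_leI[OF le])
          also have "\<dots> = ennreal (c powr (- quantile_exp DIM('a))) * ennreal (G t powr (1 + quantile_exp DIM('a)))" by (simp add: ennreal_mult')
          finally show ?thesis using True by (simp add: t_def)
        next
          \<comment> \<open>Both remaining cases give 0: \<open>0 powr a\<close> is 0 at t = 0, and
            the indicator vanishes for t \<ge> t0.\<close>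
          case False
          then show ?thesis using t by (auto simp: t_def[symmetric] indicator_def)
        qed
      qed
    qed
    also have "\<dots> = ennreal (c powr (- quantile_exp DIM('a))) * (\<integral>\<^sup>+x. ennreal (G (gap I x u) powr (1 + quantile_exp DIM('a))) \<partial>(\<Pi>\<^sub>M i\<in>I. M))"
    proof (rule nn_integral_cmult)
      have "mono G" unfolding G_def mono_def by (auto intro!: M.finite_measure_mono)
      then have "G \<in> borel_measurable borel" by (rule borel_measurable_mono)
      moreover have "(\<lambda>x. gap I x u) \<in> borel_measurable (\<Pi>\<^sub>M i\<in>I. M)"
      proof -
        have "(\<lambda>x. (x, u)) \<in> (\<Pi>\<^sub>M i\<in>I. M) \<rightarrow>\<^sub>M (\<Pi>\<^sub>M i\<in>I. M) \<Otimes>\<^sub>M sphere_measure"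
          by (intro measurable_Pair measurable_const measurable_ident_sets refl) (use u in simp)
        from measurable_compose[OF this gap_measurable[OF I]] show ?thesis by simp
      qed
      ultimately have "(\<lambda>x. G (gap I x u)) \<in> borel_measurable (\<Pi>\<^sub>M i\<in>I. M)"
        by (rule measurable_compose[rotated])
      then show "(\<lambda>x. ennreal (G (gap I x u) powr (1 + quantile_exp DIM('a)))) \<in> borel_measurable (\<Pi>\<^sub>M i\<in>I. M)" by measurable
    qed
    also have "\<dots> \<le> ennreal (c powr (- quantile_exp DIM('a))) * ennreal (S * real (card I) powr (- (1 + quantile_exp DIM('a))))"
    proof (intro mult_left_mono)
      have "(\<lambda>y. h u - u \<bullet> y) \<in> borel_measurable M" by measurable
      from M.nn_integral_Min_quantile_powr_le[OF this I, of "1 + quantile_exp DIM('a)"]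
      show "(\<integral>\<^sup>+x. ennreal (G (gap I x u) powr (1 + quantile_exp DIM('a))) \<partial>(\<Pi>\<^sub>M i\<in>I. M)) \<le> ennreal (S * real (card I) powr (- (1 + quantile_exp DIM('a))))"
        by (simp add: gap_eq_Min[OF I] S_def G_def)
    qed simp
    also have "\<dots> = ennreal (c powr (- quantile_exp DIM('a)) * S * real (card I) powr (- (1 + quantile_exp DIM('a))))"
      using S by (simp add: ennreal_mult'[symmetric] mult.assoc)
    finally show "(\<integral>\<^sup>+x. ennreal (gap I x u powr gap_exp DIM('a)) * indicator {x. gap I x u < t0} x *
        emeasure M {y. h u - u \<bullet> y < gap I x u} \<partial>(\<Pi>\<^sub>M i\<in>I. M))
      \<le> ennreal (c powr (- quantile_exp DIM('a)) * S * real (card I) powr (- (1 + quantile_exp DIM('a))))" .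
  qed
qed

text \<open>Outside the bad set the pointwise gap bound is integrated, with y innermost so that the
  cap probability appears. On the bad set a constant bound meets an exponentially small probability,
  which \<open>exp_le_powr\<close> turns into the same power of the sample size.\<close>

lemma expected_increment_le:
  obtains C where "0 \<le> C"
    "\<And>I i. finite I \<Longrightarrow> I \<noteq> {} \<Longrightarrow> i \<notin> I \<Longrightarrow>
      (\<integral>\<^sup>+x. \<integral>\<^sup>+y. ennreal ((W (insert i I) (x(i := y)) - W I x)^2) \<partial>M \<partial>(\<Pi>\<^sub>M i\<in>I. M))
      \<le> ennreal (C * real (card I) powr (- (1 + quantile_exp DIM('a))))"
proof -
  let ?\<gamma> = "1 + quantile_exp DIM('a)"
  obtain C1 \<tau>1 where C1: "0 \<le> C1" "0 < \<tau>1" and good: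
    "\<And>I i x y. finite I \<Longrightarrow> I \<noteq> {} \<Longrightarrow> i \<notin> I \<Longrightarrow> \<forall>j\<in>I. x j \<in> K \<Longrightarrow> y \<in> K \<Longrightarrow>
      \<forall>u\<in>sphere 0 1. gap I x u < \<tau>1 \<Longrightarrow>
      ennreal ((W (insert i I) (x(i := y)) - W I x)^2) \<le> ennreal C1 *
        (\<integral>\<^sup>+u. ennreal (gap I x u powr gap_exp DIM('a)) * indicator {u. h u - u \<bullet> y < gap I x u} u \<partial>sphere_measure)"
  proof (rule increment_le_gap_integral, goal_cases)
    case (1 C \<tau>)
    from 1(2-) show ?case by (rule 1(1))
  qed
  obtain C2 \<tau>2 where C2: "0 \<le> C2" "0 < \<tau>2" and expected:
    "\<And>I u. finite I \<Longrightarrow> I \<noteq> {} \<Longrightarrow> u \<in> sphere 0 1 \<Longrightarrow>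
      (\<integral>\<^sup>+x. ennreal (gap I x u powr gap_exp DIM('a)) * indicator {x. gap I x u < \<tau>2} x *
        emeasure M {y. h u - u \<bullet> y < gap I x u} \<partial>(\<Pi>\<^sub>M i\<in>I. M)) \<le> ennreal (C2 * real (card I) powr (- ?\<gamma>))"
  proof (rule expected_gap_le, goal_cases)
    case (1 C \<tau>)
    from 1(2-) show ?case by (rule 1(1))
  qed
  define \<tau> where "\<tau> = min \<tau>1 \<tau>2"
  have \<tau>: "0 < \<tau>" "\<tau> \<le> \<tau>1" "\<tau> \<le> \<tau>2" using C1 C2 by (auto simp: \<tau>_def)
  obtain N p :: real and bad :: "nat set \<Rightarrow> (nat \<Rightarrow> 'a) set" where p: "0 < p" and N: "0 \<le> N"
    and bad: "\<And>I. finite I \<Longrightarrow> bad I \<in> sets (\<Pi>\<^sub>M i\<in>I. M)"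
    "\<And>I. finite I \<Longrightarrow> emeasure (\<Pi>\<^sub>M i\<in>I. M) (bad I) \<le> ennreal (N * exp (- p * card I))"
    "\<And>I x u. finite I \<Longrightarrow> x \<in> space (\<Pi>\<^sub>M i\<in>I. M) \<Longrightarrow> x \<notin> bad I \<Longrightarrow> \<forall>i\<in>I. x i \<in> K \<Longrightarrow> u \<in> sphere 0 1 \<Longrightarrow>
      \<exists>i\<in>I. h u - u \<bullet> x i < \<tau>"
  proof (rule bad_event[OF \<tau>(1)], goal_cases)
    case (1 N p bad)
    from 1(2-) show ?case by (rule 1(1))
  qed
  obtain C3 where C3: "0 \<le> C3" "\<And>m::nat. 0 < m \<Longrightarrow> exp (- p * m) \<le> C3 * real m powr (- ?\<gamma>)"
    using exp_le_powr[OF p] by metis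
  define s where "s = measure sphere_measure (space sphere_measure :: 'a set)"
  define A where "A = (2 * W_max)^2"
  show thesis
  proof (rule that[of "C1 * (C2 * s) + A * (N * C3)"])
    show "0 \<le> C1 * (C2 * s) + A * (N * C3)" using C1 C2 C3 N by (simp add: s_def A_def)
    fix I :: "nat set" and i assume I: "finite I" "I \<noteq> {}" "i \<notin> I"
    let ?P = "\<Pi>\<^sub>M i\<in>I. M" and ?m = "card I"
    interpret pp: product_prob_space "\<lambda>_. M" I by unfold_locales
    interpret PS: pair_sigma_finite ?P sphere_measure ..
    interpret MS: pair_sigma_finite M sphere_measure ..
    \<comment> \<open>The restriction to gaps below \<tau>2 is built into f so that the integrals
      can be interchanged over the whole space before \<open>expected_gap_le\<close> is used. For
      points in K outside the bad set it is always satisfied.\<close>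
    define f where "f x y u = ennreal (gap I x u powr gap_exp DIM('a)) * indicator {u. gap I x u < \<tau>2} u
      * indicator {u. h u - u \<bullet> y < gap I x u} u" for x y u
    define g where "g x u = ennreal (gap I x u powr gap_exp DIM('a)) * indicator {x. gap I x u < \<tau>2} x
      * emeasure M {y. h u - u \<bullet> y < gap I x u}" for x u
    have m: "0 < ?m" using I by (simp add: card_gt_0_iff)
    have f_meas: "(\<lambda>(p, y). f (fst p) y (snd p)) \<in> borel_measurable ((?P \<Otimes>\<^sub>M sphere_measure) \<Otimes>\<^sub>M M)"
    proof -
      note gm = gap_measurable[OF I(1,2)]
      have [measurable]: "(\<lambda>z. gap I (fst (fst z)) (snd (fst z))) \<in> borel_measurable ((?P \<Otimes>\<^sub>M sphere_measure) \<Otimes>\<^sub>M M)"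
        by (rule measurable_compose[OF measurable_fst gm])
      have u[measurable]: "(\<lambda>z. snd (fst z)) \<in> borel_measurable ((?P \<Otimes>\<^sub>M sphere_measure) \<Otimes>\<^sub>M M)"
        by (rule measurable_compose[OF measurable_compose[OF measurable_fst measurable_snd] ident_sphere_measure])
      have y[measurable]: "(\<lambda>z. snd z) \<in> borel_measurable ((?P \<Otimes>\<^sub>M sphere_measure) \<Otimes>\<^sub>M M)"
        using measurable_snd by (simp add: measurable_cong_sets[OF refl sets_M])
      have [measurable]: "(\<lambda>z. h (snd (fst z)) - snd (fst z) \<bullet> snd z) \<in> borel_measurable ((?P \<Otimes>\<^sub>M sphere_measure) \<Otimes>\<^sub>M M)"
        using measurable_compose[OF u h_measurable] by measurable
      show ?thesis
        unfolding f_def case_prod_unfold indicator_def mem_Collect_eq by measurable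
    qed
    have f_int: "(\<integral>\<^sup>+y. f x y u \<partial>M) = g x u" for x u
    proof -
      have "(\<integral>\<^sup>+y. f x y u \<partial>M) = (\<integral>\<^sup>+y. ennreal (gap I x u powr gap_exp DIM('a)) * indicator {x. gap I x u < \<tau>2} x
          * indicator {y. h u - u \<bullet> y < gap I x u} y \<partial>M)"
        by (intro nn_integral_cong) (auto simp: f_def indicator_def)
      also have "\<dots> = g x u" unfolding g_def by (rule nn_integral_cmult_indicator) measurable
      finally show ?thesis .
    qed
    have g_meas: "(\<lambda>(x, u). g x u) \<in> borel_measurable (?P \<Otimes>\<^sub>M sphere_measure)"
      using M.borel_measurable_nn_integral[OF f_meas] by (simp add: f_int case_prod_unfold)
    have fx_meas: "(\<lambda>(y, u). f x y u) \<in> borel_measurable (M \<Otimes>\<^sub>M sphere_measure)" if "x \<in> space ?P" for x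
    proof -
      have "(\<lambda>z. ((x, snd z), fst z)) \<in> M \<Otimes>\<^sub>M sphere_measure \<rightarrow>\<^sub>M (?P \<Otimes>\<^sub>M sphere_measure) \<Otimes>\<^sub>M M"
        by (intro measurable_Pair measurable_const that measurable_snd measurable_fst)
      from measurable_compose[OF this f_meas] show ?thesis by (simp add: case_prod_unfold)
    qed
    have point: "ennreal ((W (insert i I) (x(i := y)) - W I x)^2)
        \<le> ennreal C1 * (\<integral>\<^sup>+u. f x y u \<partial>sphere_measure) + ennreal A * indicator (bad I) x"
      if x: "x \<in> space ?P" "\<forall>j\<in>I. x j \<in> K" and y: "y \<in> K" for x y
    proof (cases "x \<in> bad I")
      case True
      have J: "finite (insert i I)" "insert i I \<noteq> {}" "\<forall>j\<in>insert i I. (x(i := y)) j \<in> K"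
        using I x y by auto
      have "\<bar>W (insert i I) (x(i := y)) - W I x\<bar> \<le> 2 * W_max"
        using abs_W_le[OF J] abs_W_le[OF I(1,2) x(2)] by linarith
      from power_mono[OF this abs_ge_zero, of 2]
      have "ennreal ((W (insert i I) (x(i := y)) - W I x)^2) \<le> ennreal A"
        by (intro ennreal_leI) (simp add: A_def)
      then show ?thesis using True by (simp add: add_increasing)
    next
      case False
      have gap: "gap I x u < \<tau>" if u: "u \<in> sphere 0 1" for u
      proof -
        obtain j where j: "j \<in> I" "h u - u \<bullet> x j < \<tau>" using bad(3)[OF I(1) x(1) False x(2) u] by blast
        have "gap I x u \<le> h u - u \<bullet> x j" unfolding gap_eq_Min[OF I(1,2)] using I j by (intro Min_le) auto
        then show ?thesis using j by simp
      qed
      have "ennreal ((W (insert i I) (x(i := y)) - W I x)^2) \<le> ennreal C1 *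
        (\<integral>\<^sup>+u. ennreal (gap I x u powr gap_exp DIM('a)) * indicator {u. h u - u \<bullet> y < gap I x u} u \<partial>sphere_measure)"
        using gap \<tau>(2) by (intro good I x y) (meson less_le_trans)
      also have "\<dots> = ennreal C1 * (\<integral>\<^sup>+u. f x y u \<partial>sphere_measure)"
      proof (intro arg_cong[where f = "\<lambda>z. ennreal C1 * z"] nn_integral_cong)
        fix u :: 'a assume "u \<in> space sphere_measure"
        then have "gap I x u < \<tau>2" using gap[of u] \<tau> by simp
        then show "ennreal (gap I x u powr gap_exp DIM('a)) * indicator {u. h u - u \<bullet> y < gap I x u} u = f x y u"
          by (simp add: f_def)
      qed
      finally show ?thesis by (simp add: add_increasing2)
    qed
    have inner: "(\<integral>\<^sup>+y. ennreal ((W (insert i I) (x(i := y)) - W I x)^2) \<partial>M)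
        \<le> ennreal C1 * (\<integral>\<^sup>+u. g x u \<partial>sphere_measure) + ennreal A * indicator (bad I) x"
      if x: "x \<in> space ?P" "\<forall>j\<in>I. x j \<in> K" for x
    proof -
      note [measurable] = fx_meas[OF x(1)]
      have [measurable]: "(\<lambda>y. \<integral>\<^sup>+u. f x y u \<partial>sphere_measure) \<in> borel_measurable M"
        by (rule sphere.borel_measurable_nn_integral) measurable
      have "(\<integral>\<^sup>+y. ennreal ((W (insert i I) (x(i := y)) - W I x)^2) \<partial>M)
          \<le> (\<integral>\<^sup>+y. ennreal C1 * (\<integral>\<^sup>+u. f x y u \<partial>sphere_measure) + ennreal A * indicator (bad I) x \<partial>M)"
        by (intro nn_integral_mono_AE) (use AE_M_in_K in eventually_elim, rule point[OF x])
      also have "\<dots> = ennreal C1 * (\<integral>\<^sup>+y. (\<integral>\<^sup>+u. f x y u \<partial>sphere_measure) \<partial>M) + ennreal A * indicator (bad I) x"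
        by (simp add: nn_integral_add nn_integral_cmult M.emeasure_space_1[simplified])
      also have "(\<integral>\<^sup>+y. (\<integral>\<^sup>+u. f x y u \<partial>sphere_measure) \<partial>M) = (\<integral>\<^sup>+u. (\<integral>\<^sup>+y. f x y u \<partial>M) \<partial>sphere_measure)"
        by (rule MS.Fubini'[symmetric]) (rule fx_meas[OF x(1)])
      finally show ?thesis unfolding f_int .
    qed
    have gi_meas: "(\<lambda>x. \<integral>\<^sup>+u. g x u \<partial>sphere_measure) \<in> borel_measurable ?P"
      by (rule sphere.borel_measurable_nn_integral[OF g_meas])
    have "(\<integral>\<^sup>+x. \<integral>\<^sup>+y. ennreal ((W (insert i I) (x(i := y)) - W I x)^2) \<partial>M \<partial>?P)
        \<le> (\<integral>\<^sup>+x. ennreal C1 * (\<integral>\<^sup>+u. g x u \<partial>sphere_measure) + ennreal A * indicator (bad I) x \<partial>?P)"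
    proof (rule nn_integral_mono_AE)
      show "AE x in ?P. (\<integral>\<^sup>+y. ennreal ((W (insert i I) (x(i := y)) - W I x)^2) \<partial>M)
        \<le> ennreal C1 * (\<integral>\<^sup>+u. g x u \<partial>sphere_measure) + ennreal A * indicator (bad I) x"
        using AE_points_in_K[OF I(1)] AE_space[of ?P] by eventually_elim (rule inner)
    qed
    also have "\<dots> = ennreal C1 * (\<integral>\<^sup>+x. (\<integral>\<^sup>+u. g x u \<partial>sphere_measure) \<partial>?P) + ennreal A * emeasure ?P (bad I)"
      using gi_meas bad(1)[OF I(1)]
      by (subst nn_integral_add) (auto simp: nn_integral_cmult nn_integral_cmult_indicator)
    also have "(\<integral>\<^sup>+x. (\<integral>\<^sup>+u. g x u \<partial>sphere_measure) \<partial>?P) = (\<integral>\<^sup>+u. (\<integral>\<^sup>+x. g x u \<partial>?P) \<partial>sphere_measure)"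
      by (rule PS.Fubini'[symmetric]) (rule g_meas)
    also have "ennreal C1 * (\<integral>\<^sup>+u. (\<integral>\<^sup>+x. g x u \<partial>?P) \<partial>sphere_measure) + ennreal A * emeasure ?P (bad I)
        \<le> ennreal C1 * ennreal (C2 * ?m powr (- ?\<gamma>) * s) + ennreal A * ennreal (N * (C3 * ?m powr (- ?\<gamma>)))"
    proof (intro add_mono mult_left_mono)
      have "(\<integral>\<^sup>+u. (\<integral>\<^sup>+x. g x u \<partial>?P) \<partial>sphere_measure) \<le> (\<integral>\<^sup>+u. ennreal (C2 * ?m powr (- ?\<gamma>)) \<partial>(sphere_measure :: 'a measure))"
        using expected[OF I(1,2)] by (intro nn_integral_mono) (simp add: g_def)
      also have "\<dots> = ennreal (C2 * ?m powr (- ?\<gamma>)) * ennreal s"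
        using sphere.emeasure_eq_measure[of "sphere 0 1 :: 'a set"] by (simp add: s_def)
      also have "\<dots> = ennreal (C2 * ?m powr (- ?\<gamma>) * s)"
        using C2 by (simp add: ennreal_mult' s_def)
      finally show "(\<integral>\<^sup>+u. (\<integral>\<^sup>+x. g x u \<partial>?P) \<partial>sphere_measure) \<le> ennreal (C2 * ?m powr (- ?\<gamma>) * s)" .
      have "emeasure ?P (bad I) \<le> ennreal (N * exp (- p * ?m))" by (rule bad(2)[OF I(1)])
      also have "\<dots> \<le> ennreal (N * (C3 * ?m powr (- ?\<gamma>)))"
        using C3(2)[OF m] N by (intro ennreal_leI mult_left_mono)
      finally show "emeasure ?P (bad I) \<le> ennreal (N * (C3 * ?m powr (- ?\<gamma>)))" .
    qed auto
    also have "\<dots> = ennreal (C1 * (C2 * ?m powr (- ?\<gamma>) * s) + A * (N * (C3 * ?m powr (- ?\<gamma>))))"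
      using C1(1) C2(1) C3(1) N by (simp add: ennreal_mult[symmetric] ennreal_plus[symmetric] s_def A_def del: ennreal_plus)
    also have "C1 * (C2 * ?m powr (- ?\<gamma>) * s) + A * (N * (C3 * ?m powr (- ?\<gamma>)))
        = (C1 * (C2 * s) + A * (N * C3)) * ?m powr (- ?\<gamma>)"
      by (simp only: distrib_right mult_ac)
    finally show "(\<integral>\<^sup>+x. \<integral>\<^sup>+y. ennreal ((W (insert i I) (x(i := y)) - W I x)^2) \<partial>M \<partial>?P)
      \<le> ennreal ((C1 * (C2 * s) + A * (N * C3)) * ?m powr (- ?\<gamma>))" .
  qed
qed

text \<open>\<open>Efron_Stein\<close> asks for bounds everywhere, whereas \<open>W\<close> is bounded only where all points lie in \<open>K\<close>.\<close>

definition clamp :: "real \<Rightarrow> real" where "clamp z = max (- W_max) (min W_max z)"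

lemma W_max_nonneg: "0 \<le> W_max"
  unfolding W_max_def using width_const_nonneg by (intro mult_nonneg_nonneg integral_nonneg_AE) auto

lemma abs_clamp_le: "\<bar>clamp z\<bar> \<le> W_max"
  using W_max_nonneg by (auto simp: clamp_def)

lemma clamp_eq: "\<bar>z\<bar> \<le> W_max \<Longrightarrow> clamp z = z"
  by (auto simp: clamp_def)

lemma clamp_measurable: "f \<in> borel_measurable N \<Longrightarrow> (\<lambda>x. clamp (f x)) \<in> borel_measurable N"
  unfolding clamp_def by (intro borel_measurable_max borel_measurable_min borel_measurable_const)

lemma AE_clamp_W:
  assumes "finite I" "J \<subseteq> I" "J \<noteq> {}"
  shows "AE x in (\<Pi>\<^sub>M i\<in>I. M). clamp (W J x) = W J x"
  using AE_points_in_K[OF assms(1)]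
proof eventually_elim
  case (elim x)
  then show ?case using assms by (intro clamp_eq abs_W_le) (auto intro: finite_subset)
qed

lemma variance_clamp:
  fixes n :: nat
  assumes n: "n \<ge> 1"
  shows "prob_space.variance (\<Pi>\<^sub>M i\<in>{..<n}. M) (W {..<n})
    = prob_space.variance (\<Pi>\<^sub>M i\<in>{..<n}. M) (\<lambda>x. clamp (W {..<n} x))"
proof -
  let ?P = "\<Pi>\<^sub>M i\<in>{..<n}. M" and ?F = "W {..<n}"
  have ne: "{..<n} \<noteq> {}" using n by (auto simp: lessThan_empty_iff)
  have ae: "AE x in ?P. clamp (?F x) = ?F x" by (rule AE_clamp_W) (use ne in auto)
  note Fm[measurable] = W_measurable[OF finite_lessThan ne order_refl]
  note cm[measurable] = clamp_measurable[OF Fm]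
  have e: "integral\<^sup>L ?P (\<lambda>x. clamp (?F x)) = integral\<^sup>L ?P ?F"
    by (rule integral_cong_AE[OF cm Fm ae])
  show ?thesis unfolding e
  proof (rule integral_cong_AE)
    show "AE x in ?P. (?F x - integral\<^sup>L ?P ?F)^2 = (clamp (?F x) - integral\<^sup>L ?P ?F)^2"
      using ae by eventually_elim simp
  qed measurable
qed

text \<open>Efron-Stein with the leave-one-out widths: each of the n terms is an expected squared
  increment over n - 1 points, of order n to the power -(1 + \<open>quantile_exp\<close>).\<close>

lemma variance_W_le:
  obtains c where "0 < c" "\<And>n. n \<ge> 1 \<Longrightarrow>
    prob_space.variance (\<Pi>\<^sub>M i\<in>{..<n}. M) (W {..<n}) \<le> c * real n powr (- quantile_exp DIM('a))"
proof -
  let ?\<gamma> = "1 + quantile_exp DIM('a)"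
  obtain C where C: "0 \<le> C" and incr:
    "\<And>I i. finite I \<Longrightarrow> I \<noteq> {} \<Longrightarrow> i \<notin> I \<Longrightarrow>
      (\<integral>\<^sup>+x. \<integral>\<^sup>+y. ennreal ((W (insert i I) (x(i := y)) - W I x)^2) \<partial>M \<partial>(\<Pi>\<^sub>M i\<in>I. M))
      \<le> ennreal (C * real (card I) powr (- ?\<gamma>))"
  proof (rule expected_increment_le, goal_cases)
    case (1 C)
    from 1(2-) show ?case by (rule 1(1))
  qed
  \<comment> \<open>The first summand serves n \<ge> 2, the second n = 1, and 1 keeps c
    positive.\<close>
  define c where "c = C * 2 powr ?\<gamma> + W_max^2 + 1"
  have c: "0 < c" "C * 2 powr ?\<gamma> \<le> c" "W_max^2 \<le> c"
  proof -
    have "0 \<le> C * 2 powr ?\<gamma>" "0 \<le> W_max^2" using C by auto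
    then show "0 < c" "C * 2 powr ?\<gamma> \<le> c" "W_max^2 \<le> c" unfolding c_def by linarith+
  qed
  show thesis
  proof (rule that[OF c(1)])
    fix n :: nat assume n: "n \<ge> 1"
    let ?I = "{..<n}"
    let ?P = "\<Pi>\<^sub>M i\<in>?I. M" and ?F = "\<lambda>x. clamp (W ?I x)"
    interpret P: prob_space ?P by (rule prob_space_PiM) (rule M.prob_space_axioms)
    have ne: "?I \<noteq> {}" using n by (auto simp: lessThan_empty_iff)
    note Fm[measurable] = W_measurable[OF finite_lessThan ne order_refl]
    note clamp_measurable[OF Fm, measurable]
    have Fm': "?F \<in> borel_measurable ?P" by (rule clamp_measurable[OF Fm])
    have "P.variance ?F \<le> c * real n powr (- quantile_exp DIM('a))"
    proof (cases "n = 1")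
      \<comment> \<open>Leaving out the only point would leave an empty hull, so the trivial bound
        by the second moment is used.\<close>
      case True
      have "P.variance ?F \<le> P.expectation (\<lambda>x. (?F x - 0)^2)"
        using P.expectation_square_diff[OF Fm' abs_clamp_le, of 0] by simp
      also have "\<dots> \<le> P.expectation (\<lambda>x. W_max^2)"
        using power_mono[OF abs_clamp_le abs_ge_zero, where n = 2] by (intro integral_mono') auto
      also have "\<dots> \<le> c" using c(3) by (simp add: P.prob_space)
      finally show ?thesis using True by simp
    next
      case False
      define G where "G i x = clamp (W (?I - {i}) x)" for i x
      have ne': "?I - {i} \<noteq> {}" for i
      proof -
        have "n \<ge> 2" using n False by simp
        then have "(if i = 0 then 1 else 0) \<in> ?I - {i}" by auto
        then show ?thesis by blast
      qed
      have Gm[measurable]: "G i \<in> borel_measurable ?P" for i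
        unfolding G_def using W_measurable[of "?I - {i}" ?I] ne' by (intro clamp_measurable) auto
      have W_upd: "W (?I - {i}) (x(i := y)) = W (?I - {i}) x" for i x y
      proof -
        have "(x(i := y)) ` (?I - {i}) = x ` (?I - {i})" by (intro image_cong) auto
        then show ?thesis by (simp add: W_def)
      qed
      have "P.variance ?F \<le> (\<Sum>i\<in>?I. \<integral>x. (?F x - G i x)^2 \<partial>?P)"
      proof (rule Efron_Stein[OF M.prob_space_axioms finite_lessThan Fm', where B = W_max])
        show "\<bar>G i x\<bar> \<le> W_max" for i x by (simp add: G_def abs_clamp_le)
        show "G i (x(i := y)) = G i x" for i x y unfolding G_def W_upd ..
      qed (rule abs_clamp_le Gm)+
      also have "\<dots> \<le> (\<Sum>i\<in>?I. C * real (n - 1) powr (- ?\<gamma>))"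
      proof (rule sum_mono)
        fix i assume i: "i \<in> ?I"
        let ?J = "?I - {i}"
        have ins: "insert i ?J = ?I" using i by auto
        interpret pp: product_prob_space "\<lambda>_. M" ?I by unfold_locales
        have sq: "\<bar>(?F x - G i x)^2\<bar> \<le> (2 * W_max)^2" for x
        proof -
          have "\<bar>?F x - G i x\<bar> \<le> 2 * W_max"
            using abs_clamp_le[of "W ?I x"] abs_clamp_le[of "W ?J x"] unfolding G_def by linarith
          from power_mono[OF this abs_ge_zero, of 2] show ?thesis by simp
        qed
        have int: "integrable ?P (\<lambda>x. (?F x - G i x)^2)"
          using sq by (intro P.integrable_const_bound[where B = "(2 * W_max)^2"]) auto
        have Wm[measurable]: "W ?J \<in> borel_measurable ?P"
          using ne' by (intro W_measurable) auto
        have meas: "(\<lambda>x. ennreal ((W ?I x - W ?J x)^2)) \<in> borel_measurable (\<Pi>\<^sub>M i\<in>insert i ?J. M)"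
          unfolding ins by measurable
        have "ennreal (\<integral>x. (?F x - G i x)^2 \<partial>?P) = (\<integral>\<^sup>+x. ennreal ((?F x - G i x)^2) \<partial>?P)"
          by (rule nn_integral_eq_integral[symmetric, OF int]) simp
        also have "\<dots> = (\<integral>\<^sup>+x. ennreal ((W ?I x - W ?J x)^2) \<partial>?P)"
        proof (rule nn_integral_cong_AE)
          have "AE x in ?P. clamp (W ?I x) = W ?I x" "AE x in ?P. clamp (W ?J x) = W ?J x"
            using ne ne' by (auto intro!: AE_clamp_W)
          then show "AE x in ?P. ennreal ((?F x - G i x)^2) = ennreal ((W ?I x - W ?J x)^2)"
            by eventually_elim (simp add: G_def)
        qed
        also have "\<dots> = (\<integral>\<^sup>+x. ennreal ((W ?I x - W ?J x)^2) \<partial>(\<Pi>\<^sub>M i\<in>insert i ?J. M))" by (simp only: ins)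
        \<comment> \<open>Splitting off coordinate i makes the omitted point the one that is added
          to the other n - 1.\<close>
        also have "\<dots> = (\<integral>\<^sup>+x. \<integral>\<^sup>+y. ennreal ((W ?I (x(i := y)) - W ?J (x(i := y)))^2) \<partial>M \<partial>(\<Pi>\<^sub>M i\<in>?J. M))"
          by (rule pp.product_nn_integral_insert[OF _ _ meas]) auto
        also have "\<dots> = (\<integral>\<^sup>+x. \<integral>\<^sup>+y. ennreal ((W (insert i ?J) (x(i := y)) - W ?J x)^2) \<partial>M \<partial>(\<Pi>\<^sub>M i\<in>?J. M))"
          unfolding ins W_upd ..
        also have "\<dots> \<le> ennreal (C * real (card ?J) powr (- ?\<gamma>))"
          by (rule incr) (use ne' in auto)
        finally have "ennreal (\<integral>x. (?F x - G i x)^2 \<partial>?P) \<le> ennreal (C * real (n - 1) powr (- ?\<gamma>))"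
          using i by simp
        then show "(\<integral>x. (?F x - G i x)^2 \<partial>?P) \<le> C * real (n - 1) powr (- ?\<gamma>)"
          using C by (subst (asm) ennreal_le_iff) auto
      qed
      also have "\<dots> = real n * (C * real (n - 1) powr (- ?\<gamma>))"
        by (simp only: sum_constant card_lessThan)
      also have "\<dots> \<le> real n * (C * (real n / 2) powr (- ?\<gamma>))"
      proof (intro mult_left_mono powr_mono2')
        \<comment> \<open>Holds since n \<ge> 2 here; it converts the rate in n - 1 into one in n at
          the price of \<open>2 powr ?\<gamma>\<close>.\<close>
        show "real n / 2 \<le> real (n - 1)" using n False by (simp add: of_nat_diff)
        have "0 \<le> quantile_exp DIM('a)" by simp
        then show "- ?\<gamma> \<le> 0" by linarith
      qed (use n C in auto)
      also have "\<dots> = C * 2 powr ?\<gamma> * real n powr (- quantile_exp DIM('a))"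
      proof -
        have "(real n / 2) powr (- g) = 2 powr g * real n powr (- g)" for g
          by (simp add: powr_divide powr_minus field_simps)
        then have "real n * (C * (real n / 2) powr (- ?\<gamma>)) = C * 2 powr ?\<gamma> * (real n * real n powr (- ?\<gamma>))"
          by (simp only: mult_ac)
        also have "real n * real n powr (- ?\<gamma>) = real n powr (- quantile_exp DIM('a))"
          using n powr_add[of "real n" 1 "- ?\<gamma>"] by simp
        finally show ?thesis .
      qed
      also have "\<dots> \<le> c * real n powr (- quantile_exp DIM('a))"
        using c(2) by (intro mult_right_mono) auto
      finally show ?thesis .
    qed
    then show "P.variance (W ?I) \<le> c * real n powr (- quantile_exp DIM('a))"
      unfolding variance_clamp[OF n] .
  qed
qed

end

theorem theorem3p4:
  fixes K :: "'a::euclidean_space set"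
    and \<rho> :: "'a \<Rightarrow> real"
    and q :: "real \<times> 'a \<Rightarrow> real"
  assumes "DIM('a) \<ge> 2"
    and "convex_body K"
    and "0 \<in> interior K"
    and "\<exists>a r. r > 0 \<and> rolls_freely (cball a r) K"
    and "prob_density_on K \<rho>"
    and "locally_integrable_weight q"
    and "\<forall>p \<in> frontier K. \<rho> p > 0 \<and> continuous (at p within K) \<rho>"
    and "\<forall>z \<in> support_graph K. continuous (at z within UNIV \<times> sphere 0 1) q"
  shows "\<exists>c>0. \<forall>n\<ge>1.
    prob_space.variance (iid_points K \<rho> n) (\<lambda>x. weighted_mean_width q (random_polytope n x))
      \<le> c * real n powr (- (real DIM('a) + 3) / (real DIM('a) + 1))"
proof -
  obtain a r where r: "r > 0" "rolls_freely (cball a r) K" using assms(4) by blast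
  interpret random_body K r \<rho> q
  proof
    show "convex K" "compact K" using assms(2) by (auto simp: convex_body_def)
    show "\<exists>c. p \<in> cball c r \<and> cball c r \<subseteq> K" if p: "p \<in> frontier K" for p
    proof -
      have "\<exists>v. p \<in> (+) v ` cball a r \<and> (+) v ` cball a r \<subseteq> K"
        using r(2)[unfolded rolls_freely_def] p by (rule bspec)
      then show ?thesis
      proof (elim exE)
        fix v assume "p \<in> (+) v ` cball a r \<and> (+) v ` cball a r \<subseteq> K"
        then have "p \<in> cball (v + a) r \<and> cball (v + a) r \<subseteq> K"
          by (simp only: cball_translation)
        then show ?thesis by (rule exI)
      qed
    qed
    show "\<rho> p > 0 \<and> continuous (at p within K) \<rho>" if "p \<in> frontier K" for p
      using assms(7) that by (rule bspec)
    show "continuous (at z within UNIV \<times> sphere 0 1) q" if "z \<in> support_graph K" for z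
      using assms(8) that by (rule bspec)
  qed (fact assms r)+
  obtain c where c: "0 < c" "\<And>n. n \<ge> 1 \<Longrightarrow>
      prob_space.variance (\<Pi>\<^sub>M i\<in>{..<n}. M) (W {..<n}) \<le> c * real n powr (- quantile_exp DIM('a))"
  proof (rule variance_W_le, goal_cases)
    case (1 c)
    from 1(2-) show ?case by (rule 1(1))
  qed
  have "W {..<n} = (\<lambda>x. weighted_mean_width q (random_polytope n x))" for n
    by (simp add: W_def random_polytope_def fun_eq_iff)
  moreover have "- (real DIM('a) + 3) / (real DIM('a) + 1) = - quantile_exp DIM('a)"
    by (simp only: minus_divide_left)
  ultimately show ?thesis using c by (intro exI[of _ c]) (simp only: iid_points_eq simp_thms, blast)
qed

end
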